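(* Let $d\in\mathbb N_+$ and $Q\in\mathcal E_{\operatorname{Pol}_1(A)}$. Then there is an isomorphism of algebras $W_{d,Q}^{\operatorname{cyc}}(A)\cong W_d^{Q}(A)$.
   Context: Conventions. $\Bbbk$ is a commutative ring. All algebras are associative unital $\Bbbk$-superalgebras; $\bar f\in\mathbb Z_2$ is the parity of $f$; formulas with parities are for homogeneous elements and extended linearly. $\mathbb N_+=\{1,2,\dots\}$. Tensor products of superalgebras: $(f'\otimes g)(f\otimes g')=(-1)^{\bar f\bar g}f'f\otimes gg'$. For an algebra $F$, $Z(F)=\{f: fg=(-1)^{\bar f\bar g}gf\ \forall g\in F\}$; $f\in F$ is regular if it is neither a left nor a right zero-divisor. $\mathcal E_F$ is the set of even, central, regular elements of $F$, and $\widehat{\mathcal E}_F=\mathcal E_F\cup\{\mathsf I\}$ with $\mathsf I$ a formal symbol. Frobenius superalgebra. $A$ is a fixed Frobenius superalgebra, free over $\Bbbk$ with homogeneous (finite) basis $B$, with homogeneous trace map $\operatorname{tr}\colon A\to\Bbbk$ of parity $\varepsilon\in\mathbb Z_2$, Nakayama automorphism $\psi$ (so $\operatorname{tr}(ab)=(-1)^{\bar a\bar b}\operatorname{tr}(b\psi(a))$), and left dual basis $\{b^\vee:b\in B\}$ with $\operatorname{tr}(b^\vee c)=\delta_{b,c}$. For $a\in A$, $a_i=1^{\otimes(i-1)}\otimes a\otimes 1^{\otimes(n-i)}\in A^{\otimes n}$. Frobenius polynomial algebra. $\operatorname{Pol}_n(A)$ is the superalgebra generated by $A^{\otimes n}$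 and $x_1,\dots,x_n$ of parity $\varepsilon$ subject to $x_ix_j=(-1)^{\varepsilon}x_jx_i$ ($i\ne j$) and $\mathbf a x_i=(-1)^{\varepsilon\bar{\mathbf a}}x_i\psi_i(\mathbf a)$ for $\mathbf a\in A^{\otimes n}$, where $\psi_i$ applies $\psi$ to the $i$-th factor. Write $x=x_1\in\operatorname{Pol}_1(A)$. For $f=\sum_k a_{(k)}x^k\in\operatorname{Pol}_1(A)$ put $f_i=\sum_k (a_{(k)})_i x_i^k\in\operatorname{Pol}_n(A)$. $S_n$ acts on $\operatorname{Pol}_n(A)$ by superalgebra automorphisms: superpermutation of factors on $A^{\otimes n}$ and $w(x_i)=x_{w(i)}$. Put $t_{i,j}=\sum_{b\in B}(-1)^{\varepsilon\bar b}b_i(b^\vee)_j$. The Frobenius Demazure operators $\partial_i$ ($1\le i\le n-1$) are the $\Bbbk$-linear endomorphisms of $\operatorname{Pol}_n(A)$ determined by $\partial_i(\mathbf a)=0$ for $\mathbf a\in A^{\otimes n}$, $\partial_i(x_i)=t_{i,i+1}$, $\partial_i(x_{i+1})=-t_{i+1,i}$, $\partial_i(x_j)=0$ for $j\neq i,i+1$, and $\partial_i(fg)=\partial_i(f)g+s_i(f)\partial_i(g)$. A strict $\Bbbk$-linear monoidal supercategory is a strict monoidal category enriched in $\Bbbk$-supermodules with super interchange law $(f'\otimes g)\circ(f\otimes g')=(-1)^{\bar f\bar g}(f'\circ f)\otimes(g\circ g')$; juxtaposition denotes composition. $\mathcal{AW}(A)$ is the strict $\Bbbk$-linear monoidal supercategory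 generated by one object $\mathsf I$ and morphisms $\sigma\colon\mathsf I\otimes\mathsf I\to\mathsf I\otimes\mathsf I$ (even), $\langle a\rangle\colon\mathsf I\to\mathsf I$ for $a\in A$ (parity $\bar a$), $\mathsf x\colon\mathsf I\to\mathsf I$ (parity $\varepsilon$), with relations: $\langle 1\rangle=1_{\mathsf I}$, $\lambda\langle a\rangle+\mu\langle b\rangle=\langle\lambda a+\mu b\rangle$, $\langle a\rangle\langle b\rangle=\langle ab\rangle$; $\sigma^2=1$; $(\sigma\otimes1_{\mathsf I})(1_{\mathsf I}\otimes\sigma)(\sigma\otimes1_{\mathsf I})=(1_{\mathsf I}\otimes\sigma)(\sigma\otimes1_{\mathsf I})(1_{\mathsf I}\otimes\sigma)$; $\sigma(\langle a\rangle\otimes1_{\mathsf I})=(1_{\mathsf I}\otimes\langle a\rangle)\sigma$; $\sigma(\mathsf x\otimes1_{\mathsf I})=(1_{\mathsf I}\otimes\mathsf x)\sigma-\sum_{b\in B}(-1)^{\varepsilon\bar b}\langle b\rangle\otimes\langle b^\vee\rangle$; $\langle a\rangle\mathsf x=(-1)^{\varepsilon\bar a}\mathsf x\langle\psi(a)\rangle$. The affine wreath product algebra is $W_n^{\operatorname{aff}}(A)=\operatorname{End}_{\mathcal{AW}(A)}(\mathsf I^{\otimes n})$; $\operatorname{Pol}_n(A)$ is viewed as a subalgebra of it, with $a_i$ (resp. $x_i$) the token $\langle a\rangle$ (resp. dot $\mathsf x$) on the $i$-th strand from the left. For $Q\in\mathcal E_{\operatorname{Pol}_1(A)}$, the cyclotomic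 wreath product algebra $W_n^Q(A)$ is the quotient of $W_n^{\operatorname{aff}}(A)$ by the two-sided ideal generated by $Q_1\in\operatorname{Pol}_n(A)$. $\mathcal{LAW}(A)$ is the strict $\Bbbk$-linear monoidal supercategory whose objects are generated by $\widehat{\mathcal E}_{\operatorname{Pol}_1(A)}$ (objects are words in this set, tensor product is concatenation), with generating morphisms $\sigma,\langle a\rangle,\mathsf x$ as in $\mathcal{AW}(A)$ and even morphisms $\rho_Q\colon Q\otimes\mathsf I\to\mathsf I\otimes Q$, $\lambda_Q\colon\mathsf I\otimes Q\to Q\otimes\mathsf I$ for $Q\in\mathcal E_{\operatorname{Pol}_1(A)}$. For $f=\sum_r a_{(r)}x^r\in\operatorname{Pol}_1(A)$ put $[f]=\sum_r\langle a_{(r)}\rangle\mathsf x^r$. For $f=\sum\mu_{b,c,r,s}(b\otimes c)x_1^rx_2^s\in\operatorname{Pol}_2(A)$ put $[f]_Q=\sum\mu_{b,c,r,s}(\langle b\rangle\otimes1_Q\otimes\langle c\rangle)(\mathsf x^r\otimes1_Q\otimes\mathsf x^s)\in\operatorname{End}(\mathsf I\otimes Q\otimes\mathsf I)$. The relations are those of $\mathcal{AW}(A)$ together with, for all $a\in A$, $Q\in\mathcal E_{\operatorname{Pol}_1(A)}$: $\lambda_Q(\langle a\rangle\otimes1_Q)=(1_Q\otimes\langle a\rangle)\lambda_Q$; $\rho_Q(1_Q\otimes\langle a\rangle)=(\langle a\rangle\otimes1_Q)\rho_Q$; the same two relations with $\langle a\rangle$ replaced by $\mathsf x$; $\rho_Q\lambda_Q=[Q]\otimes1_Q$;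 $\lambda_Q\rho_Q=1_Q\otimes[Q]$; $(\sigma\otimes1_Q)(1_{\mathsf I}\otimes\rho_Q)(\rho_Q\otimes1_{\mathsf I})=(1_{\mathsf I}\otimes\rho_Q)(\rho_Q\otimes1_{\mathsf I})(1_Q\otimes\sigma)$; $(\lambda_Q\otimes1_{\mathsf I})(1_{\mathsf I}\otimes\lambda_Q)(\sigma\otimes1_Q)=(1_Q\otimes\sigma)(\lambda_Q\otimes1_{\mathsf I})(1_{\mathsf I}\otimes\lambda_Q)$; $(\rho_Q\otimes1_{\mathsf I})(1_Q\otimes\sigma)(\lambda_Q\otimes1_{\mathsf I})=(1_{\mathsf I}\otimes\lambda_Q)(\sigma\otimes1_Q)(1_{\mathsf I}\otimes\rho_Q)-[\partial_1(Q_1)]_Q$. For $d\in\mathbb N_+$ and a word $\mathbf Q$ in $\mathcal E_{\operatorname{Pol}_1(A)}$ (of length $|\mathbf Q|$), $\Gamma_{d,\mathbf Q}$ is the set of words of length $d+|\mathbf Q|$ in $\widehat{\mathcal E}_{\operatorname{Pol}_1(A)}$ containing both $\mathsf I^d$ and $\mathbf Q$ as subwords (a subword is obtained by deleting some, not necessarily consecutive, letters). The $(d,\mathbf Q)$-affine wreath product algebra is $W_{d,\mathbf Q}^{\operatorname{aff}}(A)=\operatorname{End}_{\operatorname{Add}(\mathcal{LAW}(A))}\big(\bigoplus_{\mathbf i\in\Gamma_{d,\mathbf Q}}\mathbf i\big)$, where $\operatorname{Add}$ is the additive envelope. For $|\mathbf Q|\ge1$, the cyclotomic $(d,\mathbf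 Q)$-wreath product algebra $W_{d,\mathbf Q}^{\operatorname{cyc}}(A)$ is the quotient of $W_{d,\mathbf Q}^{\operatorname{aff}}(A)$ by the two-sided ideal generated by the identity morphisms $1_{\mathbf i}$ of those $\mathbf i\in\Gamma_{d,\mathbf Q}$ whose first letter is $\mathsf I$. In the claim, $Q$ is regarded as a word of length one. *)

theory Defs
  imports
    "HOL-Algebra.Module"
    "HOL-Algebra.QuotRing"
    "HOL-Library.Z2"
    "HOL-Library.Sublist"
    "HOL-Combinatorics.Transposition"
begin

section \<open>Superalgebras\<close>

text \<open>Parities live in \<^typ>\<open>bit\<close>, the field with two elements; \<open>ksign R p\<close> is
  \<open>(-1)^p\<close> in the ground ring.\<close>

definition ksign :: "('k, 'r) ring_scheme \<Rightarrow> bit \<Rightarrow> 'k" where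
  "ksign R p = (if p = 0 then \<one>\<^bsub>R\<^esub> else \<ominus>\<^bsub>R\<^esub> \<one>\<^bsub>R\<^esub>)"

record ('k, 'a) superalgebra = "('k, 'a) module" +
  hpart :: "bit \<Rightarrow> 'a set"

locale superalgebra = module R F + ring F
  for R :: "('k, 'r) ring_scheme" (structure)
    and F :: "('k, 'a, 'm) superalgebra_scheme" (structure) +
  assumes smult_mult_left:
      "\<lbrakk>c \<in> carrier R; x \<in> carrier F; y \<in> carrier F\<rbrakk> \<Longrightarrow>
        (c \<odot>\<^bsub>F\<^esub> x) \<otimes>\<^bsub>F\<^esub> y = c \<odot>\<^bsub>F\<^esub> (x \<otimes>\<^bsub>F\<^esub> y)"
    and smult_mult_right:
      "\<lbrakk>c \<in> carrier R; x \<in> carrier F; y \<in> carrier F\<rbrakk> \<Longrightarrow>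
        x \<otimes>\<^bsub>F\<^esub> (c \<odot>\<^bsub>F\<^esub> y) = c \<odot>\<^bsub>F\<^esub> (x \<otimes>\<^bsub>F\<^esub> y)"
    and hpart_submodule: "submodule (hpart F p) R F"
    and hpart_span:
      "x \<in> carrier F \<Longrightarrow> \<exists>y \<in> hpart F 0. \<exists>z \<in> hpart F 1. x = y \<oplus>\<^bsub>F\<^esub> z"
    and hpart_inter: "hpart F 0 \<inter> hpart F 1 = {\<zero>\<^bsub>F\<^esub>}"
    and hpart_one: "\<one>\<^bsub>F\<^esub> \<in> hpart F 0"
    and hpart_mult: "\<lbrakk>x \<in> hpart F p; y \<in> hpart F q\<rbrakk> \<Longrightarrow> x \<otimes>\<^bsub>F\<^esub> y \<in> hpart F (p + q)"

text \<open>The parity of a homogeneous element; meaningless on other elements.\<close>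

definition deg :: "('k, 'a, 'm) superalgebra_scheme \<Rightarrow> 'a \<Rightarrow> bit" where
  "deg F f = (if f \<in> hpart F 0 then 0 else 1)"

definition linear_map ::
  "('k, 'r) ring_scheme \<Rightarrow> ('k, 'a, 'm) module_scheme \<Rightarrow> ('k, 'b, 'n) module_scheme
    \<Rightarrow> ('a \<Rightarrow> 'b) \<Rightarrow> bool" where
  "linear_map R M N h \<longleftrightarrow>
    h \<in> carrier M \<rightarrow> carrier N \<and>
    (\<forall>x \<in> carrier M. \<forall>y \<in> carrier M. h (x \<oplus>\<^bsub>M\<^esub> y) = h x \<oplus>\<^bsub>N\<^esub> h y) \<and>
    (\<forall>c \<in> carrier R. \<forall>x \<in> carrier M. h (c \<odot>\<^bsub>M\<^esub> x) = c \<odot>\<^bsub>N\<^esub> h x)"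

definition superalg_iso ::
  "('k, 'r) ring_scheme \<Rightarrow> ('k, 'a, 'm) superalgebra_scheme \<Rightarrow>
    ('k, 'b, 'n) superalgebra_scheme \<Rightarrow> ('a \<Rightarrow> 'b) \<Rightarrow> bool" where
  "superalg_iso R F G h \<longleftrightarrow>
    h \<in> ring_iso F G \<and> linear_map R F G h \<and> (\<forall>p. h ` hpart F p \<subseteq> hpart G p)"

text \<open>The supercentre: its defining identity is imposed on the homogeneous components.\<close>

definition supercenter ::
  "('k, 'r) ring_scheme \<Rightarrow> ('k, 'a, 'm) superalgebra_scheme \<Rightarrow> 'a set" where
  "supercenter R F =
    {f \<in> carrier F. \<exists>h. f = h 0 \<oplus>\<^bsub>F\<^esub> h 1 \<and>
      (\<forall>p. h p \<in> hpart F p \<and>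
        (\<forall>q. \<forall>g \<in> hpart F q. h p \<otimes>\<^bsub>F\<^esub> g = ksign R (p * q) \<odot>\<^bsub>F\<^esub> (g \<otimes>\<^bsub>F\<^esub> h p)))}"

definition regular_elem :: "('a, 'm) ring_scheme \<Rightarrow> 'a \<Rightarrow> bool" where
  "regular_elem F f \<longleftrightarrow> f \<in> carrier F \<and>
    (\<forall>g \<in> carrier F. f \<otimes>\<^bsub>F\<^esub> g = \<zero>\<^bsub>F\<^esub> \<longrightarrow> g = \<zero>\<^bsub>F\<^esub>) \<and>
    (\<forall>g \<in> carrier F. g \<otimes>\<^bsub>F\<^esub> f = \<zero>\<^bsub>F\<^esub> \<longrightarrow> g = \<zero>\<^bsub>F\<^esub>)"

definition ECR ::
  "('k, 'r) ring_scheme \<Rightarrow> ('k, 'a, 'm) superalgebra_scheme \<Rightarrow> 'a set" where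
  "ECR R F = {f \<in> hpart F 0. f \<in> supercenter R F \<and> regular_elem F f}"

definition quot_superalg ::
  "('k, 'a, 'm) superalgebra_scheme \<Rightarrow> 'a set \<Rightarrow> ('k, 'a set) superalgebra" where
  "quot_superalg F I =
    \<lparr>carrier = carrier (F Quot I), mult = mult (F Quot I), one = one (F Quot I),
     zero = zero (F Quot I), add = add (F Quot I),
     smult = (\<lambda>c X. \<Union>x\<in>X. I +>\<^bsub>F\<^esub> (c \<odot>\<^bsub>F\<^esub> x)),
     hpart = (\<lambda>p. (\<lambda>x. I +>\<^bsub>F\<^esub> x) ` hpart F p)\<rparr>"


section \<open>Frobenius superalgebras\<close>

record ('k, 'a) frobenius = "('k, 'a) superalgebra" +
  trace :: "'a \<Rightarrow> 'k"
  eps :: bit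
  nak :: "'a \<Rightarrow> 'a"
  basis :: "'a set"
  ldual :: "'a \<Rightarrow> 'a"

locale frobenius_superalgebra = superalgebra R A
  for R :: "('k, 'r) ring_scheme" (structure)
    and A :: "('k, 'a, 'm) frobenius_scheme" (structure) +
  assumes basis_finite: "finite (basis A)"
    and basis_homogeneous: "basis A \<subseteq> hpart A 0 \<union> hpart A 1"
    and basis_free:
      "a \<in> carrier A \<Longrightarrow>
        \<exists>!c. c \<in> basis A \<rightarrow>\<^sub>E carrier R \<and> a = (\<Oplus>\<^bsub>A\<^esub>b\<in>basis A. c b \<odot>\<^bsub>A\<^esub> b)"
    and trace_closed: "a \<in> carrier A \<Longrightarrow> trace A a \<in> carrier R"
    and trace_add:
      "\<lbrakk>a \<in> carrier A; b \<in> carrier A\<rbrakk> \<Longrightarrow>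
        trace A (a \<oplus>\<^bsub>A\<^esub> b) = trace A a \<oplus>\<^bsub>R\<^esub> trace A b"
    and trace_smult:
      "\<lbrakk>k \<in> carrier R; a \<in> carrier A\<rbrakk> \<Longrightarrow>
        trace A (k \<odot>\<^bsub>A\<^esub> a) = k \<otimes>\<^bsub>R\<^esub> trace A a"
    and trace_parity: "\<lbrakk>a \<in> hpart A p; p \<noteq> eps A\<rbrakk> \<Longrightarrow> trace A a = \<zero>\<^bsub>R\<^esub>"
    and nak_auto: "superalg_iso R A A (nak A)"
    and trace_nak:
      "\<lbrakk>a \<in> hpart A p; b \<in> hpart A q\<rbrakk> \<Longrightarrow>
        trace A (a \<otimes>\<^bsub>A\<^esub> b) = ksign R (p * q) \<otimes>\<^bsub>R\<^esub> trace A (b \<otimes>\<^bsub>A\<^esub> nak A a)"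
    and ldual_closed: "b \<in> basis A \<Longrightarrow> ldual A b \<in> carrier A"
    and ldual_trace:
      "\<lbrakk>b \<in> basis A; c \<in> basis A\<rbrakk> \<Longrightarrow>
        trace A (ldual A b \<otimes>\<^bsub>A\<^esub> c) = (if b = c then \<one>\<^bsub>R\<^esub> else \<zero>\<^bsub>R\<^esub>)"


section \<open>Superalgebras given by generators and relations\<close>

datatype ('k, 'g) aterm =
    AOne
  | AGen 'g
  | AZero
  | APlus "('k, 'g) aterm" "('k, 'g) aterm"
  | AScal 'k "('k, 'g) aterm"
  | AMult "('k, 'g) aterm" "('k, 'g) aterm"

text \<open>Generators come with a predicate \<open>aghom g p\<close> (\<open>g\<close> is homogeneous of parity \<open>p\<close>)
  rather than a parity function, because the families of generators used below are indexed by
  elements of a superalgebra, which need not be homogeneous.\<close>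

record ('k, 'g) apres =
  agens :: "'g set"
  aghom :: "'g \<Rightarrow> bit \<Rightarrow> bool"
  arels :: "(('k, 'g) aterm \<times> ('k, 'g) aterm) set"

primrec awf :: "('k, 'r) ring_scheme \<Rightarrow> ('k, 'g) apres \<Rightarrow> ('k, 'g) aterm \<Rightarrow> bool" where
  "awf R P AOne \<longleftrightarrow> True"
| "awf R P (AGen g) \<longleftrightarrow> g \<in> agens P"
| "awf R P AZero \<longleftrightarrow> True"
| "awf R P (APlus s t) \<longleftrightarrow> awf R P s \<and> awf R P t"
| "awf R P (AScal c t) \<longleftrightarrow> c \<in> carrier R \<and> awf R P t"
| "awf R P (AMult s t) \<longleftrightarrow> awf R P s \<and> awf R P t"

inductive ahomog :: "('k, 'g) apres \<Rightarrow> ('k, 'g) aterm \<Rightarrow> bit \<Rightarrow> bool"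
  for P :: "('k, 'g) apres" where
  "ahomog P AOne 0"
| "aghom P g p \<Longrightarrow> ahomog P (AGen g) p"
| "ahomog P AZero p"
| "ahomog P s p \<Longrightarrow> ahomog P t p \<Longrightarrow> ahomog P (APlus s t) p"
| "ahomog P t p \<Longrightarrow> ahomog P (AScal c t) p"
| "ahomog P s p \<Longrightarrow> ahomog P t q \<Longrightarrow> ahomog P (AMult s t) (p + q)"

inductive aax :: "('k, 'r) ring_scheme \<Rightarrow> ('k, 'g) aterm \<Rightarrow> ('k, 'g) aterm \<Rightarrow> bool"
  for R :: "('k, 'r) ring_scheme" where
  "aax R (APlus (APlus s t) u) (APlus s (APlus t u))"
| "aax R (APlus s t) (APlus t s)"
| "aax R (APlus AZero t) t"
| "aax R (AScal c (APlus s t)) (APlus (AScal c s) (AScal c t))"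
| "aax R (AScal (c \<oplus>\<^bsub>R\<^esub> d) t) (APlus (AScal c t) (AScal d t))"
| "aax R (AScal (c \<otimes>\<^bsub>R\<^esub> d) t) (AScal c (AScal d t))"
| "aax R (AScal \<one>\<^bsub>R\<^esub> t) t"
| "aax R (AScal \<zero>\<^bsub>R\<^esub> t) AZero"
| "aax R (AMult (AMult s t) u) (AMult s (AMult t u))"
| "aax R (AMult AOne t) t"
| "aax R (AMult t AOne) t"
| "aax R (AMult (APlus s t) u) (APlus (AMult s u) (AMult t u))"
| "aax R (AMult s (APlus t u)) (APlus (AMult s t) (AMult s u))"
| "aax R (AMult (AScal c s) t) (AScal c (AMult s t))"
| "aax R (AMult s (AScal c t)) (AScal c (AMult s t))"

inductive aeq ::
  "('k, 'r) ring_scheme \<Rightarrow> ('k, 'g) apres \<Rightarrow> ('k, 'g) aterm \<Rightarrow> ('k, 'g) aterm \<Rightarrow> bool"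
  for R :: "('k, 'r) ring_scheme" and P :: "('k, 'g) apres" where
  aeq_refl: "awf R P t \<Longrightarrow> aeq R P t t"
| aeq_sym: "aeq R P s t \<Longrightarrow> aeq R P t s"
| aeq_trans: "aeq R P s t \<Longrightarrow> aeq R P t u \<Longrightarrow> aeq R P s u"
| aeq_plus: "aeq R P s s' \<Longrightarrow> aeq R P t t' \<Longrightarrow> aeq R P (APlus s t) (APlus s' t')"
| aeq_scal: "c \<in> carrier R \<Longrightarrow> aeq R P t t' \<Longrightarrow> aeq R P (AScal c t) (AScal c t')"
| aeq_mult: "aeq R P s s' \<Longrightarrow> aeq R P t t' \<Longrightarrow> aeq R P (AMult s t) (AMult s' t')"
| aeq_ax: "aax R s t \<Longrightarrow> awf R P s \<Longrightarrow> awf R P t \<Longrightarrow> aeq R P s t"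
| aeq_rel: "(s, t) \<in> arels P \<Longrightarrow> awf R P s \<Longrightarrow> awf R P t \<Longrightarrow> aeq R P s t"

definition acls ::
  "('k, 'r) ring_scheme \<Rightarrow> ('k, 'g) apres \<Rightarrow> ('k, 'g) aterm \<Rightarrow> ('k, 'g) aterm set" where
  "acls R P t = {s. aeq R P t s}"

definition presented_superalg ::
  "('k, 'r) ring_scheme \<Rightarrow> ('k, 'g) apres \<Rightarrow> ('k, ('k, 'g) aterm set) superalgebra" where
  "presented_superalg R P =
    \<lparr>carrier = {acls R P t |t. awf R P t},
     mult = (\<lambda>f g. \<Union>s\<in>f. \<Union>t\<in>g. acls R P (AMult s t)),
     one = acls R P AOne,
     zero = acls R P AZero,
     add = (\<lambda>f g. \<Union>s\<in>f. \<Union>t\<in>g. acls R P (APlus s t)),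
     smult = (\<lambda>c f. \<Union>t\<in>f. acls R P (AScal c t)),
     hpart = (\<lambda>p. {acls R P t |t. awf R P t \<and> ahomog P t p})\<rparr>"

definition asum :: "('k, 'g) aterm list \<Rightarrow> ('k, 'g) aterm" where
  "asum ts = foldr APlus ts AZero"

definition apow :: "('k, 'g) aterm \<Rightarrow> nat \<Rightarrow> ('k, 'g) aterm" where
  "apow t r = (AMult t ^^ r) AOne"


section \<open>Frobenius polynomial algebras\<close>

text \<open>\<open>PT [a\<^sub>1, \<dots>, a\<^sub>n]\<close> is the pure tensor \<open>a\<^sub>1 \<otimes> \<dots> \<otimes> a\<^sub>n\<close> and \<open>PX i\<close> is \<open>x\<^sub>i\<close>.
  Tensor factors and variables are numbered from \<open>1\<close>, list positions from \<open>0\<close>.\<close>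

datatype 'a polgen = PT "'a list" | PX nat

definition hom_tuple ::
  "('k, 'a, 'm) superalgebra_scheme \<Rightarrow> 'a list \<Rightarrow> bit list \<Rightarrow> bool" where
  "hom_tuple A as ps \<longleftrightarrow> list_all2 (\<lambda>a p. a \<in> hpart A p) as ps"

text \<open>The first four relations present \<open>A\<^sup>\<otimes>\<^sup>n\<close>: pure tensors are multilinear, multiply by
  the sign rule (the \<open>j\<close>-th factor on the right passes the \<open>i\<close>-th factor on the left for
  all \<open>j < i\<close>), and \<open>1 \<otimes> \<dots> \<otimes> 1\<close> is the unit.\<close>

inductive_set pol_rels ::
  "('k, 'r) ring_scheme \<Rightarrow> ('k, 'a, 'm) frobenius_scheme \<Rightarrow> nat \<Rightarrow>
    (('k, 'a polgen) aterm \<times> ('k, 'a polgen) aterm) set"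
  for R :: "('k, 'r) ring_scheme" and A :: "('k, 'a, 'm) frobenius_scheme" and n :: nat where
  pol_multilinear:
    "\<lbrakk>as \<in> lists (carrier A); length as = n; i < n; a \<in> carrier A; b \<in> carrier A;
      c \<in> carrier R; d \<in> carrier R\<rbrakk> \<Longrightarrow>
      (AGen (PT (as[i := (c \<odot>\<^bsub>A\<^esub> a) \<oplus>\<^bsub>A\<^esub> (d \<odot>\<^bsub>A\<^esub> b)])),
       APlus (AScal c (AGen (PT (as[i := a])))) (AScal d (AGen (PT (as[i := b])))))
      \<in> pol_rels R A n"
| pol_mult:
    "\<lbrakk>hom_tuple A as ps; hom_tuple A bs qs; length as = n; length bs = n\<rbrakk> \<Longrightarrow>
      (AMult (AGen (PT as)) (AGen (PT bs)),
       AScal (ksign R (\<Sum>i<n. \<Sum>j<i. ps ! i * qs ! j))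
         (AGen (PT (map2 (mult A) as bs))))
      \<in> pol_rels R A n"
| pol_unit: "(AGen (PT (replicate n \<one>\<^bsub>A\<^esub>)), AOne) \<in> pol_rels R A n"
| pol_xx:
    "\<lbrakk>i \<in> {1..n}; j \<in> {1..n}; i \<noteq> j\<rbrakk> \<Longrightarrow>
      (AMult (AGen (PX i)) (AGen (PX j)),
       AScal (ksign R (eps A)) (AMult (AGen (PX j)) (AGen (PX i))))
      \<in> pol_rels R A n"
| pol_ax:
    "\<lbrakk>hom_tuple A as ps; length as = n; i \<in> {1..n}\<rbrakk> \<Longrightarrow>
      (AMult (AGen (PT as)) (AGen (PX i)),
       AScal (ksign R (eps A * sum_list ps))
         (AMult (AGen (PX i)) (AGen (PT (as[i - 1 := nak A (as ! (i - 1))])))))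
      \<in> pol_rels R A n"

definition pol_pres ::
  "('k, 'r) ring_scheme \<Rightarrow> ('k, 'a, 'm) frobenius_scheme \<Rightarrow> nat \<Rightarrow> ('k, 'a polgen) apres" where
  "pol_pres R A n =
    \<lparr>agens = PT ` {as \<in> lists (carrier A). length as = n} \<union> PX ` {1..n},
     aghom = (\<lambda>g p. case g of
        PT as \<Rightarrow> (\<exists>ps. hom_tuple A as ps \<and> sum_list ps = p)
      | PX i \<Rightarrow> p = eps A),
     arels = pol_rels R A n\<rparr>"

definition Pol ::
  "('k, 'r) ring_scheme \<Rightarrow> ('k, 'a, 'm) frobenius_scheme \<Rightarrow> nat \<Rightarrow>
    ('k, ('k, 'a polgen) aterm set) superalgebra" where
  "Pol R A n = presented_superalg R (pol_pres R A n)"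

definition at_factor :: "('k, 'a, 'm) frobenius_scheme \<Rightarrow> nat \<Rightarrow> nat \<Rightarrow> 'a \<Rightarrow> 'a list" where
  "at_factor A n i a = (replicate n \<one>\<^bsub>A\<^esub>)[i - 1 := a]"

text \<open>For coefficients \<open>as = [a\<^sub>0, a\<^sub>1, \<dots>]\<close>, the term \<open>\<Sum>\<^sub>r (a\<^sub>r)\<^sub>i x\<^sub>i\<^sup>r\<close>.\<close>

definition pol_term ::
  "('k, 'a, 'm) frobenius_scheme \<Rightarrow> nat \<Rightarrow> nat \<Rightarrow> 'a list \<Rightarrow> ('k, 'a polgen) aterm" where
  "pol_term A n i as =
    asum (map (\<lambda>r. AMult (AGen (PT (at_factor A n i (as ! r)))) (apow (AGen (PX i)) r))
      [0..<length as])"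

text \<open>The coefficients of \<open>f = \<Sum>\<^sub>r a\<^sub>r x\<^sup>r\<close> in the algebra on one variable; they
  are unique up to trailing zeros.\<close>

definition pol_coeffs ::
  "('k, 'r) ring_scheme \<Rightarrow> ('k, 'a, 'm) frobenius_scheme \<Rightarrow>
    ('k, 'a polgen) aterm set \<Rightarrow> 'a list" where
  "pol_coeffs R A f =
    (SOME as. as \<in> lists (carrier A) \<and> f = acls R (pol_pres R A 1) (pol_term A 1 1 as))"

definition pol_at ::
  "('k, 'r) ring_scheme \<Rightarrow> ('k, 'a, 'm) frobenius_scheme \<Rightarrow> nat \<Rightarrow> nat \<Rightarrow>
    ('k, 'a polgen) aterm set \<Rightarrow> ('k, 'a polgen) aterm set" where
  "pol_at R A n i f = acls R (pol_pres R A n) (pol_term A n i (pol_coeffs R A f))"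

definition pt ::
  "('k, 'r) ring_scheme \<Rightarrow> ('k, 'a, 'm) frobenius_scheme \<Rightarrow> nat \<Rightarrow> 'a list \<Rightarrow>
    ('k, 'a polgen) aterm set" where
  "pt R A n as = acls R (pol_pres R A n) (AGen (PT as))"

definition px ::
  "('k, 'r) ring_scheme \<Rightarrow> ('k, 'a, 'm) frobenius_scheme \<Rightarrow> nat \<Rightarrow> nat \<Rightarrow>
    ('k, 'a polgen) aterm set" where
  "px R A n i = acls R (pol_pres R A n) (AGen (PX i))"

text \<open>The action of the simple transposition \<open>s\<^sub>i\<close>.  It is only specified on the carrier,
  where the conditions determine it.\<close>

definition simple_transposition ::
  "('k, 'r) ring_scheme \<Rightarrow> ('k, 'a, 'm) frobenius_scheme \<Rightarrow> nat \<Rightarrow> nat \<Rightarrow>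
    ('k, 'a polgen) aterm set \<Rightarrow> ('k, 'a polgen) aterm set" where
  "simple_transposition R A n i = (SOME s.
    superalg_iso R (Pol R A n) (Pol R A n) s \<and>
    (\<forall>as ps. hom_tuple A as ps \<and> length as = n \<longrightarrow>
      s (pt R A n as) =
        ksign R (ps ! (i - 1) * ps ! i) \<odot>\<^bsub>Pol R A n\<^esub>
          pt R A n (as[i - 1 := as ! i, i := as ! (i - 1)])) \<and>
    (\<forall>j \<in> {1..n}. s (px R A n j) = px R A n (transpose i (i + 1) j)))"

definition teleporter ::
  "('k, 'r) ring_scheme \<Rightarrow> ('k, 'a, 'm) frobenius_scheme \<Rightarrow> nat \<Rightarrow> nat \<Rightarrow> nat \<Rightarrow>
    ('k, 'a polgen) aterm set" where
  "teleporter R A n i j =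
    (\<Oplus>\<^bsub>Pol R A n\<^esub>b\<in>basis A. ksign R (eps A * deg A b) \<odot>\<^bsub>Pol R A n\<^esub>
      (pt R A n (at_factor A n i b) \<otimes>\<^bsub>Pol R A n\<^esub> pt R A n (at_factor A n j (ldual A b))))"

definition demazure ::
  "('k, 'r) ring_scheme \<Rightarrow> ('k, 'a, 'm) frobenius_scheme \<Rightarrow> nat \<Rightarrow> nat \<Rightarrow>
    ('k, 'a polgen) aterm set \<Rightarrow> ('k, 'a polgen) aterm set" where
  "demazure R A n i = (SOME D.
    linear_map R (Pol R A n) (Pol R A n) D \<and>
    (\<forall>as \<in> lists (carrier A). length as = n \<longrightarrow> D (pt R A n as) = \<zero>\<^bsub>Pol R A n\<^esub>) \<and>
    D (px R A n i) = teleporter R A n i (i + 1) \<and>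
    D (px R A n (i + 1)) = \<ominus>\<^bsub>Pol R A n\<^esub> teleporter R A n (i + 1) i \<and>
    (\<forall>j \<in> {1..n} - {i, i + 1}. D (px R A n j) = \<zero>\<^bsub>Pol R A n\<^esub>) \<and>
    (\<forall>f \<in> carrier (Pol R A n). \<forall>g \<in> carrier (Pol R A n).
      D (f \<otimes>\<^bsub>Pol R A n\<^esub> g) =
        (D f \<otimes>\<^bsub>Pol R A n\<^esub> g) \<oplus>\<^bsub>Pol R A n\<^esub> (simple_transposition R A n i f \<otimes>\<^bsub>Pol R A n\<^esub> D g)))"

text \<open>An expansion of \<open>f = \<Sum> \<mu> (b \<otimes> c) x\<^sub>1\<^sup>r x\<^sub>2\<^sup>s\<close> in the algebra on two variables, as a
  list of tuples \<open>(\<mu>, b, c, r, s)\<close>.\<close>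

definition pol2_coeffs ::
  "('k, 'r) ring_scheme \<Rightarrow> ('k, 'a, 'm) frobenius_scheme \<Rightarrow>
    ('k, 'a polgen) aterm set \<Rightarrow> ('k \<times> 'a \<times> 'a \<times> nat \<times> nat) list" where
  "pol2_coeffs R A f = (SOME L.
    (\<forall>(\<mu>, b, c, r, s) \<in> set L. \<mu> \<in> carrier R \<and> b \<in> basis A \<and> c \<in> basis A) \<and>
    f = acls R (pol_pres R A 2)
      (asum (map (\<lambda>(\<mu>, b, c, r, s).
        AScal \<mu> (AMult (AGen (PT [b, c])) (AMult (apow (AGen (PX 1)) r) (apow (AGen (PX 2)) s))))
        L)))"


section \<open>Supercategories\<close>

record ('k, 'o, 'f) supercategory =
  Obj :: "'o set"
  Mor :: "'o \<Rightarrow> 'o \<Rightarrow> 'f set"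
  MorP :: "'o \<Rightarrow> 'o \<Rightarrow> bit \<Rightarrow> 'f set"
  IdM :: "'o \<Rightarrow> 'f"
  CompM :: "'o \<Rightarrow> 'o \<Rightarrow> 'o \<Rightarrow> 'f \<Rightarrow> 'f \<Rightarrow> 'f"
  ZeroM :: "'o \<Rightarrow> 'o \<Rightarrow> 'f"
  AddM :: "'o \<Rightarrow> 'o \<Rightarrow> 'f \<Rightarrow> 'f \<Rightarrow> 'f"
  ScaleM :: "'o \<Rightarrow> 'o \<Rightarrow> 'k \<Rightarrow> 'f \<Rightarrow> 'f"

text \<open>\<open>CompM C X Y Z g f\<close> is the composite \<open>g f\<close> of \<open>f : X \<rightarrow> Y\<close> and \<open>g : Y \<rightarrow> Z\<close>.\<close>

definition End_alg :: "('k, 'o, 'f) supercategory \<Rightarrow> 'o \<Rightarrow> ('k, 'f) superalgebra" where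
  "End_alg C X =
    \<lparr>carrier = Mor C X X, mult = CompM C X X X, one = IdM C X,
     zero = ZeroM C X X, add = AddM C X X, smult = ScaleM C X X, hpart = MorP C X X\<rparr>"

text \<open>The additive envelope.  An object \<open>(I, X)\<close> is the formal direct sum of the finite family
  \<open>X i\<close> (\<open>i \<in> I\<close>), and \<open>f j i\<close> is the component of \<open>f\<close> from the \<open>i\<close>-th summand of the
  source to the \<open>j\<close>-th summand of the target.  Components outside the index sets are
  \<open>undefined\<close>, so that equality of morphisms is equality of matrices.\<close>

definition restrict2 :: "'i set \<Rightarrow> 'j set \<Rightarrow> ('i \<Rightarrow> 'j \<Rightarrow> 'f) \<Rightarrow> 'i \<Rightarrow> 'j \<Rightarrow> 'f" where
  "restrict2 I J f = (\<lambda>i j. if i \<in> I \<and> j \<in> J then f i j else undefined)"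

definition Add ::
  "('k, 'o, 'f) supercategory \<Rightarrow>
    ('k, 'i set \<times> ('i \<Rightarrow> 'o), 'i \<Rightarrow> 'i \<Rightarrow> 'f) supercategory" where
  "Add C =
    \<lparr>Obj = {(I, X). finite I \<and> X ` I \<subseteq> Obj C},
     Mor = (\<lambda>(I, X) (J, Y). {f. f = restrict2 J I f \<and>
       (\<forall>j\<in>J. \<forall>i\<in>I. f j i \<in> Mor C (X i) (Y j))}),
     MorP = (\<lambda>(I, X) (J, Y) p. {f. f = restrict2 J I f \<and>
       (\<forall>j\<in>J. \<forall>i\<in>I. f j i \<in> MorP C (X i) (Y j) p)}),
     IdM = (\<lambda>(I, X). restrict2 I I (\<lambda>j i. if j = i then IdM C (X i) else ZeroM C (X i) (X j))),
     CompM = (\<lambda>(I, X) (J, Y) (K, Z) g f. restrict2 K I (\<lambda>k i.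
       finprod \<lparr>carrier = Mor C (X i) (Z k), mult = AddM C (X i) (Z k), one = ZeroM C (X i) (Z k)\<rparr>
         (\<lambda>j. CompM C (X i) (Y j) (Z k) (g k j) (f j i)) J)),
     ZeroM = (\<lambda>(I, X) (J, Y). restrict2 J I (\<lambda>j i. ZeroM C (X i) (Y j))),
     AddM = (\<lambda>(I, X) (J, Y) f g. restrict2 J I (\<lambda>j i. AddM C (X i) (Y j) (f j i) (g j i))),
     ScaleM = (\<lambda>(I, X) (J, Y) c f. restrict2 J I (\<lambda>j i. ScaleM C (X i) (Y j) c (f j i)))\<rparr>"

text \<open>The identity of the summand \<open>X k\<close>, as an endomorphism of the direct sum.\<close>

definition summand_id ::
  "('k, 'o, 'f) supercategory \<Rightarrow> 'i set \<times> ('i \<Rightarrow> 'o) \<Rightarrow> 'i \<Rightarrow> 'i \<Rightarrow> 'i \<Rightarrow> 'f" where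
  "summand_id C = (\<lambda>(I, X) k. restrict2 I I (\<lambda>j i.
     if j = k \<and> i = k then IdM C (X k) else ZeroM C (X i) (X j)))"


section \<open>Strict monoidal supercategories given by generators and relations\<close>

text \<open>Objects are words in a set of letters.  \<open>MComp g f\<close> is \<open>g \<circ> f\<close>.\<close>

datatype ('o, 'k, 'g) mterm =
    MId "'o list"
  | MGen 'g
  | MZero "'o list" "'o list"
  | MPlus "('o, 'k, 'g) mterm" "('o, 'k, 'g) mterm"
  | MScal 'k "('o, 'k, 'g) mterm"
  | MComp "('o, 'k, 'g) mterm" "('o, 'k, 'g) mterm"
  | MTens "('o, 'k, 'g) mterm" "('o, 'k, 'g) mterm"

record ('o, 'k, 'g) mpres =
  letters :: "'o set"
  mgens :: "'g set"
  gsrc :: "'g \<Rightarrow> 'o list"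
  gtgt :: "'g \<Rightarrow> 'o list"
  mghom :: "'g \<Rightarrow> bit \<Rightarrow> bool"
  mrels :: "(('o, 'k, 'g) mterm \<times> ('o, 'k, 'g) mterm) set"

primrec msrc :: "('o, 'k, 'g) mpres \<Rightarrow> ('o, 'k, 'g) mterm \<Rightarrow> 'o list" where
  "msrc P (MId X) = X"
| "msrc P (MGen g) = gsrc P g"
| "msrc P (MZero X Y) = X"
| "msrc P (MPlus s t) = msrc P s"
| "msrc P (MScal c t) = msrc P t"
| "msrc P (MComp s t) = msrc P t"
| "msrc P (MTens s t) = msrc P s @ msrc P t"

primrec mtgt :: "('o, 'k, 'g) mpres \<Rightarrow> ('o, 'k, 'g) mterm \<Rightarrow> 'o list" where
  "mtgt P (MId X) = X"
| "mtgt P (MGen g) = gtgt P g"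
| "mtgt P (MZero X Y) = Y"
| "mtgt P (MPlus s t) = mtgt P s"
| "mtgt P (MScal c t) = mtgt P t"
| "mtgt P (MComp s t) = mtgt P s"
| "mtgt P (MTens s t) = mtgt P s @ mtgt P t"

primrec mwf :: "('k, 'r) ring_scheme \<Rightarrow> ('o, 'k, 'g) mpres \<Rightarrow> ('o, 'k, 'g) mterm \<Rightarrow> bool" where
  "mwf R P (MId X) \<longleftrightarrow> X \<in> lists (letters P)"
| "mwf R P (MGen g) \<longleftrightarrow> g \<in> mgens P"
| "mwf R P (MZero X Y) \<longleftrightarrow> X \<in> lists (letters P) \<and> Y \<in> lists (letters P)"
| "mwf R P (MPlus s t) \<longleftrightarrow>
    mwf R P s \<and> mwf R P t \<and> msrc P s = msrc P t \<and> mtgt P s = mtgt P t"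
| "mwf R P (MScal c t) \<longleftrightarrow> c \<in> carrier R \<and> mwf R P t"
| "mwf R P (MComp s t) \<longleftrightarrow> mwf R P s \<and> mwf R P t \<and> mtgt P t = msrc P s"
| "mwf R P (MTens s t) \<longleftrightarrow> mwf R P s \<and> mwf R P t"

inductive mhomog :: "('o, 'k, 'g) mpres \<Rightarrow> ('o, 'k, 'g) mterm \<Rightarrow> bit \<Rightarrow> bool"
  for P :: "('o, 'k, 'g) mpres" where
  "mhomog P (MId X) 0"
| "mghom P g p \<Longrightarrow> mhomog P (MGen g) p"
| "mhomog P (MZero X Y) p"
| "mhomog P s p \<Longrightarrow> mhomog P t p \<Longrightarrow> mhomog P (MPlus s t) p"
| "mhomog P t p \<Longrightarrow> mhomog P (MScal c t) p"
| "mhomog P s p \<Longrightarrow> mhomog P t q \<Longrightarrow> mhomog P (MComp s t) (p + q)"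
| "mhomog P s p \<Longrightarrow> mhomog P t q \<Longrightarrow> mhomog P (MTens s t) (p + q)"

text \<open>The axioms of a strict linear monoidal supercategory: linear structure on morphism spaces,
  category axioms, bilinearity of both products, strict monoidal axioms, and super interchange.
  Only instances with both sides well-formed are used below.\<close>

inductive mon_ax ::
  "('k, 'r) ring_scheme \<Rightarrow> ('o, 'k, 'g) mpres \<Rightarrow>
    ('o, 'k, 'g) mterm \<Rightarrow> ('o, 'k, 'g) mterm \<Rightarrow> bool"
  for R :: "('k, 'r) ring_scheme" and P :: "('o, 'k, 'g) mpres" where
  "mon_ax R P (MPlus (MPlus s t) u) (MPlus s (MPlus t u))"
| "mon_ax R P (MPlus s t) (MPlus t s)"
| "mon_ax R P (MPlus (MZero X Y) t) t"
| "mon_ax R P (MScal c (MPlus s t)) (MPlus (MScal c s) (MScal c t))"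
| "mon_ax R P (MScal (c \<oplus>\<^bsub>R\<^esub> d) t) (MPlus (MScal c t) (MScal d t))"
| "mon_ax R P (MScal (c \<otimes>\<^bsub>R\<^esub> d) t) (MScal c (MScal d t))"
| "mon_ax R P (MScal \<one>\<^bsub>R\<^esub> t) t"
| "mon_ax R P (MScal \<zero>\<^bsub>R\<^esub> t) (MZero (msrc P t) (mtgt P t))"
| "mon_ax R P (MComp (MComp s t) u) (MComp s (MComp t u))"
| "mon_ax R P (MComp (MId X) t) t"
| "mon_ax R P (MComp t (MId X)) t"
| "mon_ax R P (MComp (MPlus s t) u) (MPlus (MComp s u) (MComp t u))"
| "mon_ax R P (MComp s (MPlus t u)) (MPlus (MComp s t) (MComp s u))"
| "mon_ax R P (MComp (MScal c s) t) (MScal c (MComp s t))"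
| "mon_ax R P (MComp s (MScal c t)) (MScal c (MComp s t))"
| "mon_ax R P (MTens (MPlus s t) u) (MPlus (MTens s u) (MTens t u))"
| "mon_ax R P (MTens s (MPlus t u)) (MPlus (MTens s t) (MTens s u))"
| "mon_ax R P (MTens (MScal c s) t) (MScal c (MTens s t))"
| "mon_ax R P (MTens s (MScal c t)) (MScal c (MTens s t))"
| "mon_ax R P (MTens (MTens s t) u) (MTens s (MTens t u))"
| "mon_ax R P (MTens (MId []) t) t"
| "mon_ax R P (MTens t (MId [])) t"
| "mon_ax R P (MTens (MId X) (MId Y)) (MId (X @ Y))"
| "mhomog P f p \<Longrightarrow> mhomog P g q \<Longrightarrow>
    mon_ax R P (MComp (MTens f' g) (MTens f g'))
      (MScal (ksign R (p * q)) (MTens (MComp f' f) (MComp g g')))"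

inductive meq ::
  "('k, 'r) ring_scheme \<Rightarrow> ('o, 'k, 'g) mpres \<Rightarrow>
    ('o, 'k, 'g) mterm \<Rightarrow> ('o, 'k, 'g) mterm \<Rightarrow> bool"
  for R :: "('k, 'r) ring_scheme" and P :: "('o, 'k, 'g) mpres" where
  meq_refl: "mwf R P t \<Longrightarrow> meq R P t t"
| meq_sym: "meq R P s t \<Longrightarrow> meq R P t s"
| meq_trans: "meq R P s t \<Longrightarrow> meq R P t u \<Longrightarrow> meq R P s u"
| meq_plus: "meq R P s s' \<Longrightarrow> meq R P t t' \<Longrightarrow> mwf R P (MPlus s t) \<Longrightarrow>
    meq R P (MPlus s t) (MPlus s' t')"
| meq_scal: "c \<in> carrier R \<Longrightarrow> meq R P t t' \<Longrightarrow> meq R P (MScal c t) (MScal c t')"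
| meq_comp: "meq R P s s' \<Longrightarrow> meq R P t t' \<Longrightarrow> mwf R P (MComp s t) \<Longrightarrow>
    meq R P (MComp s t) (MComp s' t')"
| meq_tens: "meq R P s s' \<Longrightarrow> meq R P t t' \<Longrightarrow> meq R P (MTens s t) (MTens s' t')"
| meq_ax: "mon_ax R P s t \<Longrightarrow> mwf R P s \<Longrightarrow> mwf R P t \<Longrightarrow> meq R P s t"
| meq_rel: "(s, t) \<in> mrels P \<Longrightarrow> mwf R P s \<Longrightarrow> mwf R P t \<Longrightarrow>
    msrc P s = msrc P t \<Longrightarrow> mtgt P s = mtgt P t \<Longrightarrow> meq R P s t"

definition mcls ::
  "('k, 'r) ring_scheme \<Rightarrow> ('o, 'k, 'g) mpres \<Rightarrow> ('o, 'k, 'g) mterm \<Rightarrow>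
    ('o, 'k, 'g) mterm set" where
  "mcls R P t = {s. meq R P t s}"

definition presented_supercat ::
  "('k, 'r) ring_scheme \<Rightarrow> ('o, 'k, 'g) mpres \<Rightarrow>
    ('k, 'o list, ('o, 'k, 'g) mterm set) supercategory" where
  "presented_supercat R P =
    \<lparr>Obj = lists (letters P),
     Mor = (\<lambda>X Y. {mcls R P t |t. mwf R P t \<and> msrc P t = X \<and> mtgt P t = Y}),
     MorP = (\<lambda>X Y p. {mcls R P t |t.
       mwf R P t \<and> msrc P t = X \<and> mtgt P t = Y \<and> mhomog P t p}),
     IdM = (\<lambda>X. mcls R P (MId X)),
     CompM = (\<lambda>X Y Z g f. \<Union>s\<in>g. \<Union>t\<in>f. mcls R P (MComp s t)),
     ZeroM = (\<lambda>X Y. mcls R P (MZero X Y)),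
     AddM = (\<lambda>X Y f g. \<Union>s\<in>f. \<Union>t\<in>g. mcls R P (MPlus s t)),
     ScaleM = (\<lambda>X Y c f. \<Union>t\<in>f. mcls R P (MScal c t))\<rparr>"

definition mminus ::
  "('k, 'r) ring_scheme \<Rightarrow> ('o, 'k, 'g) mterm \<Rightarrow> ('o, 'k, 'g) mterm \<Rightarrow> ('o, 'k, 'g) mterm" where
  "mminus R s t = MPlus s (MScal (\<ominus>\<^bsub>R\<^esub> \<one>\<^bsub>R\<^esub>) t)"

definition msum ::
  "'o list \<Rightarrow> 'o list \<Rightarrow> ('o, 'k, 'g) mterm list \<Rightarrow> ('o, 'k, 'g) mterm" where
  "msum X Y ts = foldr MPlus ts (MZero X Y)"

definition mpow :: "'o list \<Rightarrow> ('o, 'k, 'g) mterm \<Rightarrow> nat \<Rightarrow> ('o, 'k, 'g) mterm" where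
  "mpow X t r = (MComp t ^^ r) (MId X)"


section \<open>The affine wreath product category and its cyclotomic quotients\<close>

datatype 'a awgen = Sigma | Tok 'a | Dot

primrec awgen_hom :: "('k, 'a, 'm) frobenius_scheme \<Rightarrow> 'a awgen \<Rightarrow> bit \<Rightarrow> bool" where
  "awgen_hom A Sigma p \<longleftrightarrow> p = 0"
| "awgen_hom A (Tok a) p \<longleftrightarrow> a \<in> hpart A p"
| "awgen_hom A Dot p \<longleftrightarrow> p = eps A"

definition aw_gens :: "('k, 'a, 'm) frobenius_scheme \<Rightarrow> 'a awgen set" where
  "aw_gens A = {Sigma, Dot} \<union> Tok ` carrier A"

primrec aw_width :: "'a awgen \<Rightarrow> nat" where
  "aw_width Sigma = 2"
| "aw_width (Tok a) = 1"
| "aw_width Dot = 1"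

text \<open>The relations are parametrised by the generating object \<open>i\<close> and an embedding \<open>e\<close> of the
  generating morphisms, so that they can be shared by both categories.  The sum over the basis is
  written along any enumeration \<open>bs\<close> of it.\<close>

inductive_set aw_rels ::
  "('k, 'r) ring_scheme \<Rightarrow> ('k, 'a, 'm) frobenius_scheme \<Rightarrow> 'o \<Rightarrow> ('a awgen \<Rightarrow> 'g) \<Rightarrow>
    (('o, 'k, 'g) mterm \<times> ('o, 'k, 'g) mterm) set"
  for R :: "('k, 'r) ring_scheme" and A :: "('k, 'a, 'm) frobenius_scheme"
    and i :: 'o and e :: "'a awgen \<Rightarrow> 'g" where
  tok_one: "(MGen (e (Tok \<one>\<^bsub>A\<^esub>)), MId [i]) \<in> aw_rels R A i e"
| tok_linear:
    "\<lbrakk>a \<in> carrier A; b \<in> carrier A; c \<in> carrier R; d \<in> carrier R\<rbrakk> \<Longrightarrow>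
      (MPlus (MScal c (MGen (e (Tok a)))) (MScal d (MGen (e (Tok b)))),
       MGen (e (Tok ((c \<odot>\<^bsub>A\<^esub> a) \<oplus>\<^bsub>A\<^esub> (d \<odot>\<^bsub>A\<^esub> b))))) \<in> aw_rels R A i e"
| tok_mult:
    "\<lbrakk>a \<in> carrier A; b \<in> carrier A\<rbrakk> \<Longrightarrow>
      (MComp (MGen (e (Tok a))) (MGen (e (Tok b))), MGen (e (Tok (a \<otimes>\<^bsub>A\<^esub> b))))
      \<in> aw_rels R A i e"
| sigma_square:
    "(MComp (MGen (e Sigma)) (MGen (e Sigma)), MId [i, i]) \<in> aw_rels R A i e"
| sigma_braid:
    "(MComp (MTens (MGen (e Sigma)) (MId [i]))
        (MComp (MTens (MId [i]) (MGen (e Sigma))) (MTens (MGen (e Sigma)) (MId [i]))),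
      MComp (MTens (MId [i]) (MGen (e Sigma)))
        (MComp (MTens (MGen (e Sigma)) (MId [i])) (MTens (MId [i]) (MGen (e Sigma)))))
      \<in> aw_rels R A i e"
| sigma_tok:
    "a \<in> carrier A \<Longrightarrow>
      (MComp (MGen (e Sigma)) (MTens (MGen (e (Tok a))) (MId [i])),
       MComp (MTens (MId [i]) (MGen (e (Tok a)))) (MGen (e Sigma))) \<in> aw_rels R A i e"
| sigma_dot:
    "\<lbrakk>distinct bs; set bs = basis A\<rbrakk> \<Longrightarrow>
      (MComp (MGen (e Sigma)) (MTens (MGen (e Dot)) (MId [i])),
       mminus R (MComp (MTens (MId [i]) (MGen (e Dot))) (MGen (e Sigma)))
         (msum [i, i] [i, i] (map (\<lambda>b. MScal (ksign R (eps A * deg A b))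
           (MTens (MGen (e (Tok b))) (MGen (e (Tok (ldual A b)))))) bs)))
      \<in> aw_rels R A i e"
| tok_dot:
    "a \<in> hpart A p \<Longrightarrow>
      (MComp (MGen (e (Tok a))) (MGen (e Dot)),
       MScal (ksign R (eps A * p)) (MComp (MGen (e Dot)) (MGen (e (Tok (nak A a))))))
      \<in> aw_rels R A i e"

definition aw_pres ::
  "('k, 'r) ring_scheme \<Rightarrow> ('k, 'a, 'm) frobenius_scheme \<Rightarrow> (unit, 'k, 'a awgen) mpres" where
  "aw_pres R A =
    \<lparr>letters = UNIV, mgens = aw_gens A,
     gsrc = (\<lambda>g. replicate (aw_width g) ()), gtgt = (\<lambda>g. replicate (aw_width g) ()),
     mghom = awgen_hom A, mrels = aw_rels R A () id\<rparr>"

definition AW ::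
  "('k, 'r) ring_scheme \<Rightarrow> ('k, 'a, 'm) frobenius_scheme \<Rightarrow>
    ('k, unit list, (unit, 'k, 'a awgen) mterm set) supercategory" where
  "AW R A = presented_supercat R (aw_pres R A)"

definition W_aff ::
  "('k, 'r) ring_scheme \<Rightarrow> ('k, 'a, 'm) frobenius_scheme \<Rightarrow> nat \<Rightarrow>
    ('k, (unit, 'k, 'a awgen) mterm set) superalgebra" where
  "W_aff R A n = End_alg (AW R A) (replicate n ())"

text \<open>A one-strand generator placed on the \<open>i\<close>-th of \<open>n\<close> strands.\<close>

definition on_strand :: "nat \<Rightarrow> nat \<Rightarrow> 'a awgen \<Rightarrow> (unit, 'k, 'a awgen) mterm" where
  "on_strand n i g =
    MTens (MId (replicate (i - 1) ())) (MTens (MGen g) (MId (replicate (n - i) ())))"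

text \<open>The image in \<open>W_aff R A n\<close> of \<open>f\<^sub>i = \<Sum>\<^sub>r (a\<^sub>r)\<^sub>i x\<^sub>i\<^sup>r\<close>, where \<open>f = \<Sum>\<^sub>r a\<^sub>r x\<^sup>r\<close>.\<close>

definition pol_in_W ::
  "('k, 'r) ring_scheme \<Rightarrow> ('k, 'a, 'm) frobenius_scheme \<Rightarrow> nat \<Rightarrow> nat \<Rightarrow>
    ('k, 'a polgen) aterm set \<Rightarrow> (unit, 'k, 'a awgen) mterm set" where
  "pol_in_W R A n i f =
    (let as = pol_coeffs R A f; X = replicate n () in
      mcls R (aw_pres R A) (msum X X
        (map (\<lambda>r. MComp (on_strand n i (Tok (as ! r))) (mpow X (on_strand n i Dot) r))
          [0..<length as])))"

definition W_cyclotomic ::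
  "('k, 'r) ring_scheme \<Rightarrow> ('k, 'a, 'm) frobenius_scheme \<Rightarrow> nat \<Rightarrow>
    ('k, 'a polgen) aterm set \<Rightarrow> ('k, (unit, 'k, 'a awgen) mterm set set) superalgebra" where
  "W_cyclotomic R A n Q =
    quot_superalg (W_aff R A n) (genideal (W_aff R A n) {pol_in_W R A n 1 Q})"


section \<open>The category with additional strands labelled by polynomials\<close>

datatype 'q letter = Istr | Lab 'q

datatype ('a, 'q) lawgen = AG "'a awgen" | Rho 'q | Lam 'q

text \<open>\<open>[f]\<close> as an endomorphism of the generating object.\<close>

definition br ::
  "('k, 'r) ring_scheme \<Rightarrow> ('k, 'a, 'm) frobenius_scheme \<Rightarrow> ('k, 'a polgen) aterm set \<Rightarrow>
    ('q letter, 'k, ('a, 'q) lawgen) mterm" where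
  "br R A f =
    (let as = pol_coeffs R A f in
      msum [Istr] [Istr]
        (map (\<lambda>r. MComp (MGen (AG (Tok (as ! r)))) (mpow [Istr] (MGen (AG Dot)) r))
          [0..<length as]))"

text \<open>\<open>[f]\<^sub>Q\<close> for \<open>f\<close> in the algebra on two variables.\<close>

definition br2 ::
  "('k, 'r) ring_scheme \<Rightarrow> ('k, 'a, 'm) frobenius_scheme \<Rightarrow> 'q \<Rightarrow> ('k, 'a polgen) aterm set \<Rightarrow>
    ('q letter, 'k, ('a, 'q) lawgen) mterm" where
  "br2 R A Q f =
    msum [Istr, Lab Q, Istr] [Istr, Lab Q, Istr]
      (map (\<lambda>(\<mu>, b, c, r, s). MScal \<mu>
        (MComp
          (MTens (MGen (AG (Tok b))) (MTens (MId [Lab Q]) (MGen (AG (Tok c)))))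
          (MTens (mpow [Istr] (MGen (AG Dot)) r)
            (MTens (MId [Lab Q]) (mpow [Istr] (MGen (AG Dot)) s)))))
        (pol2_coeffs R A f))"

abbreviation idI :: "('q letter, 'k, ('a, 'q) lawgen) mterm" where
  "idI \<equiv> MId [Istr]"

abbreviation idL :: "'q \<Rightarrow> ('q letter, 'k, ('a, 'q) lawgen) mterm" where
  "idL Q \<equiv> MId [Lab Q]"

abbreviation sig :: "('q letter, 'k, ('a, 'q) lawgen) mterm" where
  "sig \<equiv> MGen (AG Sigma)"

inductive_set law_rels ::
  "('k, 'r) ring_scheme \<Rightarrow> ('k, 'a, 'm) frobenius_scheme \<Rightarrow>
    ((('k, 'a polgen) aterm set letter, 'k, ('a, ('k, 'a polgen) aterm set) lawgen) mterm \<times>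
     (('k, 'a polgen) aterm set letter, 'k, ('a, ('k, 'a polgen) aterm set) lawgen) mterm) set"
  for R :: "('k, 'r) ring_scheme" and A :: "('k, 'a, 'm) frobenius_scheme" where
  law_aw: "r \<in> aw_rels R A Istr AG \<Longrightarrow> r \<in> law_rels R A"
| lam_slide:
    "\<lbrakk>Q \<in> ECR R (Pol R A 1); g \<in> insert Dot (Tok ` carrier A)\<rbrakk> \<Longrightarrow>
      (MComp (MGen (Lam Q)) (MTens (MGen (AG g)) (idL Q)),
       MComp (MTens (idL Q) (MGen (AG g))) (MGen (Lam Q))) \<in> law_rels R A"
| rho_slide:
    "\<lbrakk>Q \<in> ECR R (Pol R A 1); g \<in> insert Dot (Tok ` carrier A)\<rbrakk> \<Longrightarrow>
      (MComp (MGen (Rho Q)) (MTens (idL Q) (MGen (AG g))),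
       MComp (MTens (MGen (AG g)) (idL Q)) (MGen (Rho Q))) \<in> law_rels R A"
| rho_lam:
    "Q \<in> ECR R (Pol R A 1) \<Longrightarrow>
      (MComp (MGen (Rho Q)) (MGen (Lam Q)), MTens (br R A Q) (idL Q)) \<in> law_rels R A"
| lam_rho:
    "Q \<in> ECR R (Pol R A 1) \<Longrightarrow>
      (MComp (MGen (Lam Q)) (MGen (Rho Q)), MTens (idL Q) (br R A Q)) \<in> law_rels R A"
| rho_braid:
    "Q \<in> ECR R (Pol R A 1) \<Longrightarrow>
      (MComp (MTens sig (idL Q))
         (MComp (MTens idI (MGen (Rho Q))) (MTens (MGen (Rho Q)) idI)),
       MComp (MTens idI (MGen (Rho Q)))
         (MComp (MTens (MGen (Rho Q)) idI) (MTens (idL Q) sig))) \<in> law_rels R A"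
| lam_braid:
    "Q \<in> ECR R (Pol R A 1) \<Longrightarrow>
      (MComp (MTens (MGen (Lam Q)) idI)
         (MComp (MTens idI (MGen (Lam Q))) (MTens sig (idL Q))),
       MComp (MTens (idL Q) sig)
         (MComp (MTens (MGen (Lam Q)) idI) (MTens idI (MGen (Lam Q))))) \<in> law_rels R A"
| mixed_braid:
    "Q \<in> ECR R (Pol R A 1) \<Longrightarrow>
      (MComp (MTens (MGen (Rho Q)) idI)
         (MComp (MTens (idL Q) sig) (MTens (MGen (Lam Q)) idI)),
       mminus R
         (MComp (MTens idI (MGen (Lam Q)))
           (MComp (MTens sig (idL Q)) (MTens idI (MGen (Rho Q)))))
         (br2 R A Q (demazure R A 2 1 (pol_at R A 2 1 Q)))) \<in> law_rels R A"

primrec law_src :: "('a, 'q) lawgen \<Rightarrow> 'q letter list" where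
  "law_src (AG g) = replicate (aw_width g) Istr"
| "law_src (Rho Q) = [Lab Q, Istr]"
| "law_src (Lam Q) = [Istr, Lab Q]"

primrec law_tgt :: "('a, 'q) lawgen \<Rightarrow> 'q letter list" where
  "law_tgt (AG g) = replicate (aw_width g) Istr"
| "law_tgt (Rho Q) = [Istr, Lab Q]"
| "law_tgt (Lam Q) = [Lab Q, Istr]"

primrec lawgen_hom :: "('k, 'a, 'm) frobenius_scheme \<Rightarrow> ('a, 'q) lawgen \<Rightarrow> bit \<Rightarrow> bool" where
  "lawgen_hom A (AG g) p \<longleftrightarrow> awgen_hom A g p"
| "lawgen_hom A (Rho Q) p \<longleftrightarrow> p = 0"
| "lawgen_hom A (Lam Q) p \<longleftrightarrow> p = 0"

definition law_letters ::
  "('k, 'r) ring_scheme \<Rightarrow> ('k, 'a, 'm) frobenius_scheme \<Rightarrow>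
    ('k, 'a polgen) aterm set letter set" where
  "law_letters R A = insert Istr (Lab ` ECR R (Pol R A 1))"

definition law_pres ::
  "('k, 'r) ring_scheme \<Rightarrow> ('k, 'a, 'm) frobenius_scheme \<Rightarrow>
    (('k, 'a polgen) aterm set letter, 'k, ('a, ('k, 'a polgen) aterm set) lawgen) mpres" where
  "law_pres R A =
    \<lparr>letters = law_letters R A,
     mgens = AG ` aw_gens A \<union> Rho ` ECR R (Pol R A 1) \<union> Lam ` ECR R (Pol R A 1),
     gsrc = law_src, gtgt = law_tgt, mghom = lawgen_hom A, mrels = law_rels R A\<rparr>"

definition LAW ::
  "('k, 'r) ring_scheme \<Rightarrow> ('k, 'a, 'm) frobenius_scheme \<Rightarrow>
    ('k, ('k, 'a polgen) aterm set letter list,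
     (('k, 'a polgen) aterm set letter, 'k, ('a, ('k, 'a polgen) aterm set) lawgen) mterm set)
    supercategory" where
  "LAW R A = presented_supercat R (law_pres R A)"

definition Gam ::
  "('k, 'r) ring_scheme \<Rightarrow> ('k, 'a, 'm) frobenius_scheme \<Rightarrow> nat \<Rightarrow>
    ('k, 'a polgen) aterm set list \<Rightarrow> ('k, 'a polgen) aterm set letter list set" where
  "Gam R A d Qs =
    {w \<in> lists (law_letters R A). length w = d + length Qs \<and>
      subseq (replicate d Istr) w \<and> subseq (map Lab Qs) w}"

definition W_aff_words ::
  "('k, 'r) ring_scheme \<Rightarrow> ('k, 'a, 'm) frobenius_scheme \<Rightarrow> nat \<Rightarrow>
    ('k, 'a polgen) aterm set list \<Rightarrow>
    ('k, ('k, 'a polgen) aterm set letter list \<Rightarrow> ('k, 'a polgen) aterm set letter list \<Rightarrow>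
     (('k, 'a polgen) aterm set letter, 'k, ('a, ('k, 'a polgen) aterm set) lawgen) mterm set)
    superalgebra" where
  "W_aff_words R A d Qs = End_alg (Add (LAW R A)) (Gam R A d Qs, \<lambda>w. w)"

definition W_cyc_words where
  "W_cyc_words R A d Qs =
    quot_superalg (W_aff_words R A d Qs)
      (genideal (W_aff_words R A d Qs)
        {summand_id (LAW R A) (Gam R A d Qs, \<lambda>w. w) w |w. w \<in> Gam R A d Qs \<and> hd w = Istr})"

end

theory Submission
  imports Defs "HOL-Library.Multiset"
begin

text \<open>
  Only words with a single letter \<open>Q\<close> occur, and killing the words that start with \<open>I\<close> leaves
  the single word \<open>Q I\<^sup>d\<close>.  Modulo morphisms that factor through a killed word, an endomorphism of
  \<open>Q I\<^sup>d\<close> is \<open>1\<^sub>Q \<otimes> z\<close> with \<open>z\<close> in the affine wreath product algebra, since a crossing with the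
  labelled strand always leads to a killed word; and \<open>1\<^sub>Q \<otimes> Q\<^sub>1\<close> is killed because
  \<open>\<lambda>\<^sub>Q \<rho>\<^sub>Q = 1\<^sub>Q \<otimes> [Q]\<close>.  So \<open>z \<mapsto> 1\<^sub>Q \<otimes> z\<close> induces a surjection from the cyclotomic quotient.

  The inverse exists without any basis theorem: forgetting the labelled strand and sending
  \<open>\<lambda>\<^sub>Q\<close>, \<open>\<rho>\<^sub>Q\<close> to zero respects all relations between endomorphisms of words without labels,
  and it respects the relations between endomorphisms of words \<open>Q I\<^sup>n\<close> modulo \<open>Q\<^sub>1\<close>.  The mixed
  braid relation, with its Demazure term, lives on \<open>I Q I\<close> and imposes nothing there.
\<close>


section \<open>Calculus in a presented monoidal supercategory\<close>

text \<open>Forgetting the labelled strand is not a functor: on the word \<open>I Q\<close> it would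
  turn the relation for \<open>\<rho>\<^sub>Q \<lambda>\<^sub>Q\<close> into \<open>0 = [Q]\<close>.
  So no universal property applies, and the comparison is an induction over derivations of equality
  between terms. Such a derivation may use subterms whose ends are words on which nothing is known.
  Two vanishing facts make them harmless. The projection of a term with different source and target
  is zero, since only the crossings change a word; this makes the corner entry at
  \<open>Q I\<^sup>d\<close> multiplicative. In the category itself a term is zero unless its ends
  agree as multisets of letters; with the killed identities, this reduces every composite to the
  corner. Tensor products impose an asymmetry. The killed terms are stable under adding strands on
  the right, but the labelled strand on the left would turn a killed identity into the identity of a
  surviving word. Hence congruence is only ever placed on the left factor and genuine equality on
  the right one.\<close>

lemma mon_ax_types:
  "mon_ax R P s t \<Longrightarrow> mwf R P s \<Longrightarrow> mwf R P t \<Longrightarrow> msrc P s = msrc P t \<and> mtgt P s = mtgt P t"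
  by (induction rule: mon_ax.induct) auto

lemma meq_types:
  "meq R P s t \<Longrightarrow> mwf R P s \<and> mwf R P t \<and> msrc P s = msrc P t \<and> mtgt P s = mtgt P t"
proof (induction rule: meq.induct)
  case (meq_ax s t)
  then show ?case using mon_ax_types by blast
qed auto

lemma meq_wf2: "meq R P s t \<Longrightarrow> mwf R P t"
  using meq_types by blast

declare meq_trans [trans]

lemma mcls_eqI: "meq R P s t \<Longrightarrow> mcls R P s = mcls R P t"
  unfolding mcls_def by (auto intro: meq_trans meq_trans[OF meq_sym])

lemma mcls_eq_iff: "mwf R P t \<Longrightarrow> mcls R P s = mcls R P t \<longleftrightarrow> meq R P s t"
proof
  assume "mwf R P t" "mcls R P s = mcls R P t"
  then have "t \<in> mcls R P s" by (simp add: mcls_def meq_refl)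
  then show "meq R P s t" by (simp add: mcls_def)
qed (rule mcls_eqI)

lemma mem_mcls: "s \<in> mcls R P t \<longleftrightarrow> meq R P t s"
  by (simp add: mcls_def)

text \<open>The token of a non-homogeneous element is a generator without parity.
  \<open>gens_split\<close> asks that such a generator be equal to the sum of an even and an odd
  term; the interchange law for arbitrary terms rests on it.\<close>

locale mpresentation = cring R
  for R :: "('k, 'r) ring_scheme" (structure) +
  fixes P :: "('o, 'k, 'g) mpres"
  assumes gens_letters:
      "g \<in> mgens P \<Longrightarrow> gsrc P g \<in> lists (letters P) \<and> gtgt P g \<in> lists (letters P)"
    and gens_split:
      "g \<in> mgens P \<Longrightarrow> (\<exists>p. mghom P g p) \<or>
        (\<exists>s t. mhomog P s 0 \<and> mhomog P t 1 \<and> meq R P (MGen g) (MPlus s t))"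
begin

abbreviation wf where "wf \<equiv> mwf R P"
abbreviation src where "src \<equiv> msrc P"
abbreviation tgt where "tgt \<equiv> mtgt P"
abbreviation meq' (infix "\<approx>" 50) where "s \<approx> t \<equiv> meq R P s t"

lemma ends_letters: "wf t \<Longrightarrow> src t \<in> lists (letters P) \<and> tgt t \<in> lists (letters P)"
  by (induction t) (use gens_letters in auto)

lemma src_letters [simp]: "wf t \<Longrightarrow> src t \<in> lists (letters P)"
  and tgt_letters [simp]: "wf t \<Longrightarrow> tgt t \<in> lists (letters P)"
  using ends_letters by auto

lemma scal_zero: "wf t \<Longrightarrow> MScal \<zero> t \<approx> MZero (src t) (tgt t)"
  by (intro meq_ax mon_ax.intros) auto

text \<open>No axiom says how \<open>MZero\<close> behaves under scalars, composition or tensor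
  product. Writing a zero as a zero multiple of itself turns each such rule into bilinearity
  followed by the axiom for the scalar zero.\<close>

lemma zero_as_scal:
  "X \<in> lists (letters P) \<Longrightarrow> Y \<in> lists (letters P) \<Longrightarrow> MZero X Y \<approx> MScal \<zero> (MZero X Y)"
  using scal_zero[of "MZero X Y"] by (auto intro: meq_sym)

lemma scal_scal:
  "c \<in> carrier R \<Longrightarrow> c' \<in> carrier R \<Longrightarrow> wf t \<Longrightarrow> MScal c (MScal c' t) \<approx> MScal (c \<otimes> c') t"
  by (intro meq_sym[OF meq_ax] mon_ax.intros) auto

lemma scal_one: "wf t \<Longrightarrow> MScal \<one> t \<approx> t"
  by (intro meq_ax mon_ax.intros) auto

lemma scal_MZero:
  assumes "c \<in> carrier R" "X \<in> lists (letters P)" "Y \<in> lists (letters P)"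
  shows "MScal c (MZero X Y) \<approx> MZero X Y"
proof -
  have "MScal c (MZero X Y) \<approx> MScal c (MScal \<zero> (MZero X Y))"
    using assms by (intro meq_scal zero_as_scal)
  also have "\<dots> \<approx> MScal (c \<otimes> \<zero>) (MZero X Y)"
    using assms by (intro scal_scal) auto
  also have "MScal (c \<otimes> \<zero>) (MZero X Y) \<approx> MZero X Y"
    using assms scal_zero[of "MZero X Y"] by simp
  finally show ?thesis .
qed

lemma scal_zeroI: "c \<in> carrier R \<Longrightarrow> s \<approx> MZero X Y \<Longrightarrow> MScal c s \<approx> MZero X Y"
  using meq_wf2[of R P s "MZero X Y"] by (intro meq_trans[OF meq_scal scal_MZero]) auto

lemma plus_comm: "wf (MPlus s t) \<Longrightarrow> MPlus s t \<approx> MPlus t s"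
  by (intro meq_ax mon_ax.intros) auto

lemma plus_assoc: "wf (MPlus (MPlus s t) u) \<Longrightarrow> MPlus (MPlus s t) u \<approx> MPlus s (MPlus t u)"
  by (intro meq_ax mon_ax.intros) auto

lemma plus_zero_left:
  "wf t \<Longrightarrow> X = src t \<Longrightarrow> Y = tgt t \<Longrightarrow> MPlus (MZero X Y) t \<approx> t"
  by (intro meq_ax mon_ax.intros) auto

lemma plus_zero_right:
  "wf t \<Longrightarrow> X = src t \<Longrightarrow> Y = tgt t \<Longrightarrow> MPlus t (MZero X Y) \<approx> t"
  by (rule meq_trans[OF plus_comm plus_zero_left]) auto

lemma plus_zeroI:
  assumes "s \<approx> MZero X Y" "t \<approx> MZero X Y" shows "MPlus s t \<approx> MZero X Y"
proof -
  have "MPlus s t \<approx> MPlus (MZero X Y) (MZero X Y)"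
    using assms meq_types[OF assms(1)] meq_types[OF assms(2)] by (intro meq_plus) auto
  also have "\<dots> \<approx> MZero X Y"
    using meq_wf2[OF assms(1)] by (intro plus_zero_left) auto
  finally show ?thesis .
qed

lemma plus_neg:
  assumes "wf t" shows "MPlus t (MScal (\<ominus> \<one>) t) \<approx> MZero (src t) (tgt t)"
proof -
  have "MPlus t (MScal (\<ominus> \<one>) t) \<approx> MPlus (MScal \<one> t) (MScal (\<ominus> \<one>) t)"
    using assms by (intro meq_plus meq_sym[OF scal_one] meq_refl) auto
  also have "\<dots> \<approx> MScal (\<one> \<oplus> \<ominus> \<one>) t"
    using assms by (intro meq_sym[OF meq_ax] mon_ax.intros) auto
  also have "MScal (\<one> \<oplus> \<ominus> \<one>) t \<approx> MZero (src t) (tgt t)"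
    using assms scal_zero by (simp add: r_neg)
  finally show ?thesis .
qed

lemma comp_assoc: "wf (MComp (MComp s t) u) \<Longrightarrow> MComp (MComp s t) u \<approx> MComp s (MComp t u)"
  by (intro meq_ax mon_ax.intros) auto

lemma comp_id_left: "wf t \<Longrightarrow> X = tgt t \<Longrightarrow> MComp (MId X) t \<approx> t"
  by (intro meq_ax mon_ax.intros) auto

lemma comp_id_right: "wf t \<Longrightarrow> X = src t \<Longrightarrow> MComp t (MId X) \<approx> t"
  by (intro meq_ax mon_ax.intros) auto

lemma comp_plus_left:
  "wf (MComp (MPlus s t) u) \<Longrightarrow> MComp (MPlus s t) u \<approx> MPlus (MComp s u) (MComp t u)"
  by (intro meq_ax mon_ax.intros) auto

lemma comp_plus_right:
  "wf (MComp u (MPlus s t)) \<Longrightarrow> MComp u (MPlus s t) \<approx> MPlus (MComp u s) (MComp u t)"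
  by (intro meq_ax mon_ax.intros) auto

lemma comp_scal_left:
  "wf (MComp (MScal c s) t) \<Longrightarrow> MComp (MScal c s) t \<approx> MScal c (MComp s t)"
  by (intro meq_ax mon_ax.intros) auto

lemma comp_scal_right:
  "wf (MComp s (MScal c t)) \<Longrightarrow> MComp s (MScal c t) \<approx> MScal c (MComp s t)"
  by (intro meq_ax mon_ax.intros) auto

lemma tens_plus_left:
  "wf (MTens (MPlus s t) u) \<Longrightarrow> MTens (MPlus s t) u \<approx> MPlus (MTens s u) (MTens t u)"
  by (intro meq_ax mon_ax.intros) auto

lemma tens_plus_right:
  "wf (MTens u (MPlus s t)) \<Longrightarrow> MTens u (MPlus s t) \<approx> MPlus (MTens u s) (MTens u t)"
  by (intro meq_ax mon_ax.intros) auto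

lemma tens_scal_left:
  "wf (MTens (MScal c s) t) \<Longrightarrow> MTens (MScal c s) t \<approx> MScal c (MTens s t)"
  by (intro meq_ax mon_ax.intros) auto

lemma tens_scal_right:
  "wf (MTens s (MScal c t)) \<Longrightarrow> MTens s (MScal c t) \<approx> MScal c (MTens s t)"
  by (intro meq_ax mon_ax.intros) auto

lemma tens_assoc:
  "wf (MTens (MTens s t) u) \<Longrightarrow> MTens (MTens s t) u \<approx> MTens s (MTens t u)"
  by (intro meq_ax mon_ax.intros) auto

lemma tens_unit_left: "wf t \<Longrightarrow> MTens (MId []) t \<approx> t"
  by (intro meq_ax mon_ax.intros) auto

lemma tens_unit_right: "wf t \<Longrightarrow> MTens t (MId []) \<approx> t"
  by (intro meq_ax mon_ax.intros) auto

lemma tens_ids: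
  "X \<in> lists (letters P) \<Longrightarrow> Y \<in> lists (letters P) \<Longrightarrow> MTens (MId X) (MId Y) \<approx> MId (X @ Y)"
  by (intro meq_ax mon_ax.intros) auto

lemma comp_MZero_left:
  assumes "wf t" "Z \<in> lists (letters P)" "Y = tgt t"
  shows "MComp (MZero Y Z) t \<approx> MZero (src t) Z"
proof -
  have "MComp (MZero Y Z) t \<approx> MComp (MScal \<zero> (MZero Y Z)) t"
    using assms by (intro meq_comp zero_as_scal meq_refl) auto
  also have "\<dots> \<approx> MScal \<zero> (MComp (MZero Y Z) t)"
    using assms by (intro comp_scal_left) auto
  also have "\<dots> \<approx> MZero (src t) Z"
    using scal_zero[of "MComp (MZero Y Z) t"] assms by simp
  finally show ?thesis .
qed

lemma comp_MZero_right:
  assumes "wf t" "X \<in> lists (letters P)" "Y = src t"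
  shows "MComp t (MZero X Y) \<approx> MZero X (tgt t)"
proof -
  have "MComp t (MZero X Y) \<approx> MComp t (MScal \<zero> (MZero X Y))"
    using assms by (intro meq_comp zero_as_scal meq_refl) auto
  also have "\<dots> \<approx> MScal \<zero> (MComp t (MZero X Y))"
    using assms by (intro comp_scal_right) auto
  also have "\<dots> \<approx> MZero X (tgt t)"
    using scal_zero[of "MComp t (MZero X Y)"] assms by simp
  finally show ?thesis .
qed

lemma tens_MZero_left:
  assumes "wf t" "X \<in> lists (letters P)" "Y \<in> lists (letters P)"
  shows "MTens (MZero X Y) t \<approx> MZero (X @ src t) (Y @ tgt t)"
proof -
  have "MTens (MZero X Y) t \<approx> MTens (MScal \<zero> (MZero X Y)) t"
    using assms by (intro meq_tens zero_as_scal meq_refl) auto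
  also have "\<dots> \<approx> MScal \<zero> (MTens (MZero X Y) t)"
    using assms by (intro tens_scal_left) auto
  also have "\<dots> \<approx> MZero (X @ src t) (Y @ tgt t)"
    using scal_zero[of "MTens (MZero X Y) t"] assms by simp
  finally show ?thesis .
qed

lemma tens_MZero_right:
  assumes "wf t" "X \<in> lists (letters P)" "Y \<in> lists (letters P)"
  shows "MTens t (MZero X Y) \<approx> MZero (src t @ X) (tgt t @ Y)"
proof -
  have "MTens t (MZero X Y) \<approx> MTens t (MScal \<zero> (MZero X Y))"
    using assms by (intro meq_tens zero_as_scal meq_refl) auto
  also have "\<dots> \<approx> MScal \<zero> (MTens t (MZero X Y))"
    using assms by (intro tens_scal_right) auto
  also have "\<dots> \<approx> MZero (src t @ X) (tgt t @ Y)"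
    using scal_zero[of "MTens t (MZero X Y)"] assms by simp
  finally show ?thesis .
qed

lemma comp_zeroI:
  assumes "wf (MComp s t)" "s \<approx> MZero Y Z \<or> t \<approx> MZero X' Y'"
  shows "MComp s t \<approx> MZero (src t) (tgt s)"
  using assms(2)
proof
  assume s: "s \<approx> MZero Y Z"
  have "MComp s t \<approx> MComp (MZero Y Z) t"
    using assms s by (intro meq_comp meq_refl) auto
  also have "\<dots> \<approx> MZero (src t) (tgt s)"
    using comp_MZero_left[of t Z Y] meq_types[OF s] assms by simp
  finally show ?thesis .
next
  assume t: "t \<approx> MZero X' Y'"
  have "MComp s t \<approx> MComp s (MZero X' Y')"
    using assms t by (intro meq_comp meq_refl) auto
  also have "\<dots> \<approx> MZero (src t) (tgt s)"
    using comp_MZero_right[of s X' Y'] meq_types[OF t] assms by simp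
  finally show ?thesis .
qed

lemma tens_zeroI:
  assumes "wf (MTens s t)" "s \<approx> MZero X Y \<or> t \<approx> MZero X' Y'"
  shows "MTens s t \<approx> MZero (src s @ src t) (tgt s @ tgt t)"
  using assms(2)
proof
  assume s: "s \<approx> MZero X Y"
  have "MTens s t \<approx> MTens (MZero X Y) t"
    using assms s by (intro meq_tens meq_refl) auto
  also have "\<dots> \<approx> MZero (src s @ src t) (tgt s @ tgt t)"
    using tens_MZero_left[of t X Y] meq_types[OF s] assms by simp
  finally show ?thesis .
next
  assume t: "t \<approx> MZero X' Y'"
  have "MTens s t \<approx> MTens s (MZero X' Y')"
    using assms t by (intro meq_tens meq_refl) auto
  also have "\<dots> \<approx> MZero (src s @ src t) (tgt s @ tgt t)"
    using tens_MZero_right[of s X' Y'] meq_types[OF t] assms by simp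
  finally show ?thesis .
qed

lemma plus_four:
  assumes "wf (MPlus (MPlus a b) (MPlus c d))"
  shows "MPlus (MPlus a b) (MPlus c d) \<approx> MPlus (MPlus a c) (MPlus b d)"
proof -
  have "MPlus (MPlus a b) (MPlus c d) \<approx> MPlus a (MPlus b (MPlus c d))"
    using assms by (intro plus_assoc) auto
  also have "\<dots> \<approx> MPlus a (MPlus c (MPlus b d))"
  proof (rule meq_plus)
    have "MPlus b (MPlus c d) \<approx> MPlus (MPlus b c) d"
      using assms by (intro meq_sym[OF plus_assoc]) auto
    also have "\<dots> \<approx> MPlus (MPlus c b) d"
      using assms by (intro meq_plus plus_comm meq_refl) auto
    also have "\<dots> \<approx> MPlus c (MPlus b d)"
      using assms by (intro plus_assoc) auto
    finally show "MPlus b (MPlus c d) \<approx> MPlus c (MPlus b d)" .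
  qed (use assms in \<open>auto intro: meq_refl\<close>)
  also have "\<dots> \<approx> MPlus (MPlus a c) (MPlus b d)"
    using assms by (intro meq_sym[OF plus_assoc]) auto
  finally show ?thesis .
qed

text \<open>The super interchange law is imposed only when two of the factors are homogeneous.  Splitting
  morphisms into homogeneous parts extends it to all morphisms as soon as one factor is even.\<close>

definition splits :: "('o, 'k, 'g) mterm \<Rightarrow> bool" where
  "splits t \<longleftrightarrow> (\<exists>t0 t1. mhomog P t0 0 \<and> mhomog P t1 1 \<and> t \<approx> MPlus t0 t1)"

lemma splitsI: "t \<approx> MPlus t0 t1 \<Longrightarrow> mhomog P t0 0 \<Longrightarrow> mhomog P t1 1 \<Longrightarrow> splits t"
  unfolding splits_def by blast

lemma splits_cong: "s \<approx> t \<Longrightarrow> splits t \<Longrightarrow> splits s"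
  unfolding splits_def using meq_trans by blast

lemma splits_homog:
  assumes "wf t" "mhomog P t p" shows "splits t"
proof (cases "p = 0")
  case True
  have "t \<approx> MPlus t (MZero (src t) (tgt t))"
    using assms by (intro meq_sym[OF plus_zero_right]) auto
  then show ?thesis using assms True by (auto intro: splitsI mhomog.intros(3))
next
  case False
  have "t \<approx> MPlus (MZero (src t) (tgt t)) t"
    using assms by (intro meq_sym[OF plus_zero_left]) auto
  then show ?thesis using assms False by (auto intro: splitsI mhomog.intros(3))
qed

lemma splits_plus:
  assumes "wf (MPlus s t)" "splits s" "splits t" shows "splits (MPlus s t)"
proof -
  obtain s0 s1 t0 t1 where
    h: "mhomog P s0 0" "mhomog P s1 1" "mhomog P t0 0" "mhomog P t1 1"
    and s: "s \<approx> MPlus s0 s1" and t: "t \<approx> MPlus t0 t1"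
    using assms unfolding splits_def by blast
  have "MPlus s t \<approx> MPlus (MPlus s0 s1) (MPlus t0 t1)"
    using s t assms by (intro meq_plus)
  also have "\<dots> \<approx> MPlus (MPlus s0 t0) (MPlus s1 t1)"
    using meq_wf2[OF calculation] by (rule plus_four)
  finally show ?thesis by (rule splitsI) (intro mhomog.intros h)+
qed

lemma splits_scal:
  assumes "c \<in> carrier R" "splits t" shows "splits (MScal c t)"
proof -
  obtain t0 t1 where h: "mhomog P t0 0" "mhomog P t1 1" and t: "t \<approx> MPlus t0 t1"
    using assms unfolding splits_def by blast
  have "MScal c t \<approx> MScal c (MPlus t0 t1)"
    using t assms by (intro meq_scal)
  also have "\<dots> \<approx> MPlus (MScal c t0) (MScal c t1)"
    using meq_wf2[OF calculation] by (intro meq_ax mon_ax.intros) auto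
  finally show ?thesis by (rule splitsI) (intro mhomog.intros h)+
qed

lemma splits_comp:
  assumes "wf (MComp s t)" "splits s" "splits t" shows "splits (MComp s t)"
proof -
  obtain s0 s1 t0 t1 where
    h: "mhomog P s0 0" "mhomog P s1 1" "mhomog P t0 0" "mhomog P t1 1"
    and s: "s \<approx> MPlus s0 s1" and t: "t \<approx> MPlus t0 t1"
    using assms unfolding splits_def by blast
  note ty = meq_types[OF s] meq_types[OF t] assms(1)
  have eq1: "MComp s t \<approx> MPlus (MComp s0 t) (MComp s1 t)"
    using s ty by (intro meq_trans[OF meq_comp comp_plus_left] meq_refl) auto
  have *: "splits (MComp s' t)" if "wf s'" "src s' = src s" "mhomog P s' p" for s' p
  proof -
    have "MComp s' t \<approx> MPlus (MComp s' t0) (MComp s' t1)"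
      using t ty that by (intro meq_trans[OF meq_comp comp_plus_right] meq_refl) auto
    moreover have "splits (MPlus (MComp s' t0) (MComp s' t1))"
      using ty that h
      by (intro splits_plus splits_homog[of _ "p + 0"] splits_homog[of _ "p + 1"] mhomog.intros) auto
    ultimately show ?thesis by (rule splits_cong)
  qed
  show ?thesis
    using ty h by (intro splits_cong[OF eq1] splits_plus *[of s0 0] *[of s1 1]) auto
qed

lemma splits_tens:
  assumes "wf (MTens s t)" "splits s" "splits t" shows "splits (MTens s t)"
proof -
  obtain s0 s1 t0 t1 where
    h: "mhomog P s0 0" "mhomog P s1 1" "mhomog P t0 0" "mhomog P t1 1"
    and s: "s \<approx> MPlus s0 s1" and t: "t \<approx> MPlus t0 t1"
    using assms unfolding splits_def by blast
  note ty = meq_types[OF s] meq_types[OF t] assms(1)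
  have eq1: "MTens s t \<approx> MPlus (MTens s0 t) (MTens s1 t)"
    using s ty by (intro meq_trans[OF meq_tens tens_plus_left] meq_refl) auto
  have *: "splits (MTens s' t)" if "wf s'" "mhomog P s' p" for s' p
  proof -
    have "MTens s' t \<approx> MPlus (MTens s' t0) (MTens s' t1)"
      using t ty that by (intro meq_trans[OF meq_tens tens_plus_right] meq_refl) auto
    moreover have "splits (MPlus (MTens s' t0) (MTens s' t1))"
      using ty that h
      by (intro splits_plus splits_homog[of _ "p + 0"] splits_homog[of _ "p + 1"] mhomog.intros) auto
    ultimately show ?thesis by (rule splits_cong)
  qed
  show ?thesis
    using ty h by (intro splits_cong[OF eq1] splits_plus *[of s0 0] *[of s1 1]) auto
qed

lemma wf_splits: "wf t \<Longrightarrow> splits t"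
proof (induction t)
  case (MGen x)
  then show ?case
    using gens_split[of x] splits_homog[OF _ mhomog.intros(2)] unfolding splits_def by fastforce
next
  case (MId x)
  then show ?case by (intro splits_homog[of _ 0] mhomog.intros) auto
next
  case (MZero x y)
  then show ?case by (intro splits_homog[of _ 0] mhomog.intros) auto
qed (auto intro: splits_plus splits_scal splits_comp splits_tens)

lemma interchange_homog:
  assumes "mhomog P f p" "mhomog P g q" "p = 0 \<or> q = 0"
    "wf (MComp f' f)" "wf (MComp g g')"
  shows "MComp (MTens f' g) (MTens f g') \<approx> MTens (MComp f' f) (MComp g g')"
proof -
  have sgn: "ksign R (p * q) = \<one>"
    using assms(3) by (auto simp: ksign_def)
  have "MComp (MTens f' g) (MTens f g')
      \<approx> MScal (ksign R (p * q)) (MTens (MComp f' f) (MComp g g'))"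
    using assms by (intro meq_ax mon_ax.intros) (auto simp: ksign_def)
  also have "MScal (ksign R (p * q)) (MTens (MComp f' f) (MComp g g'))
      \<approx> MTens (MComp f' f) (MComp g g')"
    unfolding sgn using assms by (intro scal_one) auto
  finally show ?thesis .
qed

text \<open>The interchange sign involves \<open>f\<close> and \<open>g\<close> only, so
  \<open>f'\<close> and \<open>g'\<close> never need a parity. Here \<open>g\<close> is split into
  homogeneous parts, and evenness of \<open>f\<close> makes both signs trivial.\<close>

lemma interchange_left:
  assumes "mhomog P f 0" "wf (MComp f' f)" "wf (MComp g g')"
  shows "MComp (MTens f' g) (MTens f g') \<approx> MTens (MComp f' f) (MComp g g')"
proof -
  obtain g0 g1 where h: "mhomog P g0 0" "mhomog P g1 1" and g: "g \<approx> MPlus g0 g1"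
    using wf_splits[of g] assms unfolding splits_def by auto
  note ty = meq_types[OF g] assms(2,3)
  have "MComp (MTens f' g) (MTens f g') \<approx> MComp (MPlus (MTens f' g0) (MTens f' g1)) (MTens f g')"
    using ty by (intro meq_comp meq_trans[OF meq_tens[OF meq_refl g] tens_plus_right] meq_refl) auto
  also have "\<dots> \<approx> MPlus (MComp (MTens f' g0) (MTens f g')) (MComp (MTens f' g1) (MTens f g'))"
    using ty by (intro comp_plus_left) auto
  also have "\<dots> \<approx> MPlus (MTens (MComp f' f) (MComp g0 g')) (MTens (MComp f' f) (MComp g1 g'))"
    using ty by (intro meq_plus interchange_homog[OF assms(1) h(1)] interchange_homog[OF assms(1) h(2)]) auto
  also have "\<dots> \<approx> MTens (MComp f' f) (MPlus (MComp g0 g') (MComp g1 g'))"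
    using ty by (intro meq_sym[OF tens_plus_right]) auto
  also have "\<dots> \<approx> MTens (MComp f' f) (MComp g g')"
    using ty by (intro meq_tens meq_refl meq_trans[OF meq_sym[OF comp_plus_left]
        meq_comp[OF meq_sym[OF g]]]) auto
  finally show ?thesis .
qed

lemma interchange_right:
  assumes "mhomog P g 0" "wf (MComp f' f)" "wf (MComp g g')"
  shows "MComp (MTens f' g) (MTens f g') \<approx> MTens (MComp f' f) (MComp g g')"
proof -
  obtain f0 f1 where h: "mhomog P f0 0" "mhomog P f1 1" and f: "f \<approx> MPlus f0 f1"
    using wf_splits[of f] assms unfolding splits_def by auto
  note ty = meq_types[OF f] assms(2,3)
  have "MComp (MTens f' g) (MTens f g') \<approx> MComp (MTens f' g) (MPlus (MTens f0 g') (MTens f1 g'))"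
    using ty by (intro meq_comp meq_trans[OF meq_tens[OF f meq_refl] tens_plus_left] meq_refl) auto
  also have "\<dots> \<approx> MPlus (MComp (MTens f' g) (MTens f0 g')) (MComp (MTens f' g) (MTens f1 g'))"
    using ty by (intro comp_plus_right) auto
  also have "\<dots> \<approx> MPlus (MTens (MComp f' f0) (MComp g g')) (MTens (MComp f' f1) (MComp g g'))"
    using ty by (intro meq_plus interchange_homog[OF h(1) assms(1)] interchange_homog[OF h(2) assms(1)]) auto
  also have "\<dots> \<approx> MTens (MPlus (MComp f' f0) (MComp f' f1)) (MComp g g')"
    using ty by (intro meq_sym[OF tens_plus_left]) auto
  also have "\<dots> \<approx> MTens (MComp f' f) (MComp g g')"
    using ty by (intro meq_tens meq_refl meq_trans[OF meq_sym[OF comp_plus_right]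
        meq_comp[OF _ meq_sym[OF f]]]) auto
  finally show ?thesis .
qed

lemma whisker_left:
  assumes "wf (MComp s t)" "X \<in> lists (letters P)"
  shows "MTens (MId X) (MComp s t) \<approx> MComp (MTens (MId X) s) (MTens (MId X) t)"
proof -
  have "MComp (MTens (MId X) s) (MTens (MId X) t) \<approx> MTens (MComp (MId X) (MId X)) (MComp s t)"
    using assms by (intro interchange_left mhomog.intros) auto
  also have "\<dots> \<approx> MTens (MId X) (MComp s t)"
    using assms by (intro meq_tens comp_id_left meq_refl) auto
  finally show ?thesis by (rule meq_sym)
qed

lemma whisker_right:
  assumes "wf (MComp s t)" "wf u"
  shows "MTens (MComp s t) u \<approx> MComp (MTens s (MId (tgt u))) (MTens t u)"
proof -
  have "MComp (MTens s (MId (tgt u))) (MTens t u) \<approx> MTens (MComp s t) (MComp (MId (tgt u)) u)"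
    using assms by (intro interchange_right mhomog.intros) auto
  also have "\<dots> \<approx> MTens (MComp s t) u"
    using assms by (intro meq_tens comp_id_left meq_refl) auto
  finally show ?thesis by (rule meq_sym)
qed

lemma tens_factor:
  assumes "wf s" "wf t"
  shows "MTens s t \<approx> MComp (MTens s (MId (tgt t))) (MTens (MId (src s)) t)"
proof -
  have "MTens s t \<approx> MTens (MComp s (MId (src s))) t"
    using assms by (intro meq_tens meq_refl meq_sym[OF comp_id_right]) auto
  also have "\<dots> \<approx> MComp (MTens s (MId (tgt t))) (MTens (MId (src s)) t)"
    using assms by (intro whisker_right) auto
  finally show ?thesis .
qed

no_notation meq' (infix "\<approx>" 50)

end

text \<open>Equality modulo the ideal of morphisms generated by \<open>S\<close>, closed under
  composition on both sides. There is no tensor rule: tensoring a killed identity of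
  \<open>I w\<close> on the left with the labelled strand would kill the identity of
  \<open>Q I w\<close>, and these are the words that have to survive.\<close>

inductive mcong ::
  "('k, 'r) ring_scheme \<Rightarrow> ('o, 'k, 'g) mpres \<Rightarrow> ('o, 'k, 'g) mterm set \<Rightarrow>
    ('o, 'k, 'g) mterm \<Rightarrow> ('o, 'k, 'g) mterm \<Rightarrow> bool"
  for R :: "('k, 'r) ring_scheme" and P :: "('o, 'k, 'g) mpres" and S :: "('o, 'k, 'g) mterm set"
  where
  mcong_meq: "meq R P s t \<Longrightarrow> mcong R P S s t"
| mcong_sym: "mcong R P S s t \<Longrightarrow> mcong R P S t s"
| mcong_trans: "mcong R P S s t \<Longrightarrow> mcong R P S t u \<Longrightarrow> mcong R P S s u"
| mcong_plus: "mcong R P S s s' \<Longrightarrow> mcong R P S t t' \<Longrightarrow> mwf R P (MPlus s t) \<Longrightarrow>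
    mcong R P S (MPlus s t) (MPlus s' t')"
| mcong_scal: "c \<in> carrier R \<Longrightarrow> mcong R P S t t' \<Longrightarrow> mcong R P S (MScal c t) (MScal c t')"
| mcong_comp: "mcong R P S s s' \<Longrightarrow> mcong R P S t t' \<Longrightarrow> mwf R P (MComp s t) \<Longrightarrow>
    mcong R P S (MComp s t) (MComp s' t')"
| mcong_kill: "g \<in> S \<Longrightarrow> mwf R P g \<Longrightarrow> mcong R P S g (MZero (msrc P g) (mtgt P g))"

declare mcong_trans [trans]

lemma mcong_meq_trans [trans]: "mcong R P S s t \<Longrightarrow> meq R P t u \<Longrightarrow> mcong R P S s u"
  by (blast intro: mcong_trans mcong_meq)

lemma meq_mcong_trans [trans]: "meq R P s t \<Longrightarrow> mcong R P S t u \<Longrightarrow> mcong R P S s u"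
  by (blast intro: mcong_trans mcong_meq)

context mpresentation
begin

notation meq' (infix "\<approx>" 50)

lemma mcong_types:
  "mcong R P S s t \<Longrightarrow> wf s \<and> wf t \<and> src s = src t \<and> tgt s = tgt t"
  by (induction rule: mcong.induct) (auto dest: meq_types)

lemma mcong_refl: "wf t \<Longrightarrow> mcong R P S t t"
  by (intro mcong_meq meq_refl)

text \<open>Stability of \<open>S\<close> under identity strands on the right suffices for this
  one-sided rule: a generator meets \<open>u\<close> through
  \<open>MTens g u = (MTens g id) (MTens id u)\<close>. In the composition case one of the two left
  factors is tensored with an identity instead of \<open>u\<close>, which is why the induction lets
  \<open>u\<close> vary.\<close>

lemma mcong_tens:
  assumes S: "\<And>g Y. g \<in> S \<Longrightarrow> wf g \<Longrightarrow> Y \<in> lists (letters P) \<Longrightarrow>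
      \<exists>g'\<in>S. MTens g (MId Y) \<approx> g'"
    and "mcong R P S s s'" "t \<approx> t'"
  shows "mcong R P S (MTens s t) (MTens s' t')"
proof -
  have "mcong R P S (MTens s u) (MTens s' u)" if "wf u" for u
    using assms(2) that
  proof (induction arbitrary: u rule: mcong.induct)
    case (mcong_meq s t)
    then show ?case by (intro mcong.mcong_meq meq_tens meq_refl)
  next
    case (mcong_sym s t)
    then show ?case by (intro mcong.mcong_sym[OF mcong_sym.IH]) (auto dest: mcong_types)
  next
    case (mcong_trans s t u)
    then show ?case
      by (intro mcong.mcong_trans[OF mcong_trans.IH(1) mcong_trans.IH(2)]) auto
  next
    case (mcong_plus s s' t t')
    note ty = mcong_types[OF mcong_plus(1)] mcong_types[OF mcong_plus(2)] mcong_plus.prems mcong_plus(3)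
    have "MTens (MPlus s t) u \<approx> MPlus (MTens s u) (MTens t u)"
      using ty by (intro tens_plus_left) auto
    also have "mcong R P S \<dots> (MPlus (MTens s' u) (MTens t' u))"
      using ty by (intro mcong.mcong_plus mcong_plus.IH) auto
    also have "\<dots> \<approx> MTens (MPlus s' t') u"
      using ty by (intro meq_sym[OF tens_plus_left]) auto
    finally show ?case .
  next
    case (mcong_scal c t t')
    note ty = mcong_types[OF mcong_scal(2)] mcong_scal.prems mcong_scal(1)
    have "MTens (MScal c t) u \<approx> MScal c (MTens t u)"
      using ty by (intro tens_scal_left) auto
    also have "mcong R P S \<dots> (MScal c (MTens t' u))"
      using ty by (intro mcong.mcong_scal mcong_scal.IH) auto
    also have "\<dots> \<approx> MTens (MScal c t') u"
      using ty by (intro meq_sym[OF tens_scal_left]) auto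
    finally show ?case .
  next
    case (mcong_comp s s' t t')
    note ty = mcong_types[OF mcong_comp(1)] mcong_types[OF mcong_comp(2)] mcong_comp.prems mcong_comp(3)
    have "MTens (MComp s t) u \<approx> MComp (MTens s (MId (tgt u))) (MTens t u)"
      using ty by (intro whisker_right) auto
    also have "mcong R P S \<dots> (MComp (MTens s' (MId (tgt u))) (MTens t' u))"
      using ty by (intro mcong.mcong_comp mcong_comp.IH) auto
    also have "\<dots> \<approx> MTens (MComp s' t') u"
      using ty by (intro meq_sym[OF whisker_right]) auto
    finally show ?case .
  next
    case (mcong_kill g)
    then obtain g' where g': "g' \<in> S" "MTens g (MId (tgt u)) \<approx> g'"
      using S[of g "tgt u"] by auto
    note ty = meq_types[OF g'(2)] mcong_kill
    have "MTens g u \<approx> MComp (MTens g (MId (tgt u))) (MTens (MId (src g)) u)"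
      using ty by (intro tens_factor) auto
    also have "\<dots> \<approx> MComp g' (MTens (MId (src g)) u)"
      using ty g' by (intro meq_comp meq_refl) auto
    also have "mcong R P S \<dots> (MComp (MZero (src g') (tgt g')) (MTens (MId (src g)) u))"
      using ty g' by (intro mcong_comp mcong.mcong_kill mcong_refl) auto
    also have "\<dots> \<approx> MZero (src g @ src u) (tgt g')"
      using ty comp_MZero_left[of "MTens (MId (src g)) u" "tgt g'" "src g'"] by auto
    also have "MZero (src g @ src u) (tgt g') \<approx> MTens (MZero (src g) (tgt g)) u"
      using ty tens_MZero_left[of u "src g" "tgt g"] by (auto intro: meq_sym)
    finally show ?case .
  qed
  then have "mcong R P S (MTens s t) (MTens s' t)"
    using meq_types[OF assms(3)] by blast
  also have "MTens s' t \<approx> MTens s' t'"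
    using mcong_types[OF assms(2)] by (intro meq_tens meq_refl assms(3)) auto
  finally show ?thesis .
qed

no_notation meq' (infix "\<approx>" 50)

end

section \<open>Presentations whose generators preserve the multiset of letters\<close>

locale balanced_presentation = mpresentation +
  assumes gens_mset: "g \<in> mgens P \<Longrightarrow> mset (gsrc P g) = mset (gtgt P g)"
    and gens_nonempty: "g \<in> mgens P \<Longrightarrow> gsrc P g \<noteq> []"
begin

text \<open>Generators and identities preserve the multiset of letters, so an imbalance can only
  come from an explicit zero; and if a composite or a tensor product is unbalanced, so is one of its
  factors, whose zero spreads.\<close>

lemma unbalanced_zero:
  "wf t \<Longrightarrow> mset (src t) \<noteq> mset (tgt t) \<Longrightarrow> meq R P t (MZero (src t) (tgt t))"
proof (induction t)
  case (MGen x)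
  then show ?case using gens_mset by auto
next
  case (MZero X Y)
  then show ?case by (auto intro: meq_refl)
next
  case (MPlus s t)
  then show ?case by (auto intro: plus_zeroI)
next
  case (MScal c t)
  then show ?case by (auto intro: scal_zeroI)
next
  case (MComp s t)
  then have "mset (src s) \<noteq> mset (tgt s) \<or> mset (src t) \<noteq> mset (tgt t)" by auto
  then have "meq R P s (MZero (src s) (tgt s)) \<or> meq R P t (MZero (src t) (tgt t))"
    using MComp.IH MComp.prems(1) mwf.simps(6) by blast
  with MComp.prems(1) show ?case using comp_zeroI by auto
next
  case (MTens s t)
  then have "mset (src s) \<noteq> mset (tgt s) \<or> mset (src t) \<noteq> mset (tgt t)" by auto
  then have "meq R P s (MZero (src s) (tgt s)) \<or> meq R P t (MZero (src t) (tgt t))"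
    using MTens by auto
  with MTens.prems(1) show ?case using tens_zeroI by auto
qed auto

text \<open>No generator has an empty source, so only sums, multiples and products of the identity
  of the empty word occur. A composite through a nonempty word has unbalanced factors and is
  zero.\<close>

lemma unit_endomorphism:
  "wf t \<Longrightarrow> src t = [] \<Longrightarrow> tgt t = [] \<Longrightarrow> \<exists>c \<in> carrier R. meq R P t (MScal c (MId []))"
proof (induction t)
  case (MId X)
  then have "meq R P (MScal \<one> (MId [])) (MId X)" using scal_one[of "MId []"] by simp
  then show ?case by (blast intro: meq_sym)
next
  case (MGen x)
  then show ?case using gens_nonempty by auto
next
  case (MZero X Y)
  then have "meq R P (MScal \<zero> (MId [])) (MZero X Y)" using scal_zero[of "MId []"] by simp
  then show ?case by (blast intro: meq_sym)
next
  case (MPlus s t)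
  then obtain c d where cd: "c \<in> carrier R" "d \<in> carrier R"
    "meq R P s (MScal c (MId []))" "meq R P t (MScal d (MId []))" by auto
  have "meq R P (MPlus s t) (MPlus (MScal c (MId [])) (MScal d (MId [])))"
    using cd MPlus.prems by (intro meq_plus) auto
  also have "meq R P \<dots> (MScal (c \<oplus> d) (MId []))"
    using cd by (intro meq_sym[OF meq_ax] mon_ax.intros) auto
  finally show ?case using cd by blast
next
  case (MScal e t)
  then obtain c where c: "c \<in> carrier R" "meq R P t (MScal c (MId []))" by auto
  have "meq R P (MScal e t) (MScal e (MScal c (MId [])))"
    using c MScal.prems by (intro meq_scal) auto
  also have "meq R P \<dots> (MScal (e \<otimes> c) (MId []))"
    using c MScal.prems by (intro scal_scal) auto
  finally show ?case using c MScal.prems by auto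
next
  case (MComp s t)
  show ?case
  proof (cases "src s = []")
    case True
    then obtain c d where cd: "c \<in> carrier R" "d \<in> carrier R"
      "meq R P s (MScal c (MId []))" "meq R P t (MScal d (MId []))" using MComp by auto
    have "meq R P (MComp s t) (MComp (MScal c (MId [])) (MScal d (MId [])))"
      using cd MComp.prems by (intro meq_comp) auto
    also have "meq R P \<dots> (MScal c (MComp (MId []) (MScal d (MId []))))"
      using cd by (intro comp_scal_left) auto
    also have "meq R P \<dots> (MScal c (MScal d (MId [])))"
      using cd by (intro meq_scal comp_id_left) auto
    also have "meq R P \<dots> (MScal (c \<otimes> d) (MId []))"
      using cd by (intro scal_scal) auto
    finally show ?thesis using cd by blast
  next
    case False
    then have "meq R P t (MZero (src t) (tgt t))"
      using MComp.prems by (intro unbalanced_zero) auto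
    then have "meq R P (MComp s t) (MZero [] [])"
      using MComp.prems comp_zeroI[of s t] by auto
    also have "meq R P \<dots> (MScal \<zero> (MId []))"
      using scal_zero[of "MId []"] by (auto intro: meq_sym)
    finally show ?thesis by blast
  qed
next
  case (MTens s t)
  then obtain c d where cd: "c \<in> carrier R" "d \<in> carrier R"
    "meq R P s (MScal c (MId []))" "meq R P t (MScal d (MId []))" by auto
  have "meq R P (MTens s t) (MTens (MScal c (MId [])) (MScal d (MId [])))"
    using cd by (intro meq_tens) auto
  also have "meq R P \<dots> (MScal c (MTens (MId []) (MScal d (MId []))))"
    using cd by (intro tens_scal_left) auto
  also have "meq R P \<dots> (MScal c (MScal d (MId [])))"
    using cd by (intro meq_scal tens_unit_left) auto
  also have "meq R P \<dots> (MScal (c \<otimes> d) (MId []))"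
    using cd by (intro scal_scal) auto
  finally show ?case using cd by blast
qed

text \<open>Endomorphisms of the empty word are scalars, so they can be moved past a labelled strand.\<close>

lemma unit_tens:
  assumes "c \<in> carrier R" "meq R P s (MScal c (MId []))" "wf t"
  shows "meq R P (MTens s t) (MScal c t)"
proof -
  have "meq R P (MTens s t) (MTens (MScal c (MId [])) t)"
    using assms by (intro meq_tens meq_refl) auto
  also have "meq R P \<dots> (MScal c (MTens (MId []) t))"
    using assms by (intro tens_scal_left) auto
  also have "meq R P \<dots> (MScal c t)"
    using assms by (intro meq_scal tens_unit_left) auto
  finally show ?thesis .
qed

end

section \<open>Normal forms in the polynomial algebra on one variable\<close>

lemma aeq_wf: "aeq R P s t \<Longrightarrow> awf R P s \<and> awf R P t"
  by (induction rule: aeq.induct) auto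

declare aeq_trans [trans]

context frobenius_superalgebra
begin

lemma hpart_carrier: "a \<in> hpart A p \<Longrightarrow> a \<in> carrier A"
  using hpart_submodule[of p] by (auto dest: submoduleE(1))

abbreviation pol1 :: "('k, 'a polgen) apres" where "pol1 \<equiv> pol_pres R A (Suc 0)"
abbreviation peq (infix "\<sim>" 50) where "s \<sim> t \<equiv> aeq R pol1 s t"
abbreviation pwf where "pwf t \<equiv> awf R pol1 t"
abbreviation tok :: "'a \<Rightarrow> ('k, 'a polgen) aterm" where "tok a \<equiv> AGen (PT [a])"
abbreviation dot :: "('k, 'a polgen) aterm" where "dot \<equiv> AGen (PX (Suc 0))"

definition monom :: "'a \<Rightarrow> nat \<Rightarrow> ('k, 'a polgen) aterm" where
  "monom a r = AMult (tok a) (apow dot r)"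

lemma agens_pol1 [simp]:
  "PT [a] \<in> agens pol1 \<longleftrightarrow> a \<in> carrier A" "PX (Suc 0) \<in> agens pol1"
  by (auto simp: pol_pres_def)

lemma pwf_apow [simp]: "pwf (apow dot r)"
  by (induction r) (auto simp: apow_def pol_pres_def)

lemma pwf_monom [simp]: "pwf (monom a r) \<longleftrightarrow> a \<in> carrier A"
  by (simp add: monom_def)

lemma apow_Suc: "apow t (Suc r) = AMult t (apow t r)"
  by (simp add: apow_def)

lemma ksign_closed [simp]: "ksign R p \<in> carrier R"
  by (simp add: ksign_def)

lemma peq_mult_zero:
  assumes "pwf t" shows "AMult t AZero \<sim> AZero"
proof -
  have "AMult t AZero \<sim> AMult t (AScal \<zero>\<^bsub>R\<^esub> AZero)"
    using assms by (intro aeq_mult aeq_refl aeq_sym[OF aeq_ax] aax.intros) auto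
  also have "\<dots> \<sim> AScal \<zero>\<^bsub>R\<^esub> (AMult t AZero)"
    using assms by (intro aeq_ax aax.intros) auto
  also have "\<dots> \<sim> AZero"
    using assms by (intro aeq_ax aax.intros) auto
  finally show ?thesis .
qed

lemma peq_zero_mult:
  assumes "pwf t" shows "AMult AZero t \<sim> AZero"
proof -
  have "AMult AZero t \<sim> AMult (AScal \<zero>\<^bsub>R\<^esub> AZero) t"
    using assms by (intro aeq_mult aeq_refl aeq_sym[OF aeq_ax] aax.intros) auto
  also have "\<dots> \<sim> AScal \<zero>\<^bsub>R\<^esub> (AMult AZero t)"
    using assms by (intro aeq_ax aax.intros) auto
  also have "\<dots> \<sim> AZero"
    using assms by (intro aeq_ax aax.intros) auto
  finally show ?thesis .
qed

lemma peq_scal_zero: 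
  assumes "c \<in> carrier R" shows "AScal c AZero \<sim> AZero"
proof -
  have "AScal c AZero \<sim> AScal c (AScal \<zero>\<^bsub>R\<^esub> AZero)"
    using assms by (intro aeq_scal aeq_sym[OF aeq_ax] aax.intros) auto
  also have "\<dots> \<sim> AScal (c \<otimes>\<^bsub>R\<^esub> \<zero>\<^bsub>R\<^esub>) AZero"
    using assms by (intro aeq_sym[OF aeq_ax] aax.intros) auto
  also have "AScal (c \<otimes>\<^bsub>R\<^esub> \<zero>\<^bsub>R\<^esub>) AZero \<sim> AZero"
    using assms by (auto intro: aeq_ax aax.intros)
  finally show ?thesis .
qed

lemma peq_plus_zero:
  assumes "pwf t" shows "APlus t AZero \<sim> t"
proof -
  have "APlus t AZero \<sim> APlus AZero t"
    using assms by (intro aeq_ax aax.intros) auto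
  also have "\<dots> \<sim> t" using assms by (intro aeq_ax aax.intros) auto
  finally show ?thesis .
qed

lemma peq_plus_assoc: "pwf s \<Longrightarrow> pwf t \<Longrightarrow> pwf u \<Longrightarrow> APlus (APlus s t) u \<sim> APlus s (APlus t u)"
  by (intro aeq_ax aax.intros) auto

lemma peq_plus_comm: "pwf s \<Longrightarrow> pwf t \<Longrightarrow> APlus s t \<sim> APlus t s"
  by (intro aeq_ax aax.intros) auto

lemma peq_plus_four:
  assumes "pwf a" "pwf b" "pwf c" "pwf d"
  shows "APlus (APlus a b) (APlus c d) \<sim> APlus (APlus a c) (APlus b d)"
proof -
  have "APlus b (APlus c d) \<sim> APlus (APlus b c) d"
    using assms by (intro aeq_sym[OF peq_plus_assoc]) auto
  also have "\<dots> \<sim> APlus (APlus c b) d"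
    using assms by (intro aeq_plus peq_plus_comm aeq_refl) auto
  also have "\<dots> \<sim> APlus c (APlus b d)"
    using assms by (intro peq_plus_assoc) auto
  finally have *: "APlus b (APlus c d) \<sim> APlus c (APlus b d)" .
  have "APlus (APlus a b) (APlus c d) \<sim> APlus a (APlus b (APlus c d))"
    using assms by (intro peq_plus_assoc) auto
  also have "\<dots> \<sim> APlus a (APlus c (APlus b d))"
    using assms by (intro aeq_plus[OF aeq_refl *]) auto
  also have "\<dots> \<sim> APlus (APlus a c) (APlus b d)"
    using assms by (intro aeq_sym[OF peq_plus_assoc]) auto
  finally show ?thesis .
qed

lemma peq_scal_one: "pwf t \<Longrightarrow> AScal \<one>\<^bsub>R\<^esub> t \<sim> t"
  by (intro aeq_ax aax.intros) auto

lemma tok_linear: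
  assumes "a \<in> carrier A" "b \<in> carrier A" "c \<in> carrier R" "d \<in> carrier R"
  shows "tok ((c \<odot>\<^bsub>A\<^esub> a) \<oplus>\<^bsub>A\<^esub> (d \<odot>\<^bsub>A\<^esub> b)) \<sim> APlus (AScal c (tok a)) (AScal d (tok b))"
proof -
  have "(AGen (PT ([a][0 := (c \<odot>\<^bsub>A\<^esub> a) \<oplus>\<^bsub>A\<^esub> (d \<odot>\<^bsub>A\<^esub> b)])),
      APlus (AScal c (AGen (PT ([a][0 := a])))) (AScal d (AGen (PT ([a][0 := b])))))
      \<in> pol_rels R A (Suc 0)"
    using assms by (intro pol_rels.intros) auto
  then show ?thesis
    using assms by (intro aeq_rel) (auto simp: pol_pres_def)
qed

lemma tok_plus:
  assumes "a \<in> carrier A" "b \<in> carrier A"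
  shows "tok (a \<oplus>\<^bsub>A\<^esub> b) \<sim> APlus (tok a) (tok b)"
proof -
  have "tok ((\<one>\<^bsub>R\<^esub> \<odot>\<^bsub>A\<^esub> a) \<oplus>\<^bsub>A\<^esub> (\<one>\<^bsub>R\<^esub> \<odot>\<^bsub>A\<^esub> b)) \<sim> APlus (AScal \<one>\<^bsub>R\<^esub> (tok a)) (AScal \<one>\<^bsub>R\<^esub> (tok b))"
    using assms by (intro tok_linear) auto
  also have "\<dots> \<sim> APlus (tok a) (tok b)"
    using assms by (intro aeq_plus peq_scal_one) auto
  finally show ?thesis using assms by simp
qed

lemma tok_zero: "tok \<zero>\<^bsub>A\<^esub> \<sim> AZero"
proof -
  have "tok ((\<zero>\<^bsub>R\<^esub> \<odot>\<^bsub>A\<^esub> \<zero>\<^bsub>A\<^esub>) \<oplus>\<^bsub>A\<^esub> (\<zero>\<^bsub>R\<^esub> \<odot>\<^bsub>A\<^esub> \<zero>\<^bsub>A\<^esub>))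
      \<sim> APlus (AScal \<zero>\<^bsub>R\<^esub> (tok \<zero>\<^bsub>A\<^esub>)) (AScal \<zero>\<^bsub>R\<^esub> (tok \<zero>\<^bsub>A\<^esub>))"
    by (intro tok_linear) auto
  also have "\<dots> \<sim> APlus AZero AZero"
    by (intro aeq_plus aeq_ax aax.intros) auto
  also have "\<dots> \<sim> AZero" by (intro aeq_ax aax.intros) auto
  finally show ?thesis by simp
qed

lemma tok_scal:
  assumes "a \<in> carrier A" "c \<in> carrier R"
  shows "tok (c \<odot>\<^bsub>A\<^esub> a) \<sim> AScal c (tok a)"
proof -
  have "tok ((c \<odot>\<^bsub>A\<^esub> a) \<oplus>\<^bsub>A\<^esub> (\<zero>\<^bsub>R\<^esub> \<odot>\<^bsub>A\<^esub> a)) \<sim> APlus (AScal c (tok a)) (AScal \<zero>\<^bsub>R\<^esub> (tok a))"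
    using assms by (intro tok_linear) auto
  also have "\<dots> \<sim> APlus (AScal c (tok a)) AZero"
    using assms by (intro aeq_plus aeq_refl aeq_ax[OF aax.intros(8)]) auto
  also have "\<dots> \<sim> AScal c (tok a)"
    using assms by (intro peq_plus_zero) auto
  finally show ?thesis using assms by simp
qed

lemma tok_mult_homog:
  assumes "a \<in> hpart A p" "b \<in> hpart A q"
  shows "AMult (tok a) (tok b) \<sim> tok (a \<otimes>\<^bsub>A\<^esub> b)"
proof -
  have "(AMult (AGen (PT [a])) (AGen (PT [b])),
      AScal (ksign R (\<Sum>i<Suc 0. \<Sum>j<i. [p] ! i * [q] ! j)) (AGen (PT (map2 (monoid.mult A) [a] [b]))))
      \<in> pol_rels R A (Suc 0)"
    using assms by (intro pol_rels.intros) (auto simp: hom_tuple_def)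
  then have "AMult (tok a) (tok b) \<sim> AScal \<one>\<^bsub>R\<^esub> (tok (a \<otimes>\<^bsub>A\<^esub> b))"
    using assms by (intro aeq_rel) (auto simp: pol_pres_def ksign_def hpart_carrier)
  also have "\<dots> \<sim> tok (a \<otimes>\<^bsub>A\<^esub> b)"
    using assms by (intro peq_scal_one) (auto simp: hpart_carrier)
  finally show ?thesis .
qed

lemma tok_one: "tok \<one>\<^bsub>A\<^esub> \<sim> AOne"
proof -
  have "(AGen (PT (replicate (Suc 0) \<one>\<^bsub>A\<^esub>)), AOne) \<in> pol_rels R A (Suc 0)"
    by (intro pol_rels.intros)
  then show ?thesis by (intro aeq_rel) (auto simp: pol_pres_def)
qed

text \<open>\<open>superalg_iso\<close> only asks that each parity component be mapped into itself.
  A preimage of \<open>a\<close> is split by parity; the image of its part of the wrong parity is a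
  difference of elements of the right parity, hence lies in both components and is zero.\<close>

lemma nak_surj_hpart:
  assumes "a \<in> hpart A p" shows "\<exists>a' \<in> hpart A p. nak A a' = a"
proof -
  have iso: "nak A \<in> ring_iso A A" and hp: "nak A ` hpart A q \<subseteq> hpart A q" for q
    using nak_auto by (auto simp: superalg_iso_def)
  then have hom: "nak A \<in> ring_hom A A" and bij: "bij_betw (nak A) (carrier A) (carrier A)"
    by (auto simp: ring_iso_def)
  have inter: "hpart A q \<inter> hpart A (q + 1) \<subseteq> {\<zero>\<^bsub>A\<^esub>}" for q
    using hpart_inter by (cases q) auto
  obtain b where b: "b \<in> carrier A" "nak A b = a"
    using bij assms hpart_carrier by (metis bij_betw_imp_surj_on imageE)
  obtain u v where uv: "u \<in> hpart A p" "v \<in> hpart A (p + 1)" "b = u \<oplus>\<^bsub>A\<^esub> v"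
  proof -
    obtain y z where yz: "y \<in> hpart A 0" "z \<in> hpart A 1" "b = y \<oplus>\<^bsub>A\<^esub> z"
      using hpart_span[OF b(1)] by blast
    then have "b = z \<oplus>\<^bsub>A\<^esub> y" using hpart_carrier by (simp add: a_comm)
    then show ?thesis using that[of y z] that[of z y] yz by (cases p) auto
  qed
  have a: "a = nak A u \<oplus>\<^bsub>A\<^esub> nak A v"
    using uv b(2) ring_hom_add[OF hom] hpart_carrier by metis
  have nu: "nak A u \<in> hpart A p" and nv: "nak A v \<in> hpart A (p + 1)"
    using hp uv by blast+
  have "nak A v = a \<ominus>\<^bsub>A\<^esub> nak A u"
    using hpart_carrier[OF nu] hpart_carrier[OF nv]
    unfolding a minus_eq by (simp add: a_comm[of "nak A u" "nak A v"] a_assoc r_neg)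
  then have "nak A v \<in> hpart A p"
    using submoduleE(3)[OF hpart_submodule nu] submoduleE(5)[OF hpart_submodule assms]
    by (simp add: minus_eq)
  then have "nak A v = \<zero>\<^bsub>A\<^esub>" using nv inter by blast
  then show ?thesis using a nu uv(1) hpart_carrier by (intro bexI[of _ u]) auto
qed

text \<open>The defining relation moves a token rightwards past \<open>dot\<close> and twists it by
  the Nakayama automorphism. Moving it to the left therefore needs a homogeneous preimage under
  \<open>nak\<close>; the sign squares to one and is absorbed into the token.\<close>

lemma dot_tok_homog:
  assumes "a \<in> hpart A p"
  shows "\<exists>b \<in> carrier A. AMult dot (tok a) \<sim> AMult (tok b) dot"
proof -
  obtain a' where a': "a' \<in> hpart A p" "nak A a' = a"
    using nak_surj_hpart assms by blast
  let ?c = "ksign R (eps A * p)"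
  have cc: "?c \<otimes>\<^bsub>R\<^esub> ?c = \<one>\<^bsub>R\<^esub>" by (auto simp: ksign_def R.l_minus R.r_minus)
  have "(AMult (AGen (PT [a'])) (AGen (PX (Suc 0))),
       AScal (ksign R (eps A * sum_list [p]))
         (AMult (AGen (PX (Suc 0))) (AGen (PT ([a'][Suc 0 - 1 := nak A ([a'] ! (Suc 0 - 1))])))))
      \<in> pol_rels R A (Suc 0)"
    using a' by (intro pol_rels.intros) (auto simp: hom_tuple_def)
  then have *: "AMult (tok a') dot \<sim> AScal ?c (AMult dot (tok a))"
    using a' assms by (intro aeq_rel) (auto simp: pol_pres_def hpart_carrier)
  have ca: "a \<in> carrier A" "a' \<in> carrier A" using assms a' hpart_carrier by auto
  have "AMult dot (tok a) \<sim> AScal (?c \<otimes>\<^bsub>R\<^esub> ?c) (AMult dot (tok a))"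
    unfolding cc using ca by (intro aeq_sym[OF peq_scal_one]) auto
  also have "\<dots> \<sim> AScal ?c (AScal ?c (AMult dot (tok a)))"
    using ca by (intro aeq_ax aax.intros) auto
  also have "\<dots> \<sim> AScal ?c (AMult (tok a') dot)"
    using ca by (intro aeq_scal aeq_sym[OF *]) auto
  also have "\<dots> \<sim> AMult (AScal ?c (tok a')) dot"
    using ca by (intro aeq_sym[OF aeq_ax] aax.intros) auto
  also have "\<dots> \<sim> AMult (tok (?c \<odot>\<^bsub>A\<^esub> a')) dot"
    using ca by (intro aeq_mult aeq_sym[OF tok_scal] aeq_refl) auto
  finally show ?thesis using ca by (intro bexI[of _ "?c \<odot>\<^bsub>A\<^esub> a'"]) auto
qed

text \<open>Closure under \<open>\<sim>\<close> makes this a property of elements of the algebra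
  rather than of terms: it describes the left span over \<open>A\<close> of the powers of
  \<open>x\<close>.\<close>

inductive nf :: "('k, 'a polgen) aterm \<Rightarrow> bool" where
  nf_zero: "nf AZero"
| nf_monom: "a \<in> carrier A \<Longrightarrow> nf (monom a r)"
| nf_plus: "nf s \<Longrightarrow> nf t \<Longrightarrow> nf (APlus s t)"
| nf_cong: "nf s \<Longrightarrow> s \<sim> t \<Longrightarrow> nf t"

lemma nf_wf: "nf t \<Longrightarrow> pwf t"
  by (induction rule: nf.induct) (auto dest: aeq_wf)

text \<open>Reduces stability of that span under an additive operation to a single monomial, the
  only case in which the relations of the algebra enter.\<close>

lemma nf_additive:
  assumes "nf t"
    and "h AZero \<sim> AZero"
    and "\<And>s t. pwf s \<Longrightarrow> pwf t \<Longrightarrow> h (APlus s t) \<sim> APlus (h s) (h t)"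
    and "\<And>s t. s \<sim> t \<Longrightarrow> h s \<sim> h t"
    and "\<And>a r. a \<in> carrier A \<Longrightarrow> nf (h (monom a r))"
  shows "nf (h t)"
  using assms(1)
proof (induction rule: nf.induct)
  case nf_zero
  show ?case using nf.nf_zero assms(2) by (blast intro: nf_cong aeq_sym)
next
  case (nf_plus s t)
  then show ?case
    using nf.nf_plus[OF nf_plus.IH] assms(3)[OF nf_wf nf_wf] by (blast intro: nf_cong aeq_sym)
next
  case (nf_cong s t)
  then show ?case using assms(4) nf.nf_cong by blast
qed (use assms(5) in auto)

lemma nf_scal:
  assumes "nf t" "c \<in> carrier R" shows "nf (AScal c t)"
  using assms(1)
proof (rule nf_additive)
  fix a r assume a: "a \<in> carrier A"
  have "monom (c \<odot>\<^bsub>A\<^esub> a) r \<sim> AMult (AScal c (tok a)) (apow dot r)"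
    unfolding monom_def using a assms by (intro aeq_mult tok_scal aeq_refl) auto
  also have "\<dots> \<sim> AScal c (monom a r)"
    unfolding monom_def using a assms by (intro aeq_ax aax.intros) auto
  finally show "nf (AScal c (monom a r))"
    using a assms by (blast intro: nf_cong nf_monom smult_closed)
qed (use assms in \<open>auto intro: peq_scal_zero aeq_scal aeq_ax aax.intros\<close>)

lemma homog_sum:
  assumes "a \<in> carrier A"
  obtains a0 a1 where "a0 \<in> hpart A 0" "a1 \<in> hpart A 1" "tok a \<sim> APlus (tok a0) (tok a1)"
  using hpart_span[OF assms] tok_plus hpart_carrier by metis

text \<open>The presentation gives products of tokens for homogeneous elements only, so both
  coefficients are split by parity and the four products are recombined into one token. With a
  single tensor factor there is no sign.\<close>

lemma nf_tok_mult:
  assumes "nf t" "b \<in> carrier A" shows "nf (AMult (tok b) t)"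
  using assms(1)
proof (rule nf_additive)
  fix a r assume a: "a \<in> carrier A"
  obtain b0 b1 where b: "b0 \<in> hpart A 0" "b1 \<in> hpart A 1" "tok b \<sim> APlus (tok b0) (tok b1)"
    using homog_sum assms by blast
  obtain a0 a1 where a': "a0 \<in> hpart A 0" "a1 \<in> hpart A 1" "tok a \<sim> APlus (tok a0) (tok a1)"
    using homog_sum a by blast
  have ca: "a0 \<in> carrier A" "a1 \<in> carrier A" "b0 \<in> carrier A" "b1 \<in> carrier A"
    using a' b hpart_carrier by auto
  have *: "AMult (tok b') (tok a) \<sim> tok (b' \<otimes>\<^bsub>A\<^esub> a0 \<oplus>\<^bsub>A\<^esub> b' \<otimes>\<^bsub>A\<^esub> a1)" if "b' \<in> hpart A q" for b' q
  proof -
    have cb: "b' \<in> carrier A" using that hpart_carrier by auto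
    have "AMult (tok b') (tok a) \<sim> AMult (tok b') (APlus (tok a0) (tok a1))"
      using cb by (intro aeq_mult a' aeq_refl) auto
    also have "\<dots> \<sim> APlus (AMult (tok b') (tok a0)) (AMult (tok b') (tok a1))"
      using cb ca by (intro aeq_ax aax.intros) auto
    also have "\<dots> \<sim> APlus (tok (b' \<otimes>\<^bsub>A\<^esub> a0)) (tok (b' \<otimes>\<^bsub>A\<^esub> a1))"
      using that a' by (intro aeq_plus tok_mult_homog)
    also have "\<dots> \<sim> tok (b' \<otimes>\<^bsub>A\<^esub> a0 \<oplus>\<^bsub>A\<^esub> b' \<otimes>\<^bsub>A\<^esub> a1)"
      using cb ca by (intro aeq_sym[OF tok_plus]) auto
    finally show ?thesis .
  qed
  define c where "c = (b0 \<otimes>\<^bsub>A\<^esub> a0 \<oplus>\<^bsub>A\<^esub> b0 \<otimes>\<^bsub>A\<^esub> a1) \<oplus>\<^bsub>A\<^esub> (b1 \<otimes>\<^bsub>A\<^esub> a0 \<oplus>\<^bsub>A\<^esub> b1 \<otimes>\<^bsub>A\<^esub> a1)"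
  have cc: "c \<in> carrier A" unfolding c_def using ca by auto
  have "AMult (tok b) (tok a) \<sim> AMult (APlus (tok b0) (tok b1)) (tok a)"
    using a by (intro aeq_mult b aeq_refl) auto
  also have "\<dots> \<sim> APlus (AMult (tok b0) (tok a)) (AMult (tok b1) (tok a))"
    using a ca by (intro aeq_ax aax.intros) auto
  also have "\<dots> \<sim> APlus (tok (b0 \<otimes>\<^bsub>A\<^esub> a0 \<oplus>\<^bsub>A\<^esub> b0 \<otimes>\<^bsub>A\<^esub> a1)) (tok (b1 \<otimes>\<^bsub>A\<^esub> a0 \<oplus>\<^bsub>A\<^esub> b1 \<otimes>\<^bsub>A\<^esub> a1))"
    by (intro aeq_plus *[OF b(1)] *[OF b(2)])
  also have "\<dots> \<sim> tok c"
    unfolding c_def using ca by (intro aeq_sym[OF tok_plus]) auto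
  finally have tt: "AMult (tok b) (tok a) \<sim> tok c" .
  have "AMult (tok b) (monom a r) \<sim> AMult (AMult (tok b) (tok a)) (apow dot r)"
    unfolding monom_def using a assms by (intro aeq_sym[OF aeq_ax] aax.intros) auto
  also have "\<dots> \<sim> monom c r"
    unfolding monom_def by (intro aeq_mult tt aeq_refl) auto
  finally show "nf (AMult (tok b) (monom a r))"
    using cc by (blast intro: nf_cong nf_monom aeq_sym)
qed (use assms in \<open>auto intro: peq_mult_zero aeq_mult[OF aeq_refl] aeq_ax aax.intros\<close>)

lemma nf_dot_mult:
  assumes "nf t" shows "nf (AMult dot t)"
  using assms(1)
proof (rule nf_additive)
  fix a r assume a: "a \<in> carrier A"
  obtain a0 a1 where a': "a0 \<in> hpart A 0" "a1 \<in> hpart A 1" "tok a \<sim> APlus (tok a0) (tok a1)"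
    using homog_sum a by blast
  obtain b0 b1 where b: "b0 \<in> carrier A" "b1 \<in> carrier A"
      "AMult dot (tok a0) \<sim> AMult (tok b0) dot" "AMult dot (tok a1) \<sim> AMult (tok b1) dot"
    using dot_tok_homog a' by metis
  have ca: "a0 \<in> carrier A" "a1 \<in> carrier A" using a' hpart_carrier by auto
  have "AMult dot (tok a) \<sim> AMult dot (APlus (tok a0) (tok a1))"
    by (intro aeq_mult a' aeq_refl) auto
  also have "\<dots> \<sim> APlus (AMult dot (tok a0)) (AMult dot (tok a1))"
    using ca by (intro aeq_ax aax.intros) auto
  also have "\<dots> \<sim> APlus (AMult (tok b0) dot) (AMult (tok b1) dot)"
    by (intro aeq_plus b)
  also have "\<dots> \<sim> AMult (APlus (tok b0) (tok b1)) dot"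
    using b by (intro aeq_sym[OF aeq_ax] aax.intros) auto
  also have "\<dots> \<sim> AMult (tok (b0 \<oplus>\<^bsub>A\<^esub> b1)) dot"
    using b by (intro aeq_mult aeq_sym[OF tok_plus] aeq_refl) auto
  finally have tt: "AMult dot (tok a) \<sim> AMult (tok (b0 \<oplus>\<^bsub>A\<^esub> b1)) dot" .
  have "AMult dot (monom a r) \<sim> AMult (AMult dot (tok a)) (apow dot r)"
    unfolding monom_def using a by (intro aeq_sym[OF aeq_ax] aax.intros) auto
  also have "\<dots> \<sim> AMult (AMult (tok (b0 \<oplus>\<^bsub>A\<^esub> b1)) dot) (apow dot r)"
    by (intro aeq_mult tt aeq_refl) auto
  also have "\<dots> \<sim> monom (b0 \<oplus>\<^bsub>A\<^esub> b1) (Suc r)"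
    unfolding monom_def apow_Suc using b by (intro aeq_ax aax.intros) auto
  finally show "nf (AMult dot (monom a r))"
    using b by (blast intro: nf_cong nf_monom aeq_sym a_closed)
qed (auto intro: peq_mult_zero aeq_mult[OF aeq_refl] aeq_ax aax.intros)

text \<open>Induction on the left factor with \<open>u\<close> arbitrary, so that a product acts by
  its right factor first. Applied to the unit, which is a monomial of degree 0, it will show that
  every term has a normal form.\<close>

lemma nf_mult: "pwf t \<Longrightarrow> nf u \<Longrightarrow> nf (AMult t u)"
proof (induction t arbitrary: u)
  case AOne
  have "AMult AOne u \<sim> u" using nf_wf[OF AOne(2)] by (intro aeq_ax aax.intros) auto
  then show ?case using AOne by (blast intro: nf_cong aeq_sym)
next
  case (AGen g)
  then have "g = PX (Suc 0) \<or> (\<exists>a \<in> carrier A. g = PT [a])"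
    by (auto simp: pol_pres_def length_Suc_conv)
  then show ?case using AGen nf_tok_mult nf_dot_mult by blast
next
  case AZero
  then show ?case using peq_zero_mult nf_wf by (blast intro: nf_cong nf_zero aeq_sym)
next
  case (APlus s t)
  have "AMult (APlus s t) u \<sim> APlus (AMult s u) (AMult t u)"
    using APlus.prems nf_wf by (intro aeq_ax aax.intros) auto
  then show ?case using APlus by (auto intro: nf_cong[OF nf_plus aeq_sym])
next
  case (AScal c t)
  have "AMult (AScal c t) u \<sim> AScal c (AMult t u)"
    using AScal.prems nf_wf by (intro aeq_ax aax.intros) auto
  then show ?case using AScal by (auto intro: nf_cong[OF nf_scal aeq_sym])
next
  case (AMult s t)
  have "AMult (AMult s t) u \<sim> AMult s (AMult t u)"
    using AMult.prems nf_wf by (intro aeq_ax aax.intros) auto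
  moreover have "nf (AMult s (AMult t u))" using AMult by auto
  ultimately show ?case by (blast intro: nf_cong aeq_sym)
qed

lemma wf_nf:
  assumes "pwf t" shows "nf t"
proof -
  have "monom \<one>\<^bsub>A\<^esub> 0 \<sim> tok \<one>\<^bsub>A\<^esub>"
    unfolding monom_def apow_def by (simp, intro aeq_ax aax.intros) auto
  then have "nf AOne" using nf_monom[of "\<one>\<^bsub>A\<^esub>" 0] tok_one by (blast intro: nf_cong)
  moreover have "AMult t AOne \<sim> t"
    using assms by (intro aeq_ax aax.intros) auto
  ultimately show ?thesis using nf_mult assms nf_cong by blast
qed

text \<open>Coefficients are a function on all exponents rather than a list, so that two sums can be
  padded with zeros to a common length before they are added.\<close>

primrec psum :: "(nat \<Rightarrow> 'a) \<Rightarrow> nat \<Rightarrow> ('k, 'a polgen) aterm" where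
  "psum c 0 = AZero"
| "psum c (Suc N) = APlus (psum c N) (monom (c N) N)"

lemma psum_wf: "range c \<subseteq> carrier A \<Longrightarrow> pwf (psum c N)"
  by (induction N) auto

lemma psum_cong: "(\<And>k. k < N \<Longrightarrow> c k = c' k) \<Longrightarrow> psum c N = psum c' N"
  by (induction N) auto

lemma monom_zero: "monom \<zero>\<^bsub>A\<^esub> r \<sim> AZero"
proof -
  have "monom \<zero>\<^bsub>A\<^esub> r \<sim> AMult AZero (apow dot r)"
    unfolding monom_def by (intro aeq_mult tok_zero aeq_refl) auto
  also have "\<dots> \<sim> AZero" by (intro peq_zero_mult) auto
  finally show ?thesis .
qed

lemma monom_plus:
  assumes "a \<in> carrier A" "b \<in> carrier A"
  shows "APlus (monom a r) (monom b r) \<sim> monom (a \<oplus>\<^bsub>A\<^esub> b) r"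
proof -
  have "APlus (monom a r) (monom b r) \<sim> AMult (APlus (tok a) (tok b)) (apow dot r)"
    unfolding monom_def using assms by (intro aeq_sym[OF aeq_ax] aax.intros) auto
  also have "\<dots> \<sim> monom (a \<oplus>\<^bsub>A\<^esub> b) r"
    unfolding monom_def using assms by (intro aeq_mult aeq_sym[OF tok_plus] aeq_refl) auto
  finally show ?thesis .
qed

lemma psum_pad:
  assumes "range c \<subseteq> carrier A" "\<And>k. k \<ge> N \<Longrightarrow> c k = \<zero>\<^bsub>A\<^esub>"
  shows "psum c (N + M) \<sim> psum c N"
proof (induction M)
  case (Suc M)
  have "psum c (N + Suc M) \<sim> APlus (psum c N) AZero"
    using Suc monom_zero assms(2) by (simp, intro aeq_plus) auto
  also have "\<dots> \<sim> psum c N" using psum_wf[OF assms(1)] by (rule peq_plus_zero)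
  finally show ?case .
qed (use psum_wf assms in \<open>auto intro: aeq_refl\<close>)

lemma psum_add:
  assumes "range c \<subseteq> carrier A" "range c' \<subseteq> carrier A"
  shows "APlus (psum c N) (psum c' N) \<sim> psum (\<lambda>k. c k \<oplus>\<^bsub>A\<^esub> c' k) N"
proof (induction N)
  case (Suc N)
  have "APlus (psum c (Suc N)) (psum c' (Suc N))
      \<sim> APlus (APlus (psum c N) (psum c' N)) (APlus (monom (c N) N) (monom (c' N) N))"
    using assms psum_wf by (simp, intro peq_plus_four) auto
  also have "\<dots> \<sim> psum (\<lambda>k. c k \<oplus>\<^bsub>A\<^esub> c' k) (Suc N)"
    using Suc assms by (simp, intro aeq_plus monom_plus) auto
  finally show ?case .
qed (auto intro: aeq_ax aax.intros)

lemma psum_extend: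
  assumes "range c \<subseteq> carrier A" "N \<le> M"
  shows "\<exists>c'. range c' \<subseteq> carrier A \<and> psum c N \<sim> psum c' M"
proof -
  define c' where "c' k = (if k < N then c k else \<zero>\<^bsub>A\<^esub>)" for k
  have r: "range c' \<subseteq> carrier A" using assms by (auto simp: c'_def)
  have "psum c' (N + (M - N)) \<sim> psum c' N"
    using r by (intro psum_pad) (auto simp: c'_def)
  moreover have "psum c' N = psum c N" by (intro psum_cong) (auto simp: c'_def)
  ultimately show ?thesis using r assms(2) by (intro exI[of _ c']) (auto intro: aeq_sym)
qed

lemma nf_psum: "nf t \<Longrightarrow> \<exists>c N. range c \<subseteq> carrier A \<and> t \<sim> psum c N"
proof (induction rule: nf.induct)
  case nf_zero
  show ?case by (intro exI[of _ "\<lambda>_. \<zero>\<^bsub>A\<^esub>"] exI[of _ 0]) (auto intro: aeq_refl)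
next
  case (nf_monom a r)
  define c where "c k = (if k = r then a else \<zero>\<^bsub>A\<^esub>)" for k
  have r: "range c \<subseteq> carrier A" using nf_monom by (auto simp: c_def)
  have "psum c r = psum (\<lambda>_. \<zero>\<^bsub>A\<^esub>) r" by (intro psum_cong) (auto simp: c_def)
  moreover have "psum (\<lambda>_. \<zero>\<^bsub>A\<^esub>) (0 + r) \<sim> psum (\<lambda>_. \<zero>\<^bsub>A\<^esub>) 0" by (intro psum_pad) auto
  ultimately have *: "psum c r \<sim> AZero" by simp
  have "psum c (Suc r) \<sim> APlus AZero (monom a r)"
    using * nf_monom by (simp, intro aeq_plus) (auto simp: c_def intro: aeq_refl)
  also have "\<dots> \<sim> monom a r" using nf_monom by (intro aeq_ax aax.intros) auto
  finally show ?case using r aeq_sym by blast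
next
  case (nf_plus s t)
  then obtain c N c' N' where c: "range c \<subseteq> carrier A" "s \<sim> psum c N"
      "range c' \<subseteq> carrier A" "t \<sim> psum c' N'"
    by blast
  obtain d d' where d: "range d \<subseteq> carrier A" "psum c N \<sim> psum d (max N N')"
      "range d' \<subseteq> carrier A" "psum c' N' \<sim> psum d' (max N N')"
    using psum_extend c by (metis max.cobounded1 max.cobounded2)
  have "APlus s t \<sim> APlus (psum d (max N N')) (psum d' (max N N'))"
    by (intro aeq_plus aeq_trans[OF c(2) d(2)] aeq_trans[OF c(4) d(4)])
  also have "\<dots> \<sim> psum (\<lambda>k. d k \<oplus>\<^bsub>A\<^esub> d' k) (max N N')"
    using d by (intro psum_add)
  finally show ?case
    using d by (intro exI[of _ "\<lambda>k. d k \<oplus>\<^bsub>A\<^esub> d' k"] exI[of _ "max N N'"]) auto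
next
  case (nf_cong s t)
  then show ?case using aeq_trans aeq_sym by meson
qed

text \<open>\<open>asum\<close> is nested to the right, while \<open>psum\<close> attaches its
  highest monomial last; this rule bridges the two.\<close>

lemma asum_snoc:
  "list_all pwf ts \<Longrightarrow> pwf t \<Longrightarrow> asum (ts @ [t]) \<sim> APlus (asum ts) t"
proof (induction ts)
  case Nil
  have "APlus t AZero \<sim> APlus AZero t" using Nil by (intro aeq_ax aax.intros) auto
  then show ?case by (simp add: asum_def)
next
  case (Cons s ts)
  have wf: "pwf (asum ts)" using Cons(2) by (induction ts) (auto simp: asum_def)
  have "asum ((s # ts) @ [t]) \<sim> APlus s (APlus (asum ts) t)"
    using Cons by (auto simp: asum_def intro!: aeq_plus aeq_refl)
  also have "\<dots> \<sim> APlus (APlus s (asum ts)) t"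
    using Cons wf by (intro aeq_sym[OF peq_plus_assoc]) auto
  finally show ?case by (simp add: asum_def)
qed

lemma psum_pol_term:
  assumes "range c \<subseteq> carrier A"
  shows "psum c N \<sim> pol_term A (Suc 0) (Suc 0) (map c [0..<N])"
proof -
  have "asum (map (\<lambda>r. monom (c r) r) [0..<N]) \<sim> psum c N"
  proof (induction N)
    case (Suc N)
    have "asum (map (\<lambda>r. monom (c r) r) [0..<Suc N])
        \<sim> APlus (asum (map (\<lambda>r. monom (c r) r) [0..<N])) (monom (c N) N)"
      using asum_snoc[of "map (\<lambda>r. monom (c r) r) [0..<N]" "monom (c N) N"] assms
      by (auto simp: list_all_iff)
    also have "\<dots> \<sim> psum c (Suc N)"
      using Suc assms by (simp, intro aeq_plus aeq_refl) auto
    finally show ?case .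
  qed (auto simp: asum_def intro: aeq_refl)
  moreover have "pol_term A (Suc 0) (Suc 0) (map c [0..<N]) = asum (map (\<lambda>r. monom (c r) r) [0..<N])"
    unfolding pol_term_def monom_def at_factor_def
    by (intro arg_cong[of _ _ asum]) auto
  ultimately show ?thesis by (metis aeq_sym)
qed

lemma acls_eqI: "aeq R P' s t \<Longrightarrow> acls R P' s = acls R P' t"
  unfolding acls_def by (auto intro: aeq_trans aeq_trans[OF aeq_sym])

text \<open>\<open>pol_coeffs\<close> is defined by \<open>SOME\<close>; without the existence of an expansion it would be junk, and
  so would be \<open>[Q]\<close> and \<open>Q\<^sub>1\<close>.\<close>

lemma pol_coeffs_closed:
  assumes "f \<in> carrier (Pol R A 1)"
  shows "pol_coeffs R A f \<in> lists (carrier A)"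
proof -
  obtain t where t: "pwf t" "f = acls R pol1 t"
    using assms by (auto simp: Pol_def presented_superalg_def)
  obtain c N where c: "range c \<subseteq> carrier A" "t \<sim> psum c N"
    using nf_psum wf_nf t by blast
  have "t \<sim> pol_term A (Suc 0) (Suc 0) (map c [0..<N])"
    using c psum_pol_term aeq_trans by blast
  then have "map c [0..<N] \<in> lists (carrier A) \<and>
      f = acls R (pol_pres R A (Suc 0)) (pol_term A (Suc 0) (Suc 0) (map c [0..<N]))"
    using c t acls_eqI[of pol1 t] by (auto simp: image_subset_iff)
  then show ?thesis unfolding pol_coeffs_def One_nat_def by (rule someI2) auto
qed

end

section \<open>Forgetting and attaching a labelled strand\<close>

lemma msum_map_mterm:
  "map_mterm f g h (msum X Y ts) = msum (map f X) (map f Y) (map (map_mterm f g h) ts)"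
  by (induction ts) (auto simp: msum_def)

lemma (in mpresentation) msum_types:
  assumes "X \<in> lists (letters P)" "Y \<in> lists (letters P)"
    "\<And>t. t \<in> set ts \<Longrightarrow> wf t \<and> src t = X \<and> tgt t = Y"
  shows "wf (msum X Y ts) \<and> src (msum X Y ts) = X \<and> tgt (msum X Y ts) = Y"
  using assms by (induction ts) (auto simp: msum_def)

lemma (in mpresentation) mpow_types:
  assumes "wf t" "src t = X" "tgt t = X"
  shows "wf (mpow X t r) \<and> src (mpow X t r) = X \<and> tgt (mpow X t r) = X"
  using assms src_letters[OF assms(1)] by (induction r) (auto simp: mpow_def)

definition strip :: "'q letter list \<Rightarrow> unit list" where
  "strip w = map (\<lambda>_. ()) (filter ((=) Istr) w)"

lemma strip_simps [simp]:
  "strip [] = []" "strip (Istr # w) = () # strip w" "strip (Lab q # w) = strip w"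
  "strip (v @ w) = strip v @ strip w" "strip (replicate n Istr) = replicate n ()"
  by (auto simp: strip_def map_replicate_const replicate_add)

lemma unit_list_eq: "(v :: unit list) = w \<longleftrightarrow> length v = length w"
  by (auto intro: nth_equalityI)

lemma strip_strands [simp]: "strip (map (\<lambda>_. Istr) v) = v"
  by (simp add: strip_def unit_list_eq)

lemma strands_strip: "w \<in> lists {Istr} \<Longrightarrow> map (\<lambda>_. Istr) (strip w) = w"
  by (induction w) auto

lemma strands_replicate: "w \<in> lists {Istr} \<Longrightarrow> w = replicate (length w) Istr"
  by (induction w) auto

text \<open>Sending the crossings \<open>\<rho>\<^sub>Q\<close>, \<open>\<lambda>\<^sub>Q\<close> to zero respects the defining relations on words
  without labels, and on words whose only label is leftmost modulo the cyclotomic ideal; see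
  \<open>compat\<close> below.\<close>

primrec proj :: "('q letter, 'k, ('a, 'q) lawgen) mterm \<Rightarrow> (unit, 'k, 'a awgen) mterm" where
  "proj (MId w) = MId (strip w)"
| "proj (MGen g) = (case g of AG h \<Rightarrow> MGen h | _ \<Rightarrow> MZero [()] [()])"
| "proj (MZero v w) = MZero (strip v) (strip w)"
| "proj (MPlus s t) = MPlus (proj s) (proj t)"
| "proj (MScal c t) = MScal c (proj t)"
| "proj (MComp s t) = MComp (proj s) (proj t)"
| "proj (MTens s t) = MTens (proj s) (proj t)"

abbreviation emb :: "(unit, 'k, 'a awgen) mterm \<Rightarrow> ('q letter, 'k, ('a, 'q) lawgen) mterm" where
  "emb \<equiv> map_mterm (\<lambda>_. Istr) (\<lambda>c. c) AG"

lemma proj_emb [simp]: "proj (emb t) = t"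
  by (induction t) auto

lemma proj_msum: "proj (msum X Y ts) = msum (strip X) (strip Y) (map proj ts)"
  by (induction ts) (auto simp: msum_def)

lemma proj_mpow: "proj (mpow X t r) = mpow (strip X) (proj t) r"
  by (induction r) (auto simp: mpow_def)

lemma aw_pres_simps [simp]:
  "letters (aw_pres R A) = UNIV" "mgens (aw_pres R A) = aw_gens A"
  "gsrc (aw_pres R A) g = replicate (aw_width g) ()"
  "gtgt (aw_pres R A) g = replicate (aw_width g) ()"
  "mghom (aw_pres R A) = awgen_hom A" "mrels (aw_pres R A) = aw_rels R A () id"
  by (simp_all add: aw_pres_def)

lemma law_pres_simps [simp]:
  "Istr \<in> letters (law_pres R A)"
  "Lab q \<in> letters (law_pres R A) \<longleftrightarrow> q \<in> ECR R (Pol R A 1)"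
  "mgens (law_pres R A) = AG ` aw_gens A \<union> Rho ` ECR R (Pol R A 1) \<union> Lam ` ECR R (Pol R A 1)"
  "gsrc (law_pres R A) = law_src" "gtgt (law_pres R A) = law_tgt"
  "mghom (law_pres R A) = lawgen_hom A" "mrels (law_pres R A) = law_rels R A"
  by (auto simp: law_pres_def law_letters_def)

lemma aw_gens_simps [simp]:
  "Sigma \<in> aw_gens A" "Dot \<in> aw_gens A" "Tok a \<in> aw_gens A \<longleftrightarrow> a \<in> carrier A"
  by (auto simp: aw_gens_def)

context
  fixes R :: "('k, 'r) ring_scheme" and A :: "('k, 'a, 'm) frobenius_scheme"
begin

lemma proj_ends [simp]:
  "msrc (aw_pres R A) (proj t) = strip (msrc (law_pres R A) t)" "mtgt (aw_pres R A) (proj t) = strip (mtgt (law_pres R A) t)"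
  by (induction t) (auto split: lawgen.splits)

lemma emb_ends [simp]:
  "msrc (law_pres R A) (emb t) = map (\<lambda>_. Istr) (msrc (aw_pres R A) t)"
  "mtgt (law_pres R A) (emb t) = map (\<lambda>_. Istr) (mtgt (aw_pres R A) t)"
  by (induction t) auto

lemma proj_wf: "mwf R (law_pres R A) t \<Longrightarrow> mwf R (aw_pres R A) (proj t)"
  by (induction t) (auto split: lawgen.splits)

lemma emb_wf: "mwf R (aw_pres R A) t \<Longrightarrow> mwf R (law_pres R A) (emb t)"
  by (induction t) auto

lemma proj_homog: "mhomog (law_pres R A) t p \<Longrightarrow> mhomog (aw_pres R A) (proj t) p"
proof (induction rule: mhomog.induct)
  case (2 g p)
  then show ?case by (cases g) (auto intro!: mhomog.intros)
qed (simp_all only: proj.simps mhomog.intros)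

lemma emb_homog: "mhomog (aw_pres R A) t p \<Longrightarrow> mhomog (law_pres R A) (emb t) p"
proof (induction rule: mhomog.induct)
  case (2 g p)
  then show ?case by (auto intro!: mhomog.intros)
qed (simp_all only: mterm.map mhomog.intros)

lemma proj_mon_ax: "mon_ax R (law_pres R A) s t \<Longrightarrow> mon_ax R (aw_pres R A) (proj s) (proj t)"
proof (induction rule: mon_ax.induct)
  case (24 f p g q f' g')
  show ?case
    using mon_ax.intros(24)[OF proj_homog[OF 24(1)] proj_homog[OF 24(2)]] by (simp only: proj.simps)
\<comment> \<open>In the axiom for the scalar zero the ends of the term appear inside
  \<open>MZero\<close>. The reversed rule rewrites the stripped ends as the ends of the projected
  term, which is the form of the axiom.\<close>
qed (simp_all add: mon_ax.intros flip: proj_ends)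

lemma emb_mon_ax: "mon_ax R (aw_pres R A) s t \<Longrightarrow> mon_ax R (law_pres R A) (emb s) (emb t)"
proof (induction rule: mon_ax.induct)
  case (24 f p g q f' g')
  show ?case
    using mon_ax.intros(24)[OF emb_homog[OF 24(1)] emb_homog[OF 24(2)]] by (simp only: mterm.map)
qed (simp_all add: mon_ax.intros flip: emb_ends)

lemma emb_aw_rels:
  assumes "(s, t) \<in> aw_rels R A () id" shows "(emb s, emb t) \<in> aw_rels R A Istr AG"
  using assms
proof (cases rule: aw_rels.cases)
  case (sigma_dot bs)
  then show ?thesis
    using aw_rels.sigma_dot[OF sigma_dot(3,4), where R = R and i = Istr and e = AG] by (simp add: mminus_def msum_map_mterm o_def)
next
  case (tok_dot a p)
  then show ?thesis
    using aw_rels.tok_dot[OF tok_dot(3), where R = R and i = Istr and e = AG] by simp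
qed (simp_all add: aw_rels.intros)

lemma proj_aw_rels:
  assumes "(s, t) \<in> aw_rels R A Istr AG" shows "(proj s, proj t) \<in> aw_rels R A () id"
  using assms
proof (cases rule: aw_rels.cases)
  case (sigma_dot bs)
  then show ?thesis
    using aw_rels.sigma_dot[OF sigma_dot(3,4), where R = R and i = "()" and e = id] by (simp add: mminus_def proj_msum o_def)
next
  case (tok_dot a p)
  then show ?thesis
    using aw_rels.tok_dot[OF tok_dot(3), where R = R and i = "()" and e = id] by simp
qed (use aw_rels.intros[where i = "()" and e = id] in simp_all)

text \<open>All relations of the affine category are among those of the labelled one, so embedding
  respects equality on every word. For \<open>proj\<close> this holds only on certain words.\<close>

lemma emb_meq: "meq R (aw_pres R A) s t \<Longrightarrow> meq R (law_pres R A) (emb s) (emb t)"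
proof (induction rule: meq.induct)
  case (meq_rel s t)
  then show ?case
    by (intro meq.meq_rel) (auto simp: emb_wf  intro!: law_aw emb_aw_rels)
next
  case (meq_plus s s' t t')
  then show ?case using emb_wf[OF meq_plus(3)] by (auto intro: meq.meq_plus)
next
  case (meq_comp s s' t t')
  then show ?case using emb_wf[OF meq_comp(3)] by (auto intro: meq.meq_comp)
qed (auto intro: meq.intros emb_wf emb_mon_ax)

end

section \<open>Both categories as balanced presentations, and vanishing of projections off the
  diagonal\<close>

context frobenius_superalgebra
begin

abbreviation "awp \<equiv> aw_pres R A"
abbreviation "lawp \<equiv> law_pres R A"
abbreviation "meqA \<equiv> meq R awp"
abbreviation "meqL \<equiv> meq R lawp"

lemma token_split:
  assumes "a \<in> carrier A"
  shows "\<exists>s t. mhomog awp s 0 \<and> mhomog awp t 1 \<and> meqA (MGen (Tok a)) (MPlus s t)"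
proof -
  obtain y z where yz: "y \<in> hpart A 0" "z \<in> hpart A 1" "a = y \<oplus>\<^bsub>A\<^esub> z"
    using hpart_span assms by blast
  then have c: "y \<in> carrier A" "z \<in> carrier A" using hpart_carrier by auto
  let ?s = "MScal \<one>\<^bsub>R\<^esub> (MGen (Tok y))" and ?t = "MScal \<one>\<^bsub>R\<^esub> (MGen (Tok z))"
  have "(MPlus ?s ?t, MGen (Tok a)) \<in> aw_rels R A () id"
    using aw_rels.tok_linear[where a = y and b = z and c = "\<one>\<^bsub>R\<^esub>" and d = "\<one>\<^bsub>R\<^esub>" and R = R and A = A
      and i = "()" and e = id] c yz(3) by simp
  then have "meqA (MPlus ?s ?t) (MGen (Tok a))"
    using c assms by (intro meq_rel) auto
  moreover have "mhomog awp ?s 0" "mhomog awp ?t 1"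
    using yz by (auto intro!: mhomog.intros)
  ultimately show ?thesis by (blast intro: meq_sym)
qed

sublocale AW: balanced_presentation R "aw_pres R A"
proof
  fix g assume g: "g \<in> mgens awp"
  show "gsrc awp g \<in> lists (letters awp) \<and>
      gtgt awp g \<in> lists (letters awp)"
    by auto
  show "mset (gsrc awp g) = mset (gtgt awp g)"
    by simp
  show "gsrc awp g \<noteq> []"
    by (cases g) auto
  show "(\<exists>p. mghom awp g p) \<or> (\<exists>s t. mhomog awp s 0 \<and>
      mhomog awp t 1 \<and> meqA (MGen g) (MPlus s t))"
  proof (cases g)
    case (Tok a)
    then show ?thesis using g token_split[of a] by auto
  qed auto
qed

sublocale LAW: balanced_presentation R "law_pres R A"
proof
  fix g assume g: "g \<in> mgens lawp"
  show "gsrc lawp g \<in> lists (letters lawp) \<and>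
      gtgt lawp g \<in> lists (letters lawp)"
    using g by auto
  show "mset (gsrc lawp g) = mset (gtgt lawp g)"
    by (cases g) auto
  show "gsrc lawp g \<noteq> []"
  proof (cases g)
    case (AG h) then show ?thesis by (cases h) auto
  qed auto
  show "(\<exists>p. mghom lawp g p) \<or> (\<exists>s t. mhomog lawp s 0 \<and>
      mhomog lawp t 1 \<and> meq R lawp (MGen g) (MPlus s t))"
  proof (cases g)
    case (AG h)
    show ?thesis
    proof (cases h)
      case (Tok a)
      then have "a \<in> carrier A" using g AG by auto
      then obtain s t where "mhomog awp s 0" "mhomog awp t 1"
          "meqA (MGen (Tok a)) (MPlus s t)"
        using token_split by blast
      then show ?thesis
        using emb_homog emb_meq[of R A "MGen (Tok a)" "MPlus s t"] AG Tok by fastforce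
    qed (use AG in auto)
  qed auto
qed

lemma strands_letters [simp]:
  "replicate n Istr \<in> lists (letters (law_pres R A))"
  "X \<in> lists (letters (aw_pres R A))"
  by auto

text \<open>The only generators with different ends are the crossings, whose projection is zero. A
  composite or tensor product with different ends has a factor with different ends, so the zero
  spreads. Ends are compared as words, not as multisets: \<open>proj\<close> also kills morphisms
  between different arrangements of the same letters.\<close>

lemma proj_offdiag:
  "LAW.wf t \<Longrightarrow> LAW.src t \<noteq> LAW.tgt t \<Longrightarrow>
    meqA (proj t) (MZero (strip (LAW.src t)) (strip (LAW.tgt t)))"
proof (induction t)
  case (MGen g)
  then show ?case
    by (cases g) (auto intro!: meq_refl)
next
  case (MZero X Y)
  then show ?case by (auto intro!: meq_refl)
next
  case (MPlus s t)
  then show ?case by (auto intro!: AW.plus_zeroI)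
next
  case (MScal c t)
  then show ?case by (auto intro!: AW.scal_zeroI)
next
  case (MComp s t)
  then have "LAW.src s \<noteq> LAW.tgt s \<or> LAW.src t \<noteq> LAW.tgt t" by auto
  then have "meqA (proj s) (MZero (strip (LAW.src s)) (strip (LAW.tgt s))) \<or>
      meqA (proj t) (MZero (strip (LAW.src t)) (strip (LAW.tgt t)))"
    using MComp.IH MComp.prems(1) mwf.simps(6) by blast
  then show ?case
    using AW.comp_zeroI[of "proj s" "proj t"] proj_wf[OF MComp.prems(1)] by auto
next
  case (MTens s t)
  then have "LAW.src s \<noteq> LAW.tgt s \<or> LAW.src t \<noteq> LAW.tgt t" by auto
  then have "meqA (proj s) (MZero (strip (LAW.src s)) (strip (LAW.tgt s))) \<or>
      meqA (proj t) (MZero (strip (LAW.src t)) (strip (LAW.tgt t)))"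
    using MTens.IH MTens.prems(1) mwf.simps(7) by blast
  then show ?case
    using AW.tens_zeroI[of "proj s" "proj t"] proj_wf[OF MTens.prems(1)] by auto
qed auto

lemma br_types:
  assumes "f \<in> carrier (Pol R A 1)"
  shows "LAW.wf (br R A f) \<and> LAW.src (br R A f) = [Istr] \<and> LAW.tgt (br R A f) = [Istr]"
proof -
  have *: "LAW.wf (MGen (AG (Tok (pol_coeffs R A f ! r))))" if "r < length (pol_coeffs R A f)" for r
    using pol_coeffs_closed[OF assms] that by auto
  have dot: "LAW.wf (MGen (AG Dot))" "LAW.src (MGen (AG Dot)) = [Istr]" "LAW.tgt (MGen (AG Dot)) = [Istr]"
    by auto
  show ?thesis unfolding br_def Let_def
    by (intro LAW.msum_types)
      (use LAW.mpow_types[OF dot] * in \<open>auto\<close>)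
qed

end

section \<open>The projection modulo the cyclotomic relation\<close>

type_synonym ('k, 'a) lterm =
  "(('k, 'a polgen) aterm set letter, 'k, ('a, ('k, 'a polgen) aterm set) lawgen) mterm"

locale cyclotomic_parameter = frobenius_superalgebra R A
  for R :: "('k, 'r) ring_scheme" (structure) and A :: "('k, 'a, 'm) frobenius_scheme" (structure) +
  fixes Q :: "('k, 'a polgen) aterm set"
  assumes Q_ECR: "Q \<in> ECR R (Pol R A 1)"
begin

lemma Q_letter [simp]: "Lab Q \<in> letters lawp"
  using Q_ECR by simp

lemma Q_ECR_Suc [simp]: "Q \<in> ECR R (Pol R A (Suc 0))"
  using Q_ECR by simp

lemma strands_map [simp]: "map (\<lambda>_. Istr) X \<in> lists (letters lawp)"
  by auto

lemma br_Q_types [simp]: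
  "LAW.wf (br R A Q)" "LAW.src (br R A Q) = [Istr]" "LAW.tgt (br R A Q) = [Istr]"
  using br_types[of Q] Q_ECR by (auto simp: ECR_def regular_elem_def)

definition qbr :: "(unit, 'k, 'a awgen) mterm" where
  "qbr = proj (br R A Q ::
    ('k, 'a) lterm)"

lemma qbr_types [simp]: "AW.wf qbr" "AW.src qbr = [()]" "AW.tgt qbr = [()]"
  by (auto simp: qbr_def proj_wf)

text \<open>The element \<open>Q\<^sub>1\<close> in every width at once, so that the set is stable,
  up to equality, under adding strands on the right, as \<open>mcong_tens\<close> requires.\<close>

definition cyc_gens :: "(unit, 'k, 'a awgen) mterm set" where
  "cyc_gens = range (\<lambda>X. MTens qbr (MId X))"

text \<open>All continuations \<open>w\<close> are allowed for the same stability on the right.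
  Compared with the generators of the cyclotomic ideal this is harmless: there are only zero
  morphisms between \<open>Q I\<^sup>d\<close> and a word that is not a rearrangement of it.\<close>

definition bad_ids ::
  "('k, 'a) lterm set" where
  "bad_ids = range (\<lambda>w. MId (Istr # w))"

abbreviation "acong \<equiv> mcong R awp cyc_gens"
abbreviation "lcong \<equiv> mcong R lawp bad_ids"

lemma acong_tens: "acong s s' \<Longrightarrow> meqA t t' \<Longrightarrow> acong (MTens s t) (MTens s' t')"
proof (rule AW.mcong_tens)
  fix g :: "(unit, 'k, 'a awgen) mterm" and Y :: "unit list"
  assume "g \<in> cyc_gens"
  then obtain X where g: "g = MTens qbr (MId X)" by (auto simp: cyc_gens_def)
  have "meqA (MTens g (MId Y)) (MTens qbr (MTens (MId X) (MId Y)))"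
    unfolding g by (intro AW.tens_assoc) auto
  also have "meqA \<dots> (MTens qbr (MId (X @ Y)))"
    by (intro meq_tens meq_refl AW.tens_ids) auto
  finally show "\<exists>g'\<in>cyc_gens. meqA (MTens g (MId Y)) g'"
    by (auto simp: cyc_gens_def)
qed

lemma lcong_tens: "lcong s s' \<Longrightarrow> meqL t t' \<Longrightarrow> lcong (MTens s t) (MTens s' t')"
proof (rule LAW.mcong_tens)
  fix g and Y
  assume "g \<in> bad_ids" "LAW.wf g" "Y \<in> lists (letters lawp)"
  then obtain X where g: "g = MId (Istr # X)" and wf: "X \<in> lists (letters lawp)"
    by (auto simp: bad_ids_def)
  have "meqL (MTens g (MId Y)) (MId (Istr # X @ Y))"
    unfolding g using LAW.tens_ids[of "Istr # X" Y] wf \<open>Y \<in> lists (letters lawp)\<close>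
    by simp
  then show "\<exists>g'\<in>bad_ids. meqL (MTens g (MId Y)) g'"
    by (auto simp: bad_ids_def)
qed

definition qword :: "nat \<Rightarrow> ('k, 'a polgen) aterm set letter list" where
  "qword n = Lab Q # replicate n Istr"

lemma strip_qword [simp]: "strip (qword n) = replicate n ()"
  by (simp add: qword_def)

lemma qword_letters [simp]: "qword n \<in> lists (letters lawp)"
  by (simp add: qword_def)

text \<open>No condition is imposed on any other word, in particular on \<open>I Q\<close> and \<open>I Q I\<close>, where
  the relation for \<open>\<rho>\<^sub>Q \<lambda>\<^sub>Q\<close> and the mixed braid relation are not respected.\<close>

definition compat ::
  "('k, 'a polgen) aterm set letter list \<Rightarrow> (unit, 'k, 'a awgen) mterm \<Rightarrow>
    (unit, 'k, 'a awgen) mterm \<Rightarrow> bool" where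
  "compat w u v \<longleftrightarrow> (w \<in> lists {Istr} \<longrightarrow> meqA u v) \<and> (\<forall>n. w = qword n \<longrightarrow> acong u v)"

lemma compat_meq: "meqA u v \<Longrightarrow> compat w u v"
  by (auto simp: compat_def intro: mcong_meq)

lemma proj_offdiag_meq:
  assumes "LAW.wf s" "LAW.wf t" "LAW.src s = LAW.src t" "LAW.tgt s = LAW.tgt t"
    "LAW.src t \<noteq> LAW.tgt t"
  shows "meqA (proj s) (proj t)"
  using proj_offdiag[of s] proj_offdiag[of t] assms by (auto intro: meq_trans[OF _ meq_sym])

text \<open>The label is the first letter, hence lies in the left part unless that part is empty.
  These are the two ways in which a tensor product can start at \<open>qword n\<close>: with nothing
  on the left, or with only unlabelled strands on the right.\<close>

lemma qword_append:
  assumes "v @ w = qword n"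
  obtains "v = []" "w = qword n" | a where "v = qword a" "w \<in> lists {Istr}"
proof (cases v)
  case Nil
  then show ?thesis using assms that by auto
next
  case (Cons l r)
  then have l: "l = Lab Q" and rw: "r @ w = replicate n Istr"
    using assms by (auto simp: qword_def)
  have "set r \<subseteq> {Istr}" "set w \<subseteq> {Istr}"
    using arg_cong[OF rw, of set] by (auto split: if_splits)
  then show ?thesis
    using that(2)[of "length r"] Cons l strands_replicate[of r] by (auto simp: qword_def)
qed

text \<open>If one factor has different ends, both sides project to zero. Otherwise there are two
  patterns at \<open>qword n\<close>: a scalar times a congruence, or a congruence on the left with
  a genuine equality on the right, which is what \<open>acong_tens\<close> accepts. This is why
  \<open>compat\<close> also demands equality on words without labels.\<close>

lemma proj_tens_compat:
  assumes "LAW.wf s" "LAW.wf s'" "LAW.wf t" "LAW.wf t'"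
    "LAW.src s = LAW.src s'" "LAW.tgt s = LAW.tgt s'" "LAW.src t = LAW.src t'" "LAW.tgt t = LAW.tgt t'"
    "compat (LAW.src s) (proj s) (proj s')" "compat (LAW.src t) (proj t) (proj t')"
  shows "compat (LAW.src s @ LAW.src t) (MTens (proj s) (proj t)) (MTens (proj s') (proj t'))"
proof (cases "LAW.src s = LAW.tgt s \<and> LAW.src t = LAW.tgt t")
  case False
  have *: "meqA (MTens (proj u) (proj v))
      (MZero (strip (LAW.src s) @ strip (LAW.src t)) (strip (LAW.tgt s) @ strip (LAW.tgt t)))"
    if "LAW.wf u" "LAW.wf v" "LAW.src u = LAW.src s" "LAW.tgt u = LAW.tgt s"
      "LAW.src v = LAW.src t" "LAW.tgt v = LAW.tgt t" for u v
  proof -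
    have "meqA (proj u) (MZero (strip (LAW.src s)) (strip (LAW.tgt s))) \<or>
        meqA (proj v) (MZero (strip (LAW.src t)) (strip (LAW.tgt t)))"
      using False proj_offdiag[of u] proj_offdiag[of v] that by auto
    then show ?thesis
      using AW.tens_zeroI[of "proj u" "proj v"] that by (simp add: proj_wf)
  qed
  have "meqA (MTens (proj s) (proj t)) (MTens (proj s') (proj t'))"
    by (rule meq_trans[OF *[of s t] meq_sym[OF *[of s' t']]]) (use assms in auto)
  then show ?thesis by (rule compat_meq)
next
  case True
  show ?thesis unfolding compat_def
  proof (intro conjI impI allI)
    assume "LAW.src s @ LAW.src t \<in> lists {Istr}"
    then show "meqA (MTens (proj s) (proj t)) (MTens (proj s') (proj t'))"
      using assms by (intro meq_tens) (auto simp: compat_def)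
  next
    fix n assume "LAW.src s @ LAW.src t = qword n"
    then show "acong (MTens (proj s) (proj t)) (MTens (proj s') (proj t'))"
    proof (cases rule: qword_append)
      case 1
      then obtain c where c: "c \<in> carrier R" "meqA (proj s) (MScal c (MId []))"
        using AW.unit_endomorphism[of "proj s"] True assms proj_wf by auto
      \<comment> \<open>The empty word carries no label, so the hypothesis on the left factors is an
        equality and both are the same scalar.\<close>
      then have c': "meqA (proj s') (MScal c (MId []))"
        using assms 1 by (auto simp: compat_def intro: meq_trans[OF meq_sym])
      have "meqA (MTens (proj s) (proj t)) (MScal c (proj t))"
        using c assms proj_wf by (intro AW.unit_tens) auto
      also have "acong \<dots> (MScal c (proj t'))"
        using c assms(10) 1(2) unfolding compat_def by (intro mcong_scal) blast+
      also have "meqA (MScal c (proj t')) (MTens (proj s') (proj t'))"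
        using c c' assms proj_wf by (intro meq_sym[OF AW.unit_tens]) auto
      finally show ?thesis .
    next
      case (2 a)
      then show ?thesis using assms by (intro acong_tens) (auto simp: compat_def)
    qed
  qed
qed

text \<open>Everything is decided by the ends of the relation: if they differ, both sides project to
  zero; if the source starts with \<open>I\<close> but contains a label, \<open>compat\<close> asks
  for nothing. What remains are the relations of the affine category and \<open>lam_rho\<close>, the
  only one that forces \<open>Q\<^sub>1\<close> to vanish.\<close>

lemma proj_law_rel:
  assumes "(s, t) \<in> law_rels R A" "LAW.wf s" "LAW.wf t"
    "LAW.src s = LAW.src t" "LAW.tgt s = LAW.tgt t"
  shows "compat (LAW.src s) (proj s) (proj t)"
proof -
  consider (off) "LAW.src t \<noteq> LAW.tgt t" | (triv) w where "LAW.src s = Istr # w" "Istr # w \<notin> lists {Istr}"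
    | (aw) "(s, t) \<in> aw_rels R A Istr AG"
    | (rel) Q' where "s = MComp (MGen (Lam Q')) (MGen (Rho Q'))" "t = MTens (idL Q') (br R A Q')"
    using assms(1)
  proof (cases rule: law_rels.cases)
    case (lam_slide Q g) then show ?thesis by (intro triv[of "[Lab Q]"]) auto
  next
    case (rho_slide Q g) then show ?thesis by (intro off) auto
  next
    case (rho_lam Q) then show ?thesis by (intro triv[of "[Lab Q]"]) auto
  next
    case (rho_braid Q) then show ?thesis by (intro off) auto
  next
    case (lam_braid Q) then show ?thesis by (intro triv[of "[Istr, Lab Q]"]) (auto simp: numeral_2_eq_2)
  next
    case (mixed_braid Q) then show ?thesis by (intro triv[of "[Lab Q, Istr]"]) auto
  qed (use aw rel in blast)+
  then show ?thesis
  proof cases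
    case off
    then show ?thesis using assms by (intro compat_meq proj_offdiag_meq)
  next
    case (triv w)
    then show ?thesis by (auto simp: compat_def qword_def)
  next
    case aw
    then show ?thesis
      using assms by (intro compat_meq meq_rel) (auto simp: proj_wf proj_aw_rels)
  next
    case (rel Q')
    show ?thesis
    proof (cases "Q' = Q")
      case True
      have "meqA (proj s) (MZero [()] [()])"
        unfolding rel using AW.comp_MZero_left[of "MZero [()] [()]" "[()]" "[()]"] by simp
      \<comment> \<open>Width one: no strand is added, so this generator of the congruence equals
        \<open>qbr\<close> itself.\<close>
      also have "acong (MZero [()] [()]) (MTens qbr (MId []))"
        using mcong_kill[of "MTens qbr (MId [])" cyc_gens R awp]
        by (auto simp: cyc_gens_def intro: mcong_sym)
      also have "meqA (MTens qbr (MId [])) qbr"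
        by (intro AW.tens_unit_right) auto
      also have "meqA qbr (proj t)"
        using meq_sym[OF AW.tens_unit_left[OF qbr_types(1)]] by (simp add: rel True qbr_def)
      finally show ?thesis using rel by (auto simp: compat_def)
    next
      case False
      then show ?thesis by (auto simp: compat_def qword_def rel)
    qed
  qed
qed

text \<open>The delicate case is composition, where the induction hypothesis for \<open>s\<close>
  concerns the middle word. If this word equals the source, both hypotheses speak of the same word
  and combine; if not, \<open>t\<close> and \<open>t'\<close> have different ends, and both
  composites project to zero whatever \<open>s\<close> and \<open>s'\<close> are.\<close>

lemma proj_compat: "meqL s t \<Longrightarrow> compat (LAW.src s) (proj s) (proj t)"
proof (induction rule: meq.induct)
  case (meq_refl t)
  then show ?case by (intro compat_meq meq.meq_refl proj_wf)
next
  case (meq_sym s t)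
  then show ?case using meq_types[OF meq_sym(1)]
    by (auto simp: compat_def intro: meq.meq_sym mcong_sym)
next
  case (meq_trans s t u)
  then show ?case using meq_types[OF meq_trans(1)]
    by (auto simp: compat_def intro: meq.meq_trans mcong_trans)
next
  case (meq_plus s s' t t')
  have wf: "AW.wf (MPlus (proj s) (proj t))" using proj_wf[OF meq_plus(3)] by simp
  have src: "LAW.src s = LAW.src t" using meq_plus(3) by simp
  show ?case
    using meq_plus.IH meq.meq_plus[OF _ _ wf, of "proj s'" "proj t'"]
      mcong_plus[OF _ _ wf, of cyc_gens "proj s'" "proj t'"]
    by (simp add: compat_def src)
next
  case (meq_scal c t t')
  then show ?case by (auto simp: compat_def intro: meq.meq_scal mcong_scal)
next
  case (meq_comp s s' t t')
  note ty = meq_types[OF meq_comp(1)] meq_types[OF meq_comp(2)] meq_comp(3)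
  show ?case
  proof (cases "LAW.src t = LAW.tgt t")
    case True
    have wf: "AW.wf (MComp (proj s) (proj t))" using proj_wf[OF meq_comp(3)] by simp
    have src: "LAW.src s = LAW.src t" using True ty by simp
    show ?thesis
      using meq_comp.IH meq.meq_comp[OF _ _ wf, of "proj s'" "proj t'"]
        mcong_comp[OF _ _ wf, of cyc_gens "proj s'" "proj t'"]
      by (simp add: compat_def src)
  next
    case False
    have "meqA (proj (MComp s t)) (MZero (strip (LAW.src t)) (strip (LAW.tgt s)))"
      using AW.comp_zeroI[of "proj s" "proj t"] proj_offdiag[of t] False ty by (auto simp: proj_wf)
    moreover have "meqA (proj (MComp s' t')) (MZero (strip (LAW.src t)) (strip (LAW.tgt s)))"
      using AW.comp_zeroI[of "proj s'" "proj t'"] proj_offdiag[of t'] False ty by (auto simp: proj_wf)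
    ultimately have "meqA (proj (MComp s t)) (proj (MComp s' t'))"
      by (rule meq.meq_trans[OF _ meq.meq_sym])
    then show ?thesis by (rule compat_meq)
  qed
next
  case (meq_tens s s' t t')
  then show ?case using meq_types[OF meq_tens(1)] meq_types[OF meq_tens(2)]
    unfolding proj.simps msrc.simps by (intro proj_tens_compat) auto
next
  case (meq_ax s t)
  then show ?case by (intro compat_meq meq.meq_ax proj_mon_ax proj_wf)
next
  case (meq_rel s t)
  then show ?case by (intro proj_law_rel) auto
qed

section \<open>Attaching the labelled strand on the left\<close>

lemma emb_zero:
  assumes "meqA u (MZero X Y)"
  shows "meqL (emb u) (MZero (map (\<lambda>_. Istr) X) (map (\<lambda>_. Istr) Y))"
  using emb_meq[OF assms] by simp

lemma lists_mset: "mset v = mset w \<Longrightarrow> w \<in> lists {Istr} \<Longrightarrow> v \<in> lists {Istr}"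
  by (metis in_lists_conv_set mset_eq_setD)

text \<open>Crossings contribute nothing between words without labels: a composite through a word
  with a label changes the multiset of letters, so it vanishes in the category, and its projection
  vanishes as well.\<close>

lemma strands_eq_emb:
  "LAW.wf t \<Longrightarrow> LAW.src t \<in> lists {Istr} \<Longrightarrow> LAW.tgt t \<in> lists {Istr} \<Longrightarrow>
    meqL t (emb (proj t))"
proof (induction t)
  case (MId w)
  then show ?case by (auto simp: strands_strip intro!: meq_refl)
next
  case (MGen g)
  then show ?case by (cases g) (auto intro!: meq_refl)
next
  case (MZero v w)
  then show ?case by (auto simp: strands_strip intro!: meq_refl)
next
  case (MPlus s t)
  then show ?case by (auto intro!: meq_plus)
next
  case (MScal c t)
  then show ?case by (auto intro!: meq_scal)
next
  case (MComp s t)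
  show ?case
  proof (cases "LAW.src s \<in> lists {Istr}")
    case True
    then show ?thesis using MComp by (auto intro!: meq_comp)
  next
    case False
    then have ne: "mset (LAW.src t) \<noteq> mset (LAW.tgt t)" "LAW.src t \<noteq> LAW.tgt t"
      using MComp.prems lists_mset[of "LAW.tgt t" "LAW.src t"] by auto
    then have "meqL (MComp s t) (MZero (LAW.src t) (LAW.tgt s))"
      using MComp.prems LAW.unbalanced_zero[of t] LAW.comp_zeroI[of s t] by auto
    moreover have "meqA (proj (MComp s t)) (MZero (strip (LAW.src t)) (strip (LAW.tgt s)))"
      using MComp.prems ne AW.comp_zeroI[of "proj s" "proj t"] proj_offdiag[of t]
      by (auto simp: proj_wf)
    from emb_zero[OF this] have "meqL (emb (proj (MComp s t))) (MZero (LAW.src t) (LAW.tgt s))"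
      using MComp.prems by (simp add: strands_strip)
    ultimately show ?thesis by (blast intro: meq_trans meq_sym)
  qed
next
  case (MTens s t)
  then show ?case by (auto intro!: meq_tens)
qed

abbreviation attach ::
  "(unit, 'k, 'a awgen) mterm \<Rightarrow>
    ('k, 'a) lterm" where
  "attach u \<equiv> MTens (idL Q) (emb u)"

lemma attach_wf: "AW.wf u \<Longrightarrow> LAW.wf (attach u)"
  using emb_wf[of R A u] by simp

lemma attach_meq: "meqA u v \<Longrightarrow> meqL (attach u) (attach v)"
  using emb_meq by (intro meq_tens meq_refl) auto

lemma attach_comp:
  assumes "AW.wf (MComp u v)"
  shows "meqL (attach (MComp u v)) (MComp (attach u) (attach v))"
  using LAW.whisker_left[of "emb u" "emb v" "[Lab Q]"] emb_wf[OF assms]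
  by simp

lemma attach_zero:
  "meqL (attach (MZero X Y)) (MZero (Lab Q # map (\<lambda>_. Istr) X) (Lab Q # map (\<lambda>_. Istr) Y))"
  using LAW.tens_MZero_right[of "idL Q" "map (\<lambda>_. Istr) X" "map (\<lambda>_. Istr) Y"]
  by (simp add: image_subset_iff)

lemma attach_plus:
  assumes "AW.wf (MPlus u v)"
  shows "meqL (attach (MPlus u v)) (MPlus (attach u) (attach v))"
  using LAW.tens_plus_right[of "idL Q" "emb u" "emb v"] emb_wf[OF assms]
  by simp

lemma attach_scal:
  assumes "AW.wf (MScal c u)"
  shows "meqL (attach (MScal c u)) (MScal c (attach u))"
  using LAW.tens_scal_right[of "idL Q" c "emb u"] emb_wf[OF assms]
  by simp

lemma zero_lcong_attach:
  assumes "LAW.src t = qword n" "LAW.tgt t = qword m"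
    "meqL t (MZero (qword n) (qword m))" "meqA (proj t) (MZero (strip (qword n)) (strip (qword m)))"
  shows "lcong t (attach (proj t))"
proof -
  have "meqL (attach (proj t)) (attach (MZero (replicate n ()) (replicate m ())))"
    using assms by (intro attach_meq) auto
  also have "meqL \<dots> (MZero (qword n) (qword m))"
    using attach_zero[of "replicate n ()" "replicate m ()"] by (simp add: qword_def)
  finally show ?thesis using assms by (blast intro: mcong_meq meq_trans meq_sym)
qed

text \<open>This dichotomy explains the choice of killed words: among the rearrangements of
  \<open>Q I\<^sup>n\<close>, only that word itself avoids a leading \<open>I\<close>.\<close>

lemma mset_qword:
  assumes "mset w = mset (qword n)"
  obtains v where "w = Istr # v" | "w = qword n"
proof (cases w)
  case Nil
  then show ?thesis using assms by (auto simp: qword_def)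
next
  case (Cons l r)
  show ?thesis
  proof (cases l)
    case Istr then show ?thesis using Cons that by auto
  next
    case (Lab q)
    then have "Lab q \<in># mset (qword n)" using assms Cons by (metis list.set_intros(1) set_mset_mset)
    then have q: "q = Q" by (simp add: qword_def split: if_splits)
    then have "mset r = mset (replicate n Istr)" using assms Cons Lab by (simp add: qword_def)
    then have "r = replicate n Istr"
      using mset_eq_length[of r "replicate n Istr"] lists_mset[of r "replicate n Istr"]
        strands_replicate[of r] by (simp add: in_lists_conv_set)
    then show ?thesis using that(2) Cons Lab q by (simp add: qword_def)
  qed
qed

text \<open>The identity of the middle word can be inserted between the factors, and it is one of
  the killed ones.\<close>

lemma through_bad:
  assumes "LAW.wf (MComp s t)" "LAW.src s = Istr # v"
  shows "lcong (MComp s t) (MZero (LAW.src t) (LAW.tgt s))"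
proof -
  have v: "Istr # v \<in> lists (letters lawp)"
    using assms LAW.src_letters[of s] by simp
  have "meqL (MComp s t) (MComp s (MComp (MId (Istr # v)) t))"
    using assms by (intro meq_comp meq_refl meq_sym[OF LAW.comp_id_left]) auto
  also have "lcong \<dots> (MComp s (MComp (MZero (Istr # v) (Istr # v)) t))"
    using assms v mcong_kill[of "MId (Istr # v)" bad_ids R lawp]
    by (intro mcong_comp LAW.mcong_refl) (auto simp: bad_ids_def)
  also have "meqL \<dots> (MZero (LAW.src t) (LAW.tgt s))"
    using LAW.comp_zeroI[of s "MComp (MZero (Istr # v) (Istr # v)) t"
        "Istr # v" "Istr # v" "LAW.src t" "Istr # v"]
      LAW.comp_MZero_left[of t "Istr # v" "Istr # v"] assms v
    by auto
  finally show ?thesis .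
qed

text \<open>The middle word of a composite is either again some \<open>qword k\<close>, or a
  rearrangement starting with \<open>I\<close>, where the composite is killed, or unbalanced, where
  it is already zero; in the last two cases the projection is zero too. In a tensor product the
  label stays in the left factor, unless that factor is a scalar. No generator has both ends of this
  form. The widths \<open>n\<close> and \<open>m\<close> may differ, so that the hypotheses apply to
  the factors of a composite without any balance condition.\<close>

lemma lcong_attach:
  "LAW.wf t \<Longrightarrow> LAW.src t = qword n \<Longrightarrow> LAW.tgt t = qword m \<Longrightarrow> lcong t (attach (proj t))"
proof (induction t arbitrary: n m)
  case (MId w)
  have "meqL (MTens (idL Q) (MId (replicate n Istr))) (MId (qword n))"
    using LAW.tens_ids[of "[Lab Q]" "replicate n Istr"] by (simp add: qword_def)
  moreover have "w = qword n" "n = m" using MId by (auto simp: qword_def)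
  ultimately show ?case by (auto intro: mcong_meq meq_sym)
next
  case (MGen g)
  have "LAW.src (MGen g) \<noteq> qword n \<or> LAW.tgt (MGen g) \<noteq> qword m"
  proof (cases g)
    case (AG h) then show ?thesis by (cases h) (auto simp: qword_def numeral_2_eq_2)
  qed (auto simp: qword_def)
  then show ?case using MGen by auto
next
  case (MZero v w)
  then show ?case by (intro zero_lcong_attach) (auto intro!: meq_refl)
next
  case (MPlus s t)
  have "lcong (MPlus s t) (MPlus (attach (proj s)) (attach (proj t)))"
    using MPlus by (intro mcong_plus) auto
  also have "meqL \<dots> (attach (MPlus (proj s) (proj t)))"
    using proj_wf[OF MPlus.prems(1)] by (intro meq_sym[OF attach_plus]) simp
  finally show ?case by simp
next
  case (MScal c t)
  have "lcong (MScal c t) (MScal c (attach (proj t)))"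
    using MScal by (intro mcong_scal) auto
  also have "meqL \<dots> (attach (MScal c (proj t)))"
    using proj_wf[OF MScal.prems(1)] by (intro meq_sym[OF attach_scal]) simp
  finally show ?case by simp
next
  case (MComp s t)
  show ?case
  proof (cases "\<exists>k. LAW.src s = qword k")
    case True
    have "lcong (MComp s t) (MComp (attach (proj s)) (attach (proj t)))"
      using MComp True by (intro mcong_comp) auto
    also have "meqL \<dots> (attach (MComp (proj s) (proj t)))"
      using proj_wf[OF MComp.prems(1)] by (intro meq_sym[OF attach_comp]) simp
    finally show ?thesis by simp
  next
    case False
    then have ne: "LAW.src t \<noteq> LAW.tgt t" using MComp.prems by (metis mwf.simps(6) msrc.simps(6))
    have z: "lcong (MComp s t) (MZero (qword n) (qword m))"
    proof (cases "mset (LAW.tgt t) = mset (qword n)")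
      case mset: True
      show ?thesis using mset
      proof (cases rule: mset_qword)
        case (1 v)
        then have "LAW.src s = Istr # v" using MComp.prems(1) by simp
        then show ?thesis
          using through_bad[OF MComp.prems(1)] MComp.prems(2,3) by (simp only: msrc.simps mtgt.simps)
      next
        case 2
        then show ?thesis using False MComp.prems(1) by (metis mwf.simps(6))
      qed
    next
      case mset: False
      then have "meqL t (MZero (LAW.src t) (LAW.tgt t))"
        using MComp.prems by (intro LAW.unbalanced_zero) auto
      then have "meqL (MComp s t) (MZero (LAW.src t) (LAW.tgt s))"
        using LAW.comp_zeroI[OF MComp.prems(1)] by blast
      then show ?thesis
        using MComp.prems(2,3) by (simp add: mcong_meq)
    qed
    have "meqA (proj (MComp s t)) (MZero (replicate n ()) (replicate m ()))"
      using MComp.prems ne AW.comp_zeroI[of "proj s" "proj t"] proj_offdiag[of t]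
      by (auto simp: proj_wf)
    then have "meqL (attach (proj (MComp s t))) (attach (MZero (replicate n ()) (replicate m ())))"
      by (rule attach_meq)
    also have "meqL \<dots> (MZero (qword n) (qword m))"
      using attach_zero[of "replicate n ()" "replicate m ()"] by (simp add: qword_def)
    finally show ?thesis using z by (blast intro: mcong_trans mcong_meq meq_sym)
  qed
next
  case (MTens s t)
  have st: "LAW.src s @ LAW.src t = qword n" "LAW.tgt s @ LAW.tgt t = qword m"
    and wf: "LAW.wf s" "LAW.wf t"
    using MTens.prems by auto
  show ?case
  \<comment> \<open>An unbalanced left factor makes both sides zero; a balanced one forces the
    target to be cut in the same way as the source.\<close>
  proof (cases "mset (LAW.src s) = mset (LAW.tgt s)")
    case False
    then have ne: "LAW.src s \<noteq> LAW.tgt s" by auto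
    have "meqL (MTens s t) (MZero (qword n) (qword m))"
      using MTens.prems False LAW.unbalanced_zero[of s] LAW.tens_zeroI[of s t] by auto
    moreover have "meqA (proj (MTens s t)) (MZero (strip (qword n)) (strip (qword m)))"
      using AW.tens_zeroI[of "proj s" "proj t"] proj_offdiag[OF wf(1) ne] wf
      by (auto simp: proj_wf simp flip: st)
    ultimately show ?thesis using MTens.prems by (intro zero_lcong_attach) auto
  next
    case True
    show ?thesis using st(1)
    proof (cases rule: qword_append)
      case 1
      then have tn: "LAW.tgt s = []" "LAW.tgt t = qword m" using True st by auto
      obtain c where c: "c \<in> carrier R" "meqL s (MScal c (MId []))"
        using LAW.unit_endomorphism[of s] 1 tn wf by auto
      have c': "meqA (proj s) (MScal c (MId []))"
        using proj_compat[OF c(2)] 1 by (auto simp: compat_def)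
      have "meqL (MTens s t) (MScal c t)"
        using c wf by (intro LAW.unit_tens)
      also have "lcong \<dots> (MScal c (attach (proj t)))"
        using c MTens.IH(2)[OF wf(2) 1(2) tn(2)] by (intro mcong_scal)
      also have "meqL \<dots> (attach (MScal c (proj t)))"
        using c wf by (intro meq_sym[OF attach_scal]) (auto simp: proj_wf)
      also have "meqL \<dots> (attach (MTens (proj s) (proj t)))"
        using c c' wf by (intro attach_meq meq_sym[OF AW.unit_tens]) (auto simp: proj_wf)
      finally show ?thesis by simp
    next
      case (2 a)
      then obtain b where b: "LAW.tgt s = qword b" "LAW.tgt t \<in> lists {Istr}"
        using qword_append[OF st(2)] True 2(1)
        by (metis list.distinct(1) mset_zero_iff_right qword_def)
      have "lcong (MTens s t) (MTens (attach (proj s)) (emb (proj t)))"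
        using MTens.IH(1)[OF wf(1) 2(1) b(1)] strands_eq_emb[OF wf(2) 2(2) b(2)]
        by (intro lcong_tens)
      also have "meqL \<dots> (attach (MTens (proj s) (proj t)))"
        using LAW.tens_assoc[of "idL Q" "emb (proj s)" "emb (proj t)"] wf
          emb_wf[OF proj_wf[OF wf(1)]] emb_wf[OF proj_wf[OF wf(2)]]
        by simp
      finally show ?thesis by simp
    qed
  qed
qed

lemma attach_cyc_gen: "lcong (attach (MTens qbr (MId X))) (attach (MZero (() # X) (() # X)))"
proof -
  let ?X = "map (\<lambda>_. Istr) X :: ('k, 'a polgen) aterm set letter list"
  have X: "?X \<in> lists (letters lawp)" by auto
  have rel: "meqL (MTens (idL Q) (br R A Q)) (MComp (MGen (Lam Q)) (MGen (Rho Q)))"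
    using Q_ECR by (intro meq_sym[OF meq_rel]) (auto intro: lam_rho)
  have Lam: "LAW.wf (MGen (Lam Q))" and Rho: "LAW.wf (MGen (Rho Q))"
    using Q_ECR by auto
  \<comment> \<open>\<open>qbr\<close> is the projection of \<open>br R A Q\<close>, whose ends
    carry no label, so embedding it again recovers \<open>[Q]\<close> by
    \<open>strands_eq_emb\<close>.\<close>
  have "meqL (attach (MTens qbr (MId X))) (MTens (idL Q) (MTens (br R A Q) (MId ?X)))"
    using X strands_eq_emb[of "br R A Q"]
    by (auto simp: qbr_def intro!: meq_tens meq_refl intro: meq_sym)
  also have "meqL \<dots> (MTens (MTens (idL Q) (br R A Q)) (MId ?X))"
    using X by (intro meq_sym[OF LAW.tens_assoc]) auto
  also have "meqL \<dots> (MTens (MComp (MGen (Lam Q)) (MGen (Rho Q))) (MId ?X))"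
    using X rel by (intro meq_tens meq_refl) auto
  also have "meqL \<dots> (MComp (MTens (MGen (Lam Q)) (MId ?X)) (MTens (MGen (Rho Q)) (MId ?X)))"
    using X Lam Rho LAW.whisker_right[of "MGen (Lam Q)" "MGen (Rho Q)" "MId ?X"] by auto
  also have "lcong \<dots> (MZero (Lab Q # Istr # ?X) (Lab Q # Istr # ?X))"
    using X Lam Rho through_bad[of "MTens (MGen (Lam Q)) (MId ?X)" "MTens (MGen (Rho Q)) (MId ?X)"] by auto
  also have "meqL \<dots> (attach (MZero (() # X) (() # X)))"
    using attach_zero[of "() # X" "() # X"] by (auto intro: meq_sym)
  finally show ?thesis .
qed

text \<open>Carries vanishing modulo \<open>Q\<^sub>1\<close> back to the labelled category, for the
  kernel computation; the substance lies in the generator case,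
  \<open>attach_cyc_gen\<close>.\<close>

lemma acong_attach: "acong u v \<Longrightarrow> lcong (attach u) (attach v)"
proof (induction rule: mcong.induct)
  case (mcong_meq s t)
  then show ?case by (intro mcong.mcong_meq attach_meq)
next
  case (mcong_sym s t)
  then show ?case by (intro mcong.mcong_sym[OF mcong_sym.IH])
next
  case (mcong_trans s t u)
  then show ?case by (intro mcong.mcong_trans[OF mcong_trans.IH])
next
  case (mcong_plus s s' t t')
  note ty = AW.mcong_types[OF mcong_plus(1)] AW.mcong_types[OF mcong_plus(2)] mcong_plus(3)
  have "meqL (attach (MPlus s t)) (MPlus (attach s) (attach t))"
    using ty by (intro attach_plus)
  also have "lcong \<dots> (MPlus (attach s') (attach t'))"
    using ty mcong_plus.IH meq_wf2[OF calculation] by (intro mcong.mcong_plus)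
  also have "meqL \<dots> (attach (MPlus s' t'))"
    using ty by (intro meq_sym[OF attach_plus]) auto
  finally show ?case .
next
  case (mcong_scal c t t')
  note ty = AW.mcong_types[OF mcong_scal(2)] mcong_scal(1)
  have "meqL (attach (MScal c t)) (MScal c (attach t))"
    using ty by (intro attach_scal) auto
  also have "lcong \<dots> (MScal c (attach t'))"
    using ty mcong_scal.IH by (intro mcong.mcong_scal)
  also have "meqL \<dots> (attach (MScal c t'))"
    using ty by (intro meq_sym[OF attach_scal]) auto
  finally show ?case .
next
  case (mcong_comp s s' t t')
  note ty = AW.mcong_types[OF mcong_comp(1)] AW.mcong_types[OF mcong_comp(2)] mcong_comp(3)
  have "meqL (attach (MComp s t)) (MComp (attach s) (attach t))"
    using ty by (intro attach_comp)
  also have "lcong \<dots> (MComp (attach s') (attach t'))"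
    using ty mcong_comp.IH meq_wf2[OF calculation] by (intro mcong.mcong_comp)
  also have "meqL \<dots> (attach (MComp s' t'))"
    using ty by (intro meq_sym[OF attach_comp]) auto
  finally show ?case .
next
  case (mcong_kill g)
  then obtain X where "g = MTens qbr (MId X)" by (auto simp: cyc_gens_def)
  then show ?case using attach_cyc_gen[of X] by simp
qed

end

section \<open>Linear categories and additive envelopes\<close>

lemma (in comm_monoid) finprod_swap:
  assumes "finite I" "finite J" "\<And>i j. i \<in> I \<Longrightarrow> j \<in> J \<Longrightarrow> f i j \<in> carrier G"
  shows "(\<Otimes>i\<in>I. \<Otimes>j\<in>J. f i j) = (\<Otimes>j\<in>J. \<Otimes>i\<in>I. f i j)"
  using assms(1,3)
proof (induction I rule: finite_induct)
  case (insert i I)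
  have "(\<Otimes>k\<in>insert i I. \<Otimes>j\<in>J. f k j) = (\<Otimes>j\<in>J. f i j) \<otimes> (\<Otimes>k\<in>I. \<Otimes>j\<in>J. f k j)"
    using insert by (intro finprod_insert) (auto intro!: finprod_closed)
  also have "\<dots> = (\<Otimes>j\<in>J. f i j) \<otimes> (\<Otimes>j\<in>J. \<Otimes>k\<in>I. f k j)"
    using insert by simp
  also have "\<dots> = (\<Otimes>j\<in>J. f i j \<otimes> (\<Otimes>k\<in>I. f k j))"
    using insert by (intro finprod_multf[symmetric]) (auto intro!: finprod_closed)
  also have "\<dots> = (\<Otimes>j\<in>J. \<Otimes>k\<in>insert i I. f k j)"
    using insert by (intro finprod_cong') (auto intro!: finprod_closed)
  finally show ?case .
qed simp

text \<open>Addition is written multiplicatively because the matrix product in \<open>Add\<close> is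
  defined through \<open>finprod\<close> over this very record.\<close>

definition hom_group :: "('k, 'o, 'f) supercategory \<Rightarrow> 'o \<Rightarrow> 'o \<Rightarrow> 'f monoid" where
  "hom_group C X Y =
    \<lparr>carrier = Mor C X Y, monoid.mult = AddM C X Y, one = ZeroM C X Y\<rparr>"

lemma hom_group_simps [simp]:
  "carrier (hom_group C X Y) = Mor C X Y"
  "monoid.mult (hom_group C X Y) = AddM C X Y"
  "one (hom_group C X Y) = ZeroM C X Y"
  by (simp_all add: hom_group_def)

locale linear_category =
  fixes R :: "('k, 'r) ring_scheme" and C :: "('k, 'o, 'f) supercategory"
  assumes hom_comm_group: "\<lbrakk>X \<in> Obj C; Y \<in> Obj C\<rbrakk> \<Longrightarrow>
      comm_group (hom_group C X Y)"
    and comp_closed: "\<lbrakk>X \<in> Obj C; Y \<in> Obj C; Z \<in> Obj C; g \<in> Mor C Y Z; f \<in> Mor C X Y\<rbrakk> \<Longrightarrow>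
      CompM C X Y Z g f \<in> Mor C X Z"
    and comp_add_left: "\<lbrakk>X \<in> Obj C; Y \<in> Obj C; Z \<in> Obj C; g \<in> Mor C Y Z; g' \<in> Mor C Y Z; f \<in> Mor C X Y\<rbrakk> \<Longrightarrow>
      CompM C X Y Z (AddM C Y Z g g') f = AddM C X Z (CompM C X Y Z g f) (CompM C X Y Z g' f)"
    and comp_add_right: "\<lbrakk>X \<in> Obj C; Y \<in> Obj C; Z \<in> Obj C; g \<in> Mor C Y Z; f \<in> Mor C X Y; f' \<in> Mor C X Y\<rbrakk> \<Longrightarrow>
      CompM C X Y Z g (AddM C X Y f f') = AddM C X Z (CompM C X Y Z g f) (CompM C X Y Z g f')"
    and comp_assoc: "\<lbrakk>W \<in> Obj C; X \<in> Obj C; Y \<in> Obj C; Z \<in> Obj C; h \<in> Mor C Y Z; g \<in> Mor C X Y; f \<in> Mor C W X\<rbrakk> \<Longrightarrow>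
      CompM C W X Z (CompM C X Y Z h g) f = CompM C W Y Z h (CompM C W X Y g f)"
    and id_closed: "\<lbrakk>X \<in> Obj C\<rbrakk> \<Longrightarrow>
      IdM C X \<in> Mor C X X"
    and id_left: "\<lbrakk>X \<in> Obj C; Y \<in> Obj C; f \<in> Mor C X Y\<rbrakk> \<Longrightarrow>
      CompM C X Y Y (IdM C Y) f = f"
    and id_right: "\<lbrakk>X \<in> Obj C; Y \<in> Obj C; f \<in> Mor C X Y\<rbrakk> \<Longrightarrow>
      CompM C X X Y f (IdM C X) = f"
    and scale_closed: "\<lbrakk>X \<in> Obj C; Y \<in> Obj C; c \<in> carrier R; f \<in> Mor C X Y\<rbrakk> \<Longrightarrow>
      ScaleM C X Y c f \<in> Mor C X Y"
    and scale_add: "\<lbrakk>X \<in> Obj C; Y \<in> Obj C; c \<in> carrier R; f \<in> Mor C X Y; g \<in> Mor C X Y\<rbrakk> \<Longrightarrow>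
      ScaleM C X Y c (AddM C X Y f g) = AddM C X Y (ScaleM C X Y c f) (ScaleM C X Y c g)"
    and scale_comp: "\<lbrakk>X \<in> Obj C; Y \<in> Obj C; Z \<in> Obj C; c \<in> carrier R; g \<in> Mor C Y Z; f \<in> Mor C X Y\<rbrakk> \<Longrightarrow>
      ScaleM C X Z c (CompM C X Y Z g f) = CompM C X Y Z (ScaleM C Y Z c g) f"
begin

lemma hom_closed:
  assumes "X \<in> Obj C" "Y \<in> Obj C"
  shows "ZeroM C X Y \<in> Mor C X Y"
    "f \<in> Mor C X Y \<Longrightarrow> g \<in> Mor C X Y \<Longrightarrow> AddM C X Y f g \<in> Mor C X Y"
    "f \<in> Mor C X Y \<Longrightarrow> AddM C X Y (ZeroM C X Y) f = f"
    "f \<in> Mor C X Y \<Longrightarrow> AddM C X Y f (ZeroM C X Y) = f"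
    "f \<in> Mor C X Y \<Longrightarrow> inv\<^bsub>hom_group C X Y\<^esub> f \<in> Mor C X Y"
    "f \<in> Mor C X Y \<Longrightarrow> AddM C X Y (inv\<^bsub>hom_group C X Y\<^esub> f) f = ZeroM C X Y"
proof -
  interpret comm_group "hom_group C X Y" using hom_comm_group assms .
  show "ZeroM C X Y \<in> Mor C X Y"
    "f \<in> Mor C X Y \<Longrightarrow> g \<in> Mor C X Y \<Longrightarrow> AddM C X Y f g \<in> Mor C X Y"
    "f \<in> Mor C X Y \<Longrightarrow> AddM C X Y (ZeroM C X Y) f = f"
    "f \<in> Mor C X Y \<Longrightarrow> AddM C X Y f (ZeroM C X Y) = f"
    "f \<in> Mor C X Y \<Longrightarrow> inv\<^bsub>hom_group C X Y\<^esub> f \<in> Mor C X Y"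
    "f \<in> Mor C X Y \<Longrightarrow> AddM C X Y (inv\<^bsub>hom_group C X Y\<^esub> f) f = ZeroM C X Y"
    using one_closed m_closed[of f g] l_one[of f] r_one[of f] inv_closed[of f] l_inv[of f]
    by simp_all
qed

lemma hom_add_comm:
  assumes "X \<in> Obj C" "Y \<in> Obj C" "f \<in> Mor C X Y" "g \<in> Mor C X Y"
  shows "AddM C X Y f g = AddM C X Y g f"
proof -
  interpret comm_group "hom_group C X Y" using hom_comm_group assms(1,2) .
  show ?thesis using m_comm[of f g] assms by simp
qed

lemma hom_add_assoc:
  assumes "X \<in> Obj C" "Y \<in> Obj C" "f \<in> Mor C X Y" "g \<in> Mor C X Y" "h \<in> Mor C X Y"
  shows "AddM C X Y (AddM C X Y f g) h = AddM C X Y f (AddM C X Y g h)"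
proof -
  interpret comm_group "hom_group C X Y" using hom_comm_group assms(1,2) .
  show ?thesis using m_assoc[of f g h] assms by simp
qed

text \<open>With this, each zero law for composition and scaling follows from additivity: the image
  \<open>z\<close> of a zero satisfies \<open>z + z = z\<close>, and morphism sets are
  groups.\<close>

lemma idem_zero:
  assumes "X \<in> Obj C" "Y \<in> Obj C" "f \<in> Mor C X Y" "AddM C X Y f f = f"
  shows "f = ZeroM C X Y"
proof -
  interpret comm_group "hom_group C X Y" using hom_comm_group assms(1,2) .
  show ?thesis using l_cancel_one[of f f] assms by simp
qed

lemma comp_zero_left:
  assumes "X \<in> Obj C" "Y \<in> Obj C" "Z \<in> Obj C" "f \<in> Mor C X Y"
  shows "CompM C X Y Z (ZeroM C Y Z) f = ZeroM C X Z"
  using assms comp_add_left[of X Y Z "ZeroM C Y Z" "ZeroM C Y Z" f]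
  by (intro idem_zero) (auto simp: hom_closed comp_closed)

lemma comp_zero_right:
  assumes "X \<in> Obj C" "Y \<in> Obj C" "Z \<in> Obj C" "g \<in> Mor C Y Z"
  shows "CompM C X Y Z g (ZeroM C X Y) = ZeroM C X Z"
  using assms comp_add_right[of X Y Z g "ZeroM C X Y" "ZeroM C X Y"]
  by (intro idem_zero) (auto simp: hom_closed comp_closed)

lemma scale_zero:
  assumes "X \<in> Obj C" "Y \<in> Obj C" "c \<in> carrier R"
  shows "ScaleM C X Y c (ZeroM C X Y) = ZeroM C X Y"
  using assms scale_add[of X Y c "ZeroM C X Y" "ZeroM C X Y"]
  by (intro idem_zero) (auto simp: hom_closed scale_closed)

abbreviation hom_sum where "hom_sum X Y f I \<equiv> finprod (hom_group C X Y) f I"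

lemma hom_sum_closed:
  assumes "X \<in> Obj C" "Y \<in> Obj C" "\<And>i. i \<in> I \<Longrightarrow> f i \<in> Mor C X Y"
  shows "hom_sum X Y f I \<in> Mor C X Y"
proof -
  interpret comm_group "hom_group C X Y" using hom_comm_group assms(1,2) .
  show ?thesis using finprod_closed[of f I] assms(3) by auto
qed

lemma hom_sum_single:
  assumes "X \<in> Obj C" "Y \<in> Obj C" "finite I" "k \<in> I" "f k \<in> Mor C X Y"
    "\<And>i. i \<in> I \<Longrightarrow> i \<noteq> k \<Longrightarrow> f i = ZeroM C X Y"
  shows "hom_sum X Y f I = f k"
proof -
  interpret comm_group "hom_group C X Y" using hom_comm_group assms(1,2) .
  have "f i \<in> Mor C X Y" if "i \<in> I" for i
    using that assms hom_closed(1)[of X Y] by (cases "i = k") auto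
  then have "hom_sum X Y f I = finprod (hom_group C X Y) (\<lambda>i. if k = i then f i else \<one>\<^bsub>hom_group C X Y\<^esub>) I"
    using assms hom_closed(1)[of X Y] by (intro finprod_cong') auto
  also have "\<dots> = f k"
    using assms \<open>\<And>i. i \<in> I \<Longrightarrow> f i \<in> Mor C X Y\<close> by (intro finprod_singleton) auto
  finally show ?thesis .
qed

lemma hom_sum_cong:
  assumes "X \<in> Obj C" "Y \<in> Obj C" "\<And>i. i \<in> I \<Longrightarrow> f i = g i" "\<And>i. i \<in> I \<Longrightarrow> g i \<in> Mor C X Y"
  shows "hom_sum X Y f I = hom_sum X Y g I"
proof -
  interpret comm_group "hom_group C X Y" using hom_comm_group assms(1,2) .
  show ?thesis using assms by (intro finprod_cong') auto
qed

lemma hom_sum_add: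
  assumes "X \<in> Obj C" "Y \<in> Obj C" "\<And>i. i \<in> I \<Longrightarrow> f i \<in> Mor C X Y" "\<And>i. i \<in> I \<Longrightarrow> g i \<in> Mor C X Y"
  shows "hom_sum X Y (\<lambda>i. AddM C X Y (f i) (g i)) I = AddM C X Y (hom_sum X Y f I) (hom_sum X Y g I)"
proof -
  interpret comm_group "hom_group C X Y" using hom_comm_group assms(1,2) .
  show ?thesis using finprod_multf[of f I g] assms by auto
qed

lemma additive_hom_sum:
  assumes "X \<in> Obj C" "Y \<in> Obj C" "X' \<in> Obj C" "Y' \<in> Obj C" "finite I"
    "\<And>i. i \<in> I \<Longrightarrow> f i \<in> Mor C X Y"
    "h (ZeroM C X Y) = ZeroM C X' Y'"
    "\<And>u. u \<in> Mor C X Y \<Longrightarrow> h u \<in> Mor C X' Y'"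
    "\<And>u v. u \<in> Mor C X Y \<Longrightarrow> v \<in> Mor C X Y \<Longrightarrow> h (AddM C X Y u v) = AddM C X' Y' (h u) (h v)"
  shows "h (hom_sum X Y f I) = hom_sum X' Y' (\<lambda>i. h (f i)) I"
proof -
  interpret S: comm_group "hom_group C X Y" using hom_comm_group assms(1,2) .
  interpret T: comm_group "hom_group C X' Y'" using hom_comm_group assms(3,4) .
  show ?thesis using assms(5,6)
  proof (induction I rule: finite_induct)
    case empty
    then show ?case using assms(7) by simp
  next
    case (insert i I)
    have "h (hom_sum X Y f (insert i I)) = h (AddM C X Y (f i) (hom_sum X Y f I))"
      using insert S.finprod_insert[of I i f] by auto
    also have "\<dots> = AddM C X' Y' (h (f i)) (h (hom_sum X Y f I))"
      using insert hom_sum_closed[of X Y I f] assms(1,2) by (intro assms(9)) auto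
    also have "\<dots> = hom_sum X' Y' (\<lambda>i. h (f i)) (insert i I)"
      using insert T.finprod_insert[of I i "\<lambda>i. h (f i)"] assms(8) by auto
    finally show ?case .
  qed
qed

lemma comp_hom_sum_right:
  assumes "X \<in> Obj C" "Y \<in> Obj C" "Z \<in> Obj C" "finite I" "g \<in> Mor C Y Z" "\<And>i. i \<in> I \<Longrightarrow> f i \<in> Mor C X Y"
  shows "CompM C X Y Z g (hom_sum X Y f I) = hom_sum X Z (\<lambda>i. CompM C X Y Z g (f i)) I"
  using assms by (intro additive_hom_sum) (auto simp: comp_zero_right comp_closed comp_add_right)

lemma comp_hom_sum_left:
  assumes "X \<in> Obj C" "Y \<in> Obj C" "Z \<in> Obj C" "finite I" "f \<in> Mor C X Y" "\<And>i. i \<in> I \<Longrightarrow> g i \<in> Mor C Y Z"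
  shows "CompM C X Y Z (hom_sum Y Z g I) f = hom_sum X Z (\<lambda>i. CompM C X Y Z (g i) f) I"
  using assms
  by (intro additive_hom_sum[where h = "\<lambda>g. CompM C X Y Z g f"])
    (auto simp: comp_zero_left comp_closed comp_add_left)

lemma scale_hom_sum:
  assumes "X \<in> Obj C" "Y \<in> Obj C" "finite I" "c \<in> carrier R" "\<And>i. i \<in> I \<Longrightarrow> f i \<in> Mor C X Y"
  shows "ScaleM C X Y c (hom_sum X Y f I) = hom_sum X Y (\<lambda>i. ScaleM C X Y c (f i)) I"
  using assms by (intro additive_hom_sum) (auto simp: scale_zero scale_closed scale_add)

lemma hom_sum_swap:
  assumes "X \<in> Obj C" "Y \<in> Obj C" "finite I" "finite J" "\<And>i j. i \<in> I \<Longrightarrow> j \<in> J \<Longrightarrow> f i j \<in> Mor C X Y"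
  shows "hom_sum X Y (\<lambda>i. hom_sum X Y (f i) J) I = hom_sum X Y (\<lambda>j. hom_sum X Y (\<lambda>i. f i j) I) J"
proof -
  interpret comm_group "hom_group C X Y" using hom_comm_group assms(1,2) .
  show ?thesis using assms by (intro finprod_swap) auto
qed

lemma ring_End_alg:
  assumes "X \<in> Obj C" shows "ring (End_alg C X)"
  by (intro ringI abelian_groupI monoidI)
    (use assms in \<open>auto simp: End_alg_def comp_closed hom_closed id_closed id_left id_right
      comp_add_left comp_add_right comp_assoc hom_add_assoc intro: hom_add_comm hom_closed(5,6)\<close>)

end

section \<open>Matrices over a linear category: the additive envelope\<close>

lemma restrict2_apply [simp]: "i \<in> I \<Longrightarrow> j \<in> J \<Longrightarrow> restrict2 I J f i j = f i j"
  by (simp add: restrict2_def)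

lemma restrict2_cong:
  "(\<And>i j. i \<in> I \<Longrightarrow> j \<in> J \<Longrightarrow> f i j = g i j) \<Longrightarrow> restrict2 I J f = restrict2 I J g"
  by (auto simp: restrict2_def fun_eq_iff)

lemma restrict2_idem [simp]: "restrict2 I J (restrict2 I J f) = restrict2 I J f"
  by (auto simp: restrict2_def fun_eq_iff)

lemma restrict2_eqI:
  assumes "f = restrict2 I J f" "\<And>i j. i \<in> I \<Longrightarrow> j \<in> J \<Longrightarrow> f i j = g i j"
  shows "restrict2 I J g = f"
  using assms(1) restrict2_cong[of I J f g] assms(2) by simp

lemma Add_simps:
  "Obj (Add C) = {(I, X). finite I \<and> X ` I \<subseteq> Obj C}"
  "Mor (Add C) (I, X) (J, Y) = {f. f = restrict2 J I f \<and> (\<forall>j\<in>J. \<forall>i\<in>I. f j i \<in> Mor C (X i) (Y j))}"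
  "IdM (Add C) (I, X) = restrict2 I I (\<lambda>j i. if j = i then IdM C (X i) else ZeroM C (X i) (X j))"
  "CompM (Add C) (I, X) (J, Y) (K, Z) g f = restrict2 K I (\<lambda>k i.
     finprod (hom_group C (X i) (Z k)) (\<lambda>j. CompM C (X i) (Y j) (Z k) (g k j) (f j i)) J)"
  "ZeroM (Add C) (I, X) (J, Y) = restrict2 J I (\<lambda>j i. ZeroM C (X i) (Y j))"
  "AddM (Add C) (I, X) (J, Y) f g = restrict2 J I (\<lambda>j i. AddM C (X i) (Y j) (f j i) (g j i))"
  "ScaleM (Add C) (I, X) (J, Y) c f = restrict2 J I (\<lambda>j i. ScaleM C (X i) (Y j) c (f j i))"
  by (simp_all add: Add_def hom_group_def)

context linear_category
begin

lemma comm_group_Add: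
  assumes "(I, X) \<in> Obj (Add C)" "(J, Y) \<in> Obj (Add C)"
  shows "comm_group (hom_group (Add C) (I, X) (J, Y))"
proof -
  have ob: "X i \<in> Obj C" "Y j \<in> Obj C" if "i \<in> I" "j \<in> J" for i j
    using assms that by (auto simp: Add_simps)
  let ?add = "AddM (Add C) (I, X) (J, Y)" and ?M = "Mor (Add C) (I, X) (J, Y)"
    and ?z = "ZeroM (Add C) (I, X) (J, Y)"
  show ?thesis
  proof (rule comm_groupI; simp only: hom_group_simps)
    fix f g h
    assume f: "f \<in> ?M" and g: "g \<in> ?M"
      and h: "h \<in> ?M"
    show "?add (?add f g) h
        = ?add f (?add g h)"
      using f g h ob by (auto simp: Add_simps hom_add_assoc intro!: restrict2_cong)
  next
    fix f g
    assume f: "f \<in> ?M" and g: "g \<in> ?M"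
    show "?add f g \<in> ?M"
      using f g ob by (auto simp: Add_simps hom_closed)
    show "?add f g = ?add g f"
      using f g ob by (auto simp: Add_simps intro!: restrict2_cong hom_add_comm)
  next
    fix f assume f: "f \<in> ?M"
    then have f_eq: "f = restrict2 J I f" by (auto simp: Add_simps)
    show "?add (?z) f = f"
      unfolding Add_simps using f ob
      by (intro restrict2_eqI[OF f_eq]) (auto simp: Add_simps hom_closed)
    let ?n = "restrict2 J I (\<lambda>j i. inv\<^bsub>hom_group C (X i) (Y j)\<^esub> f j i)"
    show "\<exists>y\<in>?M.
        ?add y f = ?z"
      using f ob by (intro bexI[of _ ?n]) (auto simp: Add_simps hom_closed intro!: restrict2_cong)
  next
    show "?z \<in> ?M"
      using ob by (auto simp: Add_simps hom_closed)
  qed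
qed

lemma linear_category_Add: "linear_category R (Add C)"
proof (rule linear_category.intro, goal_cases)
  case (1 X Y)
  then show ?case using comm_group_Add by (cases X; cases Y) auto
next
  case (2 X Y Z g f)
  then show ?case
    by (cases X; cases Y; cases Z)
      (auto simp: Add_simps image_subset_iff intro!: hom_sum_closed comp_closed)
next
  case (3 X Y Z g g' f)
  then show ?case
    by (cases X; cases Y; cases Z)
      (auto simp: Add_simps image_subset_iff comp_add_left comp_closed
        intro!: restrict2_cong hom_sum_add[symmetric] trans[OF hom_sum_cong hom_sum_add] hom_closed)
next
  case (4 X Y Z g f f')
  then show ?case
    by (cases X; cases Y; cases Z)
      (auto simp: Add_simps image_subset_iff comp_add_right comp_closed
        intro!: restrict2_cong hom_sum_add[symmetric] trans[OF hom_sum_cong hom_sum_add] hom_closed)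
next
  \<comment> \<open>Associativity of matrix multiplication: composition is distributed over the
    inner sums, reassociated entry by entry, and the two finite sums are exchanged and collected
    again.\<close>
  case (5 W' X' Y' Z' h g f)
  obtain I W J X K Y L Z where eq: "W' = (I, W)" "X' = (J, X)" "Y' = (K, Y)" "Z' = (L, Z)"
    by (cases W'; cases X'; cases Y'; cases Z') auto
  have fin: "finite I" "finite J" "finite K" "finite L"
    and ob: "\<And>i. i \<in> I \<Longrightarrow> W i \<in> Obj C" "\<And>i. i \<in> J \<Longrightarrow> X i \<in> Obj C"
      "\<And>i. i \<in> K \<Longrightarrow> Y i \<in> Obj C" "\<And>i. i \<in> L \<Longrightarrow> Z i \<in> Obj C"
    and mem: "\<And>l k. l \<in> L \<Longrightarrow> k \<in> K \<Longrightarrow> h l k \<in> Mor C (Y k) (Z l)"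
      "\<And>k j. k \<in> K \<Longrightarrow> j \<in> J \<Longrightarrow> g k j \<in> Mor C (X j) (Y k)"
      "\<And>j i. j \<in> J \<Longrightarrow> i \<in> I \<Longrightarrow> f j i \<in> Mor C (W i) (X j)"
    using 5 unfolding eq by (auto simp: Add_simps)
  show ?case unfolding eq Add_simps
  proof (rule restrict2_cong)
    fix l i assume li: "l \<in> L" "i \<in> I"
    have "hom_sum (W i) (Z l) (\<lambda>j. CompM C (W i) (X j) (Z l) (restrict2 L J (\<lambda>l j. hom_sum (X j) (Z l)
          (\<lambda>k. CompM C (X j) (Y k) (Z l) (h l k) (g k j)) K) l j) (f j i)) J
      = hom_sum (W i) (Z l) (\<lambda>j. hom_sum (W i) (Z l) (\<lambda>k.
          CompM C (W i) (Y k) (Z l) (h l k) (CompM C (W i) (X j) (Y k) (g k j) (f j i))) K) J"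
    proof (rule hom_sum_cong)
      fix j assume j: "j \<in> J"
      have "CompM C (W i) (X j) (Z l) (hom_sum (X j) (Z l)
          (\<lambda>k. CompM C (X j) (Y k) (Z l) (h l k) (g k j)) K) (f j i)
        = hom_sum (W i) (Z l) (\<lambda>k. CompM C (W i) (X j) (Z l)
          (CompM C (X j) (Y k) (Z l) (h l k) (g k j)) (f j i)) K"
        using li j fin ob mem comp_closed by (intro comp_hom_sum_left) auto
      also have "\<dots> = hom_sum (W i) (Z l) (\<lambda>k.
          CompM C (W i) (Y k) (Z l) (h l k) (CompM C (W i) (X j) (Y k) (g k j) (f j i))) K"
        using li j fin ob mem comp_closed by (intro hom_sum_cong comp_assoc) auto
      finally show "CompM C (W i) (X j) (Z l) (restrict2 L J (\<lambda>l j. hom_sum (X j) (Z l)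
          (\<lambda>k. CompM C (X j) (Y k) (Z l) (h l k) (g k j)) K) l j) (f j i) = \<dots>"
        using li j by simp
    qed (use li ob mem comp_closed in \<open>auto intro!: hom_sum_closed\<close>)
    also have "\<dots> = hom_sum (W i) (Z l) (\<lambda>k. hom_sum (W i) (Z l) (\<lambda>j.
          CompM C (W i) (Y k) (Z l) (h l k) (CompM C (W i) (X j) (Y k) (g k j) (f j i))) J) K"
      using li fin ob mem comp_closed by (intro hom_sum_swap) auto
    also have "\<dots> = hom_sum (W i) (Z l) (\<lambda>k. CompM C (W i) (Y k) (Z l) (h l k)
          (restrict2 K I (\<lambda>k i. hom_sum (W i) (Y k) (\<lambda>j. CompM C (W i) (X j) (Y k) (g k j) (f j i)) J) k i)) K"
      using li fin ob mem comp_closed hom_sum_closed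
      by (intro hom_sum_cong) (auto simp: comp_hom_sum_right intro!: hom_sum_closed)
    finally show "hom_sum (W i) (Z l) (\<lambda>j. CompM C (W i) (X j) (Z l) (restrict2 L J (\<lambda>l j. hom_sum (X j) (Z l)
          (\<lambda>k. CompM C (X j) (Y k) (Z l) (h l k) (g k j)) K) l j) (f j i)) J = \<dots>" .
  qed
next
  case (6 X)
  then show ?case
    by (cases X) (auto simp: Add_simps image_subset_iff intro: id_closed hom_closed)
next
  case (7 X' Y' f)
  obtain I X J Y where eq: "X' = (I, X)" "Y' = (J, Y)"
    by (cases X'; cases Y') auto
  have fin: "finite I" "finite J"
    and ob: "\<And>i. i \<in> I \<Longrightarrow> X i \<in> Obj C" "\<And>i. i \<in> J \<Longrightarrow> Y i \<in> Obj C"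
    and mem: "\<And>j i. j \<in> J \<Longrightarrow> i \<in> I \<Longrightarrow> f j i \<in> Mor C (X i) (Y j)" and f: "f = restrict2 J I f"
    using 7 unfolding eq by (auto simp: Add_simps)
  show ?case unfolding eq Add_simps
  proof (rule restrict2_eqI[OF f])
    fix j i assume ji: "j \<in> J" "i \<in> I"
    show "f j i = hom_sum (X i) (Y j) (\<lambda>k. CompM C (X i) (Y k) (Y j) (restrict2 J J (\<lambda>j i. if j = i
        then IdM C (Y i) else ZeroM C (Y i) (Y j)) j k) (f k i)) J"
      using ji ob mem fin
      by (subst hom_sum_single[where k = j]) (auto simp: id_left comp_zero_left)
  qed
next
  case (8 X' Y' f)
  obtain I X J Y where eq: "X' = (I, X)" "Y' = (J, Y)"
    by (cases X'; cases Y') auto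
  have fin: "finite I" "finite J"
    and ob: "\<And>i. i \<in> I \<Longrightarrow> X i \<in> Obj C" "\<And>i. i \<in> J \<Longrightarrow> Y i \<in> Obj C"
    and mem: "\<And>j i. j \<in> J \<Longrightarrow> i \<in> I \<Longrightarrow> f j i \<in> Mor C (X i) (Y j)" and f: "f = restrict2 J I f"
    using 8 unfolding eq by (auto simp: Add_simps)
  show ?case unfolding eq Add_simps
  proof (rule restrict2_eqI[OF f])
    fix j i assume ji: "j \<in> J" "i \<in> I"
    show "f j i = hom_sum (X i) (Y j) (\<lambda>k. CompM C (X i) (X k) (Y j) (f j k) (restrict2 I I (\<lambda>j i. if j = i
        then IdM C (X i) else ZeroM C (X i) (X j)) k i)) I"
      using ji ob mem fin
      by (subst hom_sum_single[where k = i]) (auto simp: id_right comp_zero_right)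
  qed
next
  case (9 X Y c f)
  then show ?case
    by (cases X; cases Y) (auto simp: Add_simps image_subset_iff scale_closed)
next
  case (10 X Y c f g)
  then show ?case
    by (cases X; cases Y) (auto simp: Add_simps image_subset_iff scale_add intro!: restrict2_cong)
next
  case (11 X Y Z c g f)
  then show ?case
    by (cases X; cases Y; cases Z)
      (auto simp: Add_simps image_subset_iff scale_hom_sum comp_closed scale_closed scale_comp
        intro!: restrict2_cong hom_sum_cong)
qed

end

section \<open>Linearity of the category of classes of terms\<close>

context mpresentation
begin

abbreviation "pcat \<equiv> presented_supercat R P"

lemma Mor_pcat: "Mor pcat X Y = {mcls R P t |t. wf t \<and> src t = X \<and> tgt t = Y}"
  by (simp add: presented_supercat_def)

lemma mcls_mem: "wf t \<Longrightarrow> src t = X \<Longrightarrow> tgt t = Y \<Longrightarrow> mcls R P t \<in> Mor pcat X Y"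
  by (auto simp: Mor_pcat)

lemma MorE:
  assumes "f \<in> Mor pcat X Y"
  obtains t where "wf t" "src t = X" "tgt t = Y" "f = mcls R P t"
  using assms by (auto simp: Mor_pcat)

text \<open>The operations on classes are unions over representatives. Since all representatives
  yield the same class, the union collapses to that class.\<close>

lemma UN_mcls:
  assumes "wf t" "\<And>t'. meq R P t t' \<Longrightarrow> F t' = B" shows "(\<Union>t'\<in>mcls R P t. F t') = B"
proof -
  have "t \<in> mcls R P t" using assms by (simp add: mem_mcls meq_refl)
  then show ?thesis using assms(2) by (auto simp: mem_mcls)
qed

lemma mcls_comp:
  assumes "wf (MComp s t)"
  shows "CompM pcat X Y Z (mcls R P s) (mcls R P t) = mcls R P (MComp s t)"
  unfolding presented_supercat_def supercategory.simps using assms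
  by (intro UN_mcls mcls_eqI meq_sym[OF meq_comp]) auto

lemma mcls_plus:
  assumes "wf (MPlus s t)"
  shows "AddM pcat X Y (mcls R P s) (mcls R P t) = mcls R P (MPlus s t)"
  unfolding presented_supercat_def supercategory.simps using assms
  by (intro UN_mcls mcls_eqI meq_sym[OF meq_plus]) auto

lemma mcls_scal:
  assumes "wf (MScal c t)"
  shows "ScaleM pcat X Y c (mcls R P t) = mcls R P (MScal c t)"
  unfolding presented_supercat_def supercategory.simps using assms
  by (intro UN_mcls mcls_eqI meq_sym[OF meq_scal]) auto

lemma pcat_simps:
  "Obj pcat = lists (letters P)" "IdM pcat X = mcls R P (MId X)" "ZeroM pcat X Y = mcls R P (MZero X Y)"
  by (simp_all add: presented_supercat_def)

lemma comm_group_pcat: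
  assumes "X \<in> Obj pcat" "Y \<in> Obj pcat"
  shows "comm_group (hom_group pcat X Y)"
proof (intro comm_groupI)
  note ob = assms[unfolded pcat_simps]
  fix x assume "x \<in> carrier (hom_group pcat X Y)"
  then obtain s where s: "wf s" "src s = X" "tgt s = Y" "x = mcls R P s" by (auto elim: MorE)
  show "\<one>\<^bsub>hom_group pcat X Y\<^esub> \<otimes>\<^bsub>hom_group pcat X Y\<^esub> x = x"
    using s ob by (simp add: pcat_simps mcls_plus mcls_eqI plus_zero_left del: in_lists_conv_set)
  have "meq R P (MPlus (MScal (\<ominus> \<one>) s) s) (MZero X Y)"
    using s plus_neg[of s] plus_comm[of "MScal (\<ominus> \<one>) s" s] by (auto intro: meq_trans)
  then show "\<exists>y\<in>carrier (hom_group pcat X Y).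
      y \<otimes>\<^bsub>hom_group pcat X Y\<^esub> x = \<one>\<^bsub>hom_group pcat X Y\<^esub>"
    using s ob by (intro bexI[of _ "mcls R P (MScal (\<ominus> \<one>) s)"])
      (auto simp: pcat_simps mcls_plus intro!: mcls_eqI mcls_mem)
  fix y assume "y \<in> carrier (hom_group pcat X Y)"
  then obtain t where t: "wf t" "src t = X" "tgt t = Y" "y = mcls R P t" by (auto elim: MorE)
  show "x \<otimes>\<^bsub>hom_group pcat X Y\<^esub> y \<in> carrier (hom_group pcat X Y)"
    using s t by (auto simp: mcls_plus intro!: mcls_mem)
  show "x \<otimes>\<^bsub>hom_group pcat X Y\<^esub> y = y \<otimes>\<^bsub>hom_group pcat X Y\<^esub> x"
    using s t by (simp add: mcls_plus mcls_eqI plus_comm)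
  fix z assume "z \<in> carrier (hom_group pcat X Y)"
  then obtain u where u: "wf u" "src u = X" "tgt u = Y" "z = mcls R P u" by (auto elim: MorE)
  show "x \<otimes>\<^bsub>hom_group pcat X Y\<^esub> y \<otimes>\<^bsub>hom_group pcat X Y\<^esub> z
      = x \<otimes>\<^bsub>hom_group pcat X Y\<^esub> (y \<otimes>\<^bsub>hom_group pcat X Y\<^esub> z)"
    using s t u by (simp add: mcls_plus mcls_eqI plus_assoc)
next
  show "\<one>\<^bsub>hom_group pcat X Y\<^esub> \<in> carrier (hom_group pcat X Y)"
    using assms by (auto simp: pcat_simps intro!: mcls_mem)
qed

lemma linear_category_pcat: "linear_category R pcat"
proof (rule linear_category.intro, goal_cases)
  case (1 X Y)
  then show ?case by (rule comm_group_pcat)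
next
  case (2 X Y Z g f)
  then show ?case by (auto elim!: MorE simp: mcls_comp intro!: mcls_mem)
next
  case (3 X Y Z g g' f)
  then show ?case
    by (elim MorE) (simp add: mcls_comp mcls_plus, intro mcls_eqI comp_plus_left, simp)
next
  case (4 X Y Z g f f')
  then show ?case
    by (elim MorE) (simp add: mcls_comp mcls_plus, intro mcls_eqI comp_plus_right, simp)
next
  case (5 W X Y Z h g f)
  then show ?case
    by (elim MorE) (simp add: mcls_comp, intro mcls_eqI comp_assoc, simp)
next
  case (6 X)
  then show ?case by (auto simp: pcat_simps intro!: mcls_mem)
next
  case (7 X Y f)
  then show ?case
    by (elim MorE) (simp add: pcat_simps mcls_comp, intro mcls_eqI comp_id_left, simp_all)
next
  case (8 X Y f)
  then show ?case
    by (elim MorE) (simp add: pcat_simps mcls_comp, intro mcls_eqI comp_id_right, simp_all)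
next
  case (9 X Y c f)
  then show ?case by (auto elim!: MorE simp: mcls_scal intro!: mcls_mem)
next
  case (10 X Y c f g)
  then show ?case
    by (elim MorE) (simp add: mcls_scal mcls_plus, intro mcls_eqI meq_ax mon_ax.intros, simp_all)
next
  case (11 X Y Z c g f)
  then show ?case
    by (elim MorE) (simp add: mcls_scal mcls_comp, intro mcls_eqI meq_sym[OF comp_scal_left], simp)
qed

end

section \<open>Quotients of superalgebras\<close>

lemma quot_superalg_simps [simp]:
  "carrier (quot_superalg F I) = carrier (F Quot I)"
  "monoid.mult (quot_superalg F I) = monoid.mult (F Quot I)"
  "one (quot_superalg F I) = one (F Quot I)"
  "zero (quot_superalg F I) = zero (F Quot I)"
  "add (quot_superalg F I) = add (F Quot I)"
  "hpart (quot_superalg F I) p = (\<lambda>x. I +>\<^bsub>F\<^esub> x) ` hpart F p"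
  by (simp_all add: quot_superalg_def)

text \<open>\<open>quot_superalg\<close> is another record than the factor ring \<open>Quot\<close>
  and shares only its ring fields, so the ring axioms have to be carried over.\<close>

lemma ring_cong:
  assumes "ring S" "carrier S' = carrier S" "monoid.mult S' = monoid.mult S" "one S' = one S"
    "zero S' = zero S" "add S' = add S"
  shows "ring S'"
proof -
  interpret S: ring S by fact
  have "\<exists>y \<in> carrier S. y \<oplus>\<^bsub>S\<^esub> x = \<zero>\<^bsub>S\<^esub>" if "x \<in> carrier S" for x
    using that S.l_neg by blast
  then show ?thesis
    by (intro ringI abelian_groupI monoidI)
      (simp_all add: assms(2-) S.a_ac S.m_assoc S.l_distr S.r_distr)
qed

lemma ring_quot_superalg: "ideal I F \<Longrightarrow> ring (quot_superalg F I)"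
  by (rule ring_cong[OF ideal.quotient_is_ring]) auto

text \<open>Absorption already provides additive inverses, by multiplication with the negative of
  the unit.\<close>

lemma (in ring) idealI_closed:
  assumes "K \<subseteq> carrier R" "\<zero> \<in> K" "\<And>a b. a \<in> K \<Longrightarrow> b \<in> K \<Longrightarrow> a \<oplus> b \<in> K"
    "\<And>a x. a \<in> K \<Longrightarrow> x \<in> carrier R \<Longrightarrow> x \<otimes> a \<in> K"
    "\<And>a x. a \<in> K \<Longrightarrow> x \<in> carrier R \<Longrightarrow> a \<otimes> x \<in> K"
  shows "ideal K R"
proof (rule idealI[OF ring_axioms _ assms(4,5)])
  have "\<ominus> a \<in> K" if "a \<in> K" for a
    using assms(4)[OF that, of "\<ominus> \<one>"] that assms(1) by (auto simp: l_minus)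
  then show "subgroup K (add_monoid R)"
    using assms by (intro add.subgroupI) (auto simp: a_inv_def[symmetric])
qed

locale scaled_ring = ring F for R :: "('k, 'r) ring_scheme" and F :: "('k, 'a, 'm) superalgebra_scheme" (structure) +
  assumes smult_closed: "c \<in> carrier R \<Longrightarrow> x \<in> carrier F \<Longrightarrow> c \<odot> x \<in> carrier F"
    and smult_add: "c \<in> carrier R \<Longrightarrow> x \<in> carrier F \<Longrightarrow> y \<in> carrier F \<Longrightarrow> c \<odot> (x \<oplus> y) = c \<odot> x \<oplus> c \<odot> y"
    and smult_mult: "c \<in> carrier R \<Longrightarrow> x \<in> carrier F \<Longrightarrow> y \<in> carrier F \<Longrightarrow> c \<odot> (x \<otimes> y) = (c \<odot> x) \<otimes> y"
begin

text \<open>A scalar acts as multiplication by \<open>c \<odot> \<one>\<close>, so the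
  ring-theoretic \<open>genideal\<close> automatically respects the linear structure.\<close>

lemma smult_ideal:
  assumes "ideal I F" "c \<in> carrier R" "x \<in> I" shows "c \<odot> x \<in> I"
proof -
  interpret ideal I F by fact
  have "c \<odot> x = (c \<odot> \<one>) \<otimes> x"
    using assms smult_mult[of c \<one> x] by auto
  then show ?thesis using assms I_l_closed smult_closed by auto
qed

lemma coset_zero_iff:
  assumes "ideal I F" "x \<in> carrier F" shows "I +> x = I \<longleftrightarrow> x \<in> I"
proof -
  interpret ideal I F by fact
  show ?thesis
  proof
    assume "I +> x = I" then show "x \<in> I" using a_rcos_self[OF assms(2)] by simp
  next
    assume "x \<in> I" then show "I +> x = I" by (rule a_rcos_const)
  qed
qed

lemma smult_coset:
  assumes "ideal I F" "c \<in> carrier R" "x \<in> carrier F"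
  shows "c \<odot>\<^bsub>quot_superalg F I\<^esub> (I +> x) = I +> (c \<odot> x)"
proof -
  interpret ideal I F by fact
  have coset: "I +> (c \<odot> y) = I +> (c \<odot> x)" if y: "y \<in> I +> x" for y
  proof -
    obtain i where i: "i \<in> I" "y = i \<oplus> x" using y by (auto simp: a_r_coset_def')
    have "c \<odot> y = c \<odot> i \<oplus> c \<odot> x" using i assms smult_add by simp
    then have "c \<odot> y \<in> I +> (c \<odot> x)"
      using smult_ideal[OF assms(1,2) i(1)] by (auto simp: a_r_coset_def')
    then show ?thesis
      using a_repr_independence[OF _ smult_closed[OF assms(2,3)] a_subgroup] by simp
  qed
  have "I +> x \<noteq> {}" using a_rcos_self[OF assms(3)] by (metis empty_iff)
  then have "(\<Union>y\<in>I +> x. I +> (c \<odot> y)) = I +> (c \<odot> x)"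
    by (rule SUP_eq_const) (rule coset)
  then show ?thesis by (simp add: quot_superalg_def)
qed

text \<open>The first isomorphism theorem, with the ring part taken from
  \<open>FactRing_iso_set\<close>. The map \<open>h\<close> is constant on cosets of its kernel, so
  \<open>the_elem\<close> picks out its value, and scalars and parities are checked on
  representatives.\<close>

lemma quot_superalg_iso:
  assumes hom: "h \<in> ring_hom F G" and G: "ring G" and surj: "h ` carrier F = carrier G"
    and scal: "\<And>c x. c \<in> carrier R \<Longrightarrow> x \<in> carrier F \<Longrightarrow> h (c \<odot> x) = c \<odot>\<^bsub>G\<^esub> h x"
    and par: "\<And>p x. x \<in> hpart F p \<Longrightarrow> x \<in> carrier F \<and> h x \<in> hpart G p"
    and J: "J = a_kernel F G h"
  shows "superalg_iso R (quot_superalg F J) G (\<lambda>X. the_elem (h ` X))"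
proof -
  interpret G: ring G by fact
  interpret ring_hom_ring F G h by (rule ring_hom_ringI2[OF ring_axioms G hom])
  have idl: "ideal J F" unfolding J by (rule kernel_is_ideal)
  then interpret J: ideal J F .
  have val: "the_elem (h ` (J +> x)) = h x" if "x \<in> carrier F" for x
  proof -
    have "h ` (J +> x) = {h x}"
    proof
      show "h ` (J +> x) \<subseteq> {h x}"
      proof
        fix y assume "y \<in> h ` (J +> x)"
        then obtain j where j: "j \<in> J" "y = h (j \<oplus> x)" by (auto simp: a_r_coset_def')
        then have "j \<in> carrier F" "h j = \<zero>\<^bsub>G\<^esub>" unfolding J a_kernel_def' by auto
        then show "y \<in> {h x}" using j that by simp
      qed
      show "{h x} \<subseteq> h ` (J +> x)" using J.a_rcos_self[OF that] by blast
    qed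
    then show ?thesis by simp
  qed
  have iso: "(\<lambda>X. the_elem (h ` X)) \<in> ring_iso (F Quot J) G"
    unfolding J using FactRing_iso_set[OF surj] .
  have "(\<lambda>X. the_elem (h ` X)) \<in> ring_iso (quot_superalg F J) G"
    using iso unfolding ring_iso_def ring_hom_def by simp
  moreover have "linear_map R (quot_superalg F J) G (\<lambda>X. the_elem (h ` X))"
    unfolding linear_map_def
  proof (intro conjI ballI)
    show "(\<lambda>X. the_elem (h ` X)) \<in> carrier (quot_superalg F J) \<rightarrow> carrier G"
      using iso by (auto simp: ring_iso_def ring_hom_def)
    show "the_elem (h ` (X \<oplus>\<^bsub>quot_superalg F J\<^esub> Y)) = the_elem (h ` X) \<oplus>\<^bsub>G\<^esub> the_elem (h ` Y)"
      if "X \<in> carrier (quot_superalg F J)" "Y \<in> carrier (quot_superalg F J)" for X Y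
      using iso that by (auto simp: ring_iso_def ring_hom_def)
    show "the_elem (h ` (c \<odot>\<^bsub>quot_superalg F J\<^esub> X)) = c \<odot>\<^bsub>G\<^esub> the_elem (h ` X)"
      if c: "c \<in> carrier R" and X: "X \<in> carrier (quot_superalg F J)" for c X
    proof -
      obtain x where x: "x \<in> carrier F" "X = J +> x"
        using X by (auto simp: FactRing_def A_RCOSETS_def')
      then show ?thesis using c by (simp add: smult_coset[OF idl] val smult_closed scal)
    qed
  qed
  moreover have "(\<lambda>X. the_elem (h ` X)) ` hpart (quot_superalg F J) p \<subseteq> hpart G p" for p
    using par val by auto
  ultimately show ?thesis by (auto simp: superalg_iso_def)
qed

end

section \<open>Matrix units in the endomorphism ring of a direct sum\<close>

lemma End_alg_simps [simp]:
  "carrier (End_alg C X) = Mor C X X" "monoid.mult (End_alg C X) = CompM C X X X"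
  "one (End_alg C X) = IdM C X" "zero (End_alg C X) = ZeroM C X X" "add (End_alg C X) = AddM C X X"
  "smult (End_alg C X) = ScaleM C X X" "hpart (End_alg C X) = MorP C X X"
  by (simp_all add: End_alg_def)

text \<open>A matrix unit with coefficient \<open>f\<close>; rows index targets and columns index
  sources.\<close>

definition elem_mor ::
  "('k, 'o, 'f) supercategory \<Rightarrow> 'i set \<Rightarrow> ('i \<Rightarrow> 'o) \<Rightarrow> 'i \<Rightarrow> 'i \<Rightarrow> 'f \<Rightarrow> 'i \<Rightarrow> 'i \<Rightarrow> 'f" where
  "elem_mor C I X j i f =
    restrict2 I I (\<lambda>j' i'. if j' = j \<and> i' = i then f else ZeroM C (X i') (X j'))"

text \<open>The idempotent of the summands in \<open>T\<close>. Having \<open>T\<close> as a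
  parameter lets the identity be assembled from matrix units by induction over a finite set.\<close>

definition diag_id ::
  "('k, 'o, 'f) supercategory \<Rightarrow> 'i set \<Rightarrow> ('i \<Rightarrow> 'o) \<Rightarrow> 'i set \<Rightarrow> 'i \<Rightarrow> 'i \<Rightarrow> 'f" where
  "diag_id C I X T =
    restrict2 I I (\<lambda>j i. if j = i \<and> i \<in> T then IdM C (X i) else ZeroM C (X i) (X j))"

lemma summand_id_elem: "summand_id C (I, X) k = elem_mor C I X k k (IdM C (X k))"
  by (simp add: summand_id_def elem_mor_def)

context linear_category
begin

lemma scaled_ring_End_alg:
  assumes "X \<in> Obj C" shows "scaled_ring R (End_alg C X)"
  using ring_End_alg[OF assms] assms
  by (intro scaled_ring.intro scaled_ring_axioms.intro) (auto simp: scale_closed scale_add scale_comp)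

context
  fixes I :: "'i set" and X :: "'i \<Rightarrow> 'o"
  assumes fin: "finite I" and ob: "\<And>i. i \<in> I \<Longrightarrow> X i \<in> Obj C"
begin

lemma sum_obj: "(I, X) \<in> Obj (Add C)"
  using fin ob by (auto simp: Add_simps)

lemma elem_mor_closed:
  "j \<in> I \<Longrightarrow> i \<in> I \<Longrightarrow> f \<in> Mor C (X i) (X j) \<Longrightarrow> elem_mor C I X j i f \<in> Mor (Add C) (I, X) (I, X)"
  using ob by (auto simp: Add_simps elem_mor_def hom_closed)

lemma elem_mor_add:
  "j \<in> I \<Longrightarrow> i \<in> I \<Longrightarrow> f \<in> Mor C (X i) (X j) \<Longrightarrow> g \<in> Mor C (X i) (X j) \<Longrightarrow>
    elem_mor C I X j i (AddM C (X i) (X j) f g) =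
    AddM (Add C) (I, X) (I, X) (elem_mor C I X j i f) (elem_mor C I X j i g)"
  using ob by (auto simp: Add_simps elem_mor_def hom_closed intro!: restrict2_cong)

lemma elem_mor_zero: "elem_mor C I X j i (ZeroM C (X i) (X j)) = ZeroM (Add C) (I, X) (I, X)"
  by (auto simp: Add_simps elem_mor_def intro!: restrict2_cong)

lemma elem_mor_scale:
  "c \<in> carrier R \<Longrightarrow> j \<in> I \<Longrightarrow> i \<in> I \<Longrightarrow>
    elem_mor C I X j i (ScaleM C (X i) (X j) c f) = ScaleM (Add C) (I, X) (I, X) c (elem_mor C I X j i f)"
  using ob by (auto simp: Add_simps elem_mor_def scale_zero intro!: restrict2_cong)

lemma elem_mor_comp:
  assumes "k \<in> I" "j \<in> I" "i \<in> I" "g \<in> Mor C (X j) (X k)" "f \<in> Mor C (X i) (X j)"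
  shows "CompM (Add C) (I, X) (I, X) (I, X) (elem_mor C I X k j g) (elem_mor C I X j i f)
    = elem_mor C I X k i (CompM C (X i) (X j) (X k) g f)"
  unfolding Add_simps elem_mor_def
proof (rule restrict2_cong)
  fix k' i' assume ki: "k' \<in> I" "i' \<in> I"
  show "finprod (hom_group C (X i') (X k')) (\<lambda>l. CompM C (X i') (X l) (X k')
      (restrict2 I I (\<lambda>j' i'. if j' = k \<and> i' = j then g else ZeroM C (X i') (X j')) k' l)
      (restrict2 I I (\<lambda>j' i'. if j' = j \<and> i' = i then f else ZeroM C (X i') (X j')) l i')) I
    = (if k' = k \<and> i' = i then CompM C (X i) (X j) (X k) g f else ZeroM C (X i') (X k'))"
    using ki assms ob fin
    by (subst hom_sum_single[where k = j])
      (auto simp: comp_zero_left comp_zero_right comp_closed hom_closed)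
qed

lemma elem_id_comp:
  assumes "k \<in> I" "f \<in> Mor (Add C) (I, X) (I, X)"
  shows "CompM (Add C) (I, X) (I, X) (I, X) (elem_mor C I X k k (IdM C (X k))) f
    = restrict2 I I (\<lambda>j i. if j = k then f j i else ZeroM C (X i) (X j))"
  unfolding Add_simps(4)
proof (rule restrict2_cong)
  fix j i assume ji: "j \<in> I" "i \<in> I"
  have mem: "f j i \<in> Mor C (X i) (X j)" if "j \<in> I" "i \<in> I" for j i
    using assms that by (auto simp: Add_simps)
  show "finprod (hom_group C (X i) (X j)) (\<lambda>l. CompM C (X i) (X l) (X j)
      (elem_mor C I X k k (IdM C (X k)) j l) (f l i)) I
    = (if j = k then f j i else ZeroM C (X i) (X j))"
    using ji assms(1) mem ob fin
    by (subst hom_sum_single[where k = k])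
      (auto simp: elem_mor_def comp_zero_left id_left hom_closed)
qed

lemma comp_elem_id:
  assumes "k \<in> I" "f \<in> Mor (Add C) (I, X) (I, X)"
  shows "CompM (Add C) (I, X) (I, X) (I, X) f (elem_mor C I X k k (IdM C (X k)))
    = restrict2 I I (\<lambda>j i. if i = k then f j i else ZeroM C (X i) (X j))"
  unfolding Add_simps(4)
proof (rule restrict2_cong)
  fix j i assume ji: "j \<in> I" "i \<in> I"
  have mem: "f j i \<in> Mor C (X i) (X j)" if "j \<in> I" "i \<in> I" for j i
    using assms that by (auto simp: Add_simps)
  show "finprod (hom_group C (X i) (X j)) (\<lambda>l. CompM C (X i) (X l) (X j)
      (f j l) (elem_mor C I X k k (IdM C (X k)) l i)) I
    = (if i = k then f j i else ZeroM C (X i) (X j))"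
    using ji assms(1) mem ob fin
    by (subst hom_sum_single[where k = k])
      (auto simp: elem_mor_def comp_zero_right id_right hom_closed)
qed

lemma elem_id_sandwich:
  assumes "k \<in> I" "f \<in> Mor (Add C) (I, X) (I, X)"
  shows "CompM (Add C) (I, X) (I, X) (I, X) (elem_mor C I X k k (IdM C (X k)))
      (CompM (Add C) (I, X) (I, X) (I, X) f (elem_mor C I X k k (IdM C (X k))))
    = elem_mor C I X k k (f k k)"
proof -
  have "CompM (Add C) (I, X) (I, X) (I, X) f (elem_mor C I X k k (IdM C (X k))) \<in> Mor (Add C) (I, X) (I, X)"
    using assms ob hom_closed unfolding comp_elem_id[OF assms] by (auto simp: Add_simps)
  from elem_id_comp[OF assms(1) this] show ?thesis
    unfolding comp_elem_id[OF assms] by (auto simp: elem_mor_def intro!: restrict2_cong)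
qed

lemma diag_id_insert:
  "t \<in> I \<Longrightarrow> t \<notin> T \<Longrightarrow> diag_id C I X (insert t T) =
    AddM (Add C) (I, X) (I, X) (elem_mor C I X t t (IdM C (X t))) (diag_id C I X T)"
  using ob by (auto simp: Add_simps elem_mor_def diag_id_def hom_closed id_closed intro!: restrict2_cong)

lemma diag_id_empty: "diag_id C I X {} = ZeroM (Add C) (I, X) (I, X)"
  by (auto simp: Add_simps diag_id_def)

lemma diag_id_all: "diag_id C I X I = IdM (Add C) (I, X)"
  by (auto simp: Add_simps diag_id_def intro!: restrict2_cong)

end

end

section \<open>The isomorphism\<close>

lemma unit_mset_eq: "mset (v :: unit list) = mset w \<Longrightarrow> v = w"
  using mset_eq_length by (auto simp: unit_list_eq)

lemma mset_eq_of_subset_size: "A \<subseteq># B \<Longrightarrow> size A = size B \<Longrightarrow> A = (B :: 'x multiset)"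
  by (metis mset_subset_size nless_le subset_mset.less_le)

locale cyclotomic_level = cyclotomic_parameter R A Q
  for R :: "('k, 'r) ring_scheme" (structure) and A :: "('k, 'a, 'm) frobenius_scheme" (structure)
    and Q :: "('k, 'a polgen) aterm set" +
  fixes d :: nat
  assumes d_pos: "d \<ge> 1"
begin

section \<open>The cyclotomic ideal of the affine wreath product algebra, in terms of the
  congruence\<close>

abbreviation "Xd \<equiv> replicate d ()"
abbreviation "Wd \<equiv> W_aff R A d"
abbreviation "acl \<equiv> mcls R awp"
abbreviation "lcl \<equiv> mcls R lawp"
definition Icyc where "Icyc = genideal Wd {pol_in_W R A d 1 Q}"

abbreviation coset_I ("modI _" [61] 60) where "modI m \<equiv> Icyc +>\<^bsub>Wd\<^esub> m"

interpretation AWC: linear_category R "presented_supercat R awp"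
  by (rule AW.linear_category_pcat)

lemma Wd_simps:
  "carrier Wd = Mor (presented_supercat R awp) Xd Xd" "\<zero>\<^bsub>Wd\<^esub> = acl (MZero Xd Xd)"
  "\<one>\<^bsub>Wd\<^esub> = acl (MId Xd)"
  by (simp_all add: W_aff_def AW_def AW.pcat_simps)

lemma mcls_Wd: "AW.wf u \<Longrightarrow> AW.src u = Xd \<Longrightarrow> AW.tgt u = Xd \<Longrightarrow> acl u \<in> carrier Wd"
  by (simp add: Wd_simps AW.mcls_mem)

lemma Wd_E:
  assumes "m \<in> carrier Wd"
  obtains u where "AW.wf u" "AW.src u = Xd" "AW.tgt u = Xd" "m = acl u"
  using assms by (auto simp: Wd_simps elim: AW.MorE)

lemma Wd_mult: "AW.wf (MComp u v) \<Longrightarrow> acl u \<otimes>\<^bsub>Wd\<^esub> acl v = acl (MComp u v)"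
  by (simp add: W_aff_def AW_def AW.mcls_comp)

lemma Wd_add: "AW.wf (MPlus u v) \<Longrightarrow> acl u \<oplus>\<^bsub>Wd\<^esub> acl v = acl (MPlus u v)"
  by (simp add: W_aff_def AW_def AW.mcls_plus)

lemma Wd_smult: "AW.wf (MScal c u) \<Longrightarrow> c \<odot>\<^bsub>Wd\<^esub> acl u = acl (MScal c u)"
  by (simp add: W_aff_def AW_def AW.mcls_scal)

interpretation Wd: scaled_ring R Wd
  unfolding W_aff_def AW_def
  by (rule AWC.scaled_ring_End_alg) (simp add: AW.pcat_simps)

text \<open>Positivity of \<open>d\<close> provides the first strand, on which
  \<open>Q\<^sub>1\<close> acts.\<close>

lemma Xd_Cons: "Xd = () # replicate (d - 1) ()"
  using d_pos by (cases d) auto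

lemma on_strand_tens: "meqA (on_strand d 1 g) (MTens (MGen g) (MId (replicate (d - 1) ())))"
  if "g \<in> aw_gens A"
  unfolding on_strand_def using that by (simp, intro AW.tens_unit_left) simp

lemma mpow_on_strand:
  "meqA (mpow Xd (on_strand d 1 Dot) r)
    (MTens (mpow [()] (MGen Dot) r) (MId (replicate (d - 1) ())))"
proof (induction r)
  case 0
  show ?case
    unfolding mpow_def Xd_Cons using AW.tens_ids[of "[()]" "replicate (d - 1) ()"]
    by (auto intro: meq_sym)
next
  case (Suc r)
  let ?Y = "replicate (d - 1) ()" and ?D = "MGen Dot :: (unit, 'k, 'a awgen) mterm"
  have pow: "AW.wf (mpow [()] ?D r)" "AW.src (mpow [()] ?D r) = [()]" "AW.tgt (mpow [()] ?D r) = [()]"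
    using AW.mpow_types[of ?D "[()]" r] by auto
  have 1: "meqA (on_strand d 1 Dot) (MTens ?D (MId ?Y))"
    by (rule on_strand_tens) simp
  have "meqA (MComp (on_strand d 1 Dot) (mpow Xd (on_strand d 1 Dot) r))
      (MComp (MTens ?D (MId ?Y)) (MTens (mpow [()] ?D r) (MId ?Y)))"
    using meq_types[OF 1] meq_types[OF Suc] pow by (intro meq_comp 1 Suc) auto
  also have "meqA \<dots> (MTens (MComp ?D (mpow [()] ?D r)) (MId ?Y))"
    using pow AW.whisker_right[of ?D "mpow [()] ?D r" "MId ?Y"] by (auto intro: meq_sym)
  finally show ?case by (simp add: mpow_def)
qed

lemma msum_tens:
  assumes "\<And>r. r \<in> set rs \<Longrightarrow>
      meqA (f r) (MTens (g r) (MId Y)) \<and> AW.src (g r) = [()] \<and> AW.tgt (g r) = [()]"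
  shows "meqA (msum (() # Y) (() # Y) (map f rs)) (MTens (msum [()] [()] (map g rs)) (MId Y))"
  using assms
proof (induction rs)
  case Nil
  show ?case using AW.tens_MZero_left[of "MId Y" "[()]" "[()]"] by (auto simp: msum_def intro: meq_sym)
next
  case (Cons r rs)
  have IH: "meqA (msum (() # Y) (() # Y) (map f rs)) (MTens (msum [()] [()] (map g rs)) (MId Y))"
    using Cons by auto
  have fr: "meqA (f r) (MTens (g r) (MId Y))" "AW.src (g r) = [()]" "AW.tgt (g r) = [()]"
    using Cons.prems by auto
  have "AW.wf t \<and> AW.src t = [()] \<and> AW.tgt t = [()]" if "t \<in> set (map g rs)" for t
    using Cons.prems that meq_wf2 by fastforce
  then have ts: "AW.wf (msum [()] [()] (map g rs))" "AW.src (msum [()] [()] (map g rs)) = [()]"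
    "AW.tgt (msum [()] [()] (map g rs)) = [()]"
    using AW.msum_types[of "[()]" "[()]" "map g rs"] by auto
  have "meqA (MPlus (f r) (msum (() # Y) (() # Y) (map f rs)))
      (MPlus (MTens (g r) (MId Y)) (MTens (msum [()] [()] (map g rs)) (MId Y)))"
    using meq_types[OF fr(1)] meq_types[OF IH] fr ts by (intro meq_plus IH) auto
  also have "meqA \<dots> (MTens (MPlus (g r) (msum [()] [()] (map g rs))) (MId Y))"
    using meq_types[OF fr(1)] fr ts by (intro meq_sym[OF AW.tens_plus_left]) auto
  finally show ?case by (simp add: msum_def)
qed

text \<open>The generator of the cyclotomic ideal places each token and each dot separately on the
  first of \<open>d\<close> strands. Identity strands on the right can be pulled out of powers,
  products and sums without signs, which leaves \<open>[Q]\<close> on one strand beside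
  \<open>d - 1\<close> identities.\<close>

lemma pol_in_W_eq: "pol_in_W R A d 1 Q = acl (MTens qbr (MId (replicate (d - 1) ())))"
proof -
  let ?Y = "replicate (d - 1) ()" and ?as = "pol_coeffs R A Q"
  let ?g = "\<lambda>r. MComp (MGen (Tok (?as ! r))) (mpow [()] (MGen Dot) r)"
  have pow: "AW.wf (mpow [()] (MGen Dot) r)" "AW.src (mpow [()] (MGen Dot) r) = [()]"
    "AW.tgt (mpow [()] (MGen Dot) r) = [()]" for r
    using AW.mpow_types[of "MGen Dot" "[()]" r] by auto
  have "meqA (msum (() # ?Y) (() # ?Y) (map (\<lambda>r. MComp (on_strand d 1 (Tok (?as ! r)))
      (mpow Xd (on_strand d 1 Dot) r)) [0..<length ?as])) (MTens (msum [()] [()] (map ?g [0..<length ?as])) (MId ?Y))"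
  proof (rule msum_tens, intro conjI)
    fix r assume "r \<in> set [0..<length ?as]"
    then have a: "?as ! r \<in> carrier A"
      using pol_coeffs_closed[of Q] Q_ECR by (auto simp: ECR_def regular_elem_def)
    have 1: "meqA (on_strand d 1 (Tok (?as ! r))) (MTens (MGen (Tok (?as ! r))) (MId ?Y))"
      using a by (intro on_strand_tens) simp
    have "meqA (MComp (on_strand d 1 (Tok (?as ! r))) (mpow Xd (on_strand d 1 Dot) r))
        (MComp (MTens (MGen (Tok (?as ! r))) (MId ?Y)) (MTens (mpow [()] (MGen Dot) r) (MId ?Y)))"
      using meq_types[OF 1] meq_types[OF mpow_on_strand] pow by (intro meq_comp 1 mpow_on_strand) auto
    also have "meqA \<dots> (MTens (?g r) (MId ?Y))"
      using pow a AW.whisker_right[of "MGen (Tok (?as ! r))" "mpow [()] (MGen Dot) r" "MId ?Y"]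
      by (auto intro: meq_sym)
    finally show "meqA (MComp (on_strand d 1 (Tok (?as ! r))) (mpow Xd (on_strand d 1 Dot) r))
        (MTens (?g r) (MId ?Y))" .
  qed (auto simp: pow)
  moreover have "qbr = msum [()] [()] (map ?g [0..<length ?as])"
    by (simp add: qbr_def br_def Let_def proj_msum proj_mpow o_def)
  ultimately show ?thesis
    unfolding pol_in_W_def Let_def Xd_Cons[symmetric] by (simp add: mcls_eqI)
qed

lemma cyc_ideal: "ideal Icyc Wd"
proof -
  have "pol_in_W R A d 1 Q \<in> carrier Wd"
    unfolding pol_in_W_eq by (rule mcls_Wd) (use Xd_Cons in auto)
  then show ?thesis unfolding Icyc_def by (intro Wd.genideal_ideal) auto
qed

lemma cyc_hom: "(\<lambda>m. modI m) \<in> ring_hom Wd (Wd Quot Icyc)"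
  by (rule ideal.rcos_ring_hom[OF cyc_ideal])

text \<open>The congruence is generated in all widths, whereas the ideal lives in width
  \<open>d\<close>. A composite through another width is zero by imbalance, and a killed generator
  with the right ends has exactly \<open>d - 1\<close> extra strands, so it is
  \<open>Q\<^sub>1\<close>.\<close>

lemma acong_coset:
  "acong u v \<Longrightarrow> AW.src u = Xd \<Longrightarrow> AW.tgt u = Xd \<Longrightarrow>
    modI acl u = modI acl v"
proof (induction rule: mcong.induct)
  case (mcong_meq s t)
  then show ?case by (simp add: mcls_eqI)
next
  case (mcong_sym s t)
  then show ?case using AW.mcong_types[OF mcong_sym(1)] by auto
next
  case (mcong_trans s t u)
  then show ?case using AW.mcong_types[OF mcong_trans(1)] by auto
next
  case (mcong_plus s s' t t')
  note ty = AW.mcong_types[OF mcong_plus(1)] AW.mcong_types[OF mcong_plus(2)] mcong_plus(3) mcong_plus.prems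
  have "modI acl (MPlus s t) = modI (acl s \<oplus>\<^bsub>Wd\<^esub> acl t)"
    using ty by (simp add: Wd_add)
  also have "\<dots> = modI (acl s' \<oplus>\<^bsub>Wd\<^esub> acl t')"
    using ty mcong_plus.IH by (simp add: ring_hom_add[OF cyc_hom] mcls_Wd)
  also have "\<dots> = modI acl (MPlus s' t')"
    using ty by (simp add: Wd_add)
  finally show ?case .
next
  case (mcong_scal c t t')
  note ty = AW.mcong_types[OF mcong_scal(2)] mcong_scal.prems mcong_scal(1)
  have "modI acl (MScal c t) = c \<odot>\<^bsub>quot_superalg Wd Icyc\<^esub> (modI acl t)"
    using ty by (simp add: Wd.smult_coset[OF cyc_ideal] mcls_Wd Wd_smult)
  also have "\<dots> = modI acl (MScal c t')"
    using ty mcong_scal.IH by (simp add: Wd.smult_coset[OF cyc_ideal] mcls_Wd Wd_smult)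
  finally show ?case .
next
  case (mcong_comp s s' t t')
  note ty = AW.mcong_types[OF mcong_comp(1)] AW.mcong_types[OF mcong_comp(2)] mcong_comp(3) mcong_comp.prems
  show ?case
  proof (cases "AW.tgt t = Xd")
    case True
    have "modI acl (MComp s t) = modI (acl s \<otimes>\<^bsub>Wd\<^esub> acl t)"
      using ty by (simp add: Wd_mult)
    also have "\<dots> = modI (acl s' \<otimes>\<^bsub>Wd\<^esub> acl t')"
      using ty True mcong_comp.IH by (simp add: ring_hom_mult[OF cyc_hom] mcls_Wd)
    also have "\<dots> = modI acl (MComp s' t')"
      using ty by (simp add: Wd_mult)
    finally show ?thesis .
  next
    case False
    then have "mset (AW.src t) \<noteq> mset (AW.tgt t)" using ty unit_mset_eq[of "AW.src t" "AW.tgt t"] by auto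
    then have "meqA t (MZero (AW.src t) (AW.tgt t))" "meqA t' (MZero (AW.src t') (AW.tgt t'))"
      using ty AW.unbalanced_zero[of t] AW.unbalanced_zero[of t'] by auto
    then have "meqA (MComp s t) (MZero Xd Xd)" "meqA (MComp s' t') (MZero Xd Xd)"
      using ty AW.comp_zeroI[OF _ disjI2, of s t "AW.src t" "AW.tgt t"]
        AW.comp_zeroI[OF _ disjI2, of s' t' "AW.src t'" "AW.tgt t'"] by auto
    then show ?thesis by (simp add: mcls_eqI)
  qed
next
  case (mcong_kill g)
  then obtain X where g: "g = MTens qbr (MId X)" by (auto simp: cyc_gens_def)
  then have "X = replicate (d - 1) ()" using mcong_kill.prems d_pos by (cases d) auto
  then have "pol_in_W R A d 1 Q = acl g" unfolding g pol_in_W_eq by simp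
  then have "acl g \<in> Icyc"
    unfolding Icyc_def using Wd.genideal_self'[OF mcls_Wd[OF mcong_kill(2) mcong_kill.prems]] by metis
  moreover have "\<zero>\<^bsub>Wd\<^esub> \<in> Icyc"
    using cyc_ideal by (simp add: additive_subgroup.zero_closed ideal.axioms(1))
  ultimately have "modI acl g = Icyc" "modI \<zero>\<^bsub>Wd\<^esub> = Icyc"
    using mcls_Wd[OF mcong_kill(2) mcong_kill.prems] Wd.coset_zero_iff[OF cyc_ideal] by auto
  then show ?case using mcong_kill.prems by (simp add: Wd_simps(2))
qed

text \<open>The classes congruent to zero form an ideal containing \<open>Q\<^sub>1\<close>, hence
  contain the ideal generated by it.\<close>

lemma genideal_acong:
  assumes u: "AW.wf u" "AW.src u = Xd" "AW.tgt u = Xd" and mem: "acl u \<in> Icyc"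
  shows "acong u (MZero Xd Xd)"
proof -
  define K where "K = {acl t |t. AW.wf t \<and> AW.src t = Xd \<and> AW.tgt t = Xd \<and> acong t (MZero Xd Xd)}"
  have "ideal K Wd"
  proof (rule Wd.idealI_closed)
    show "K \<subseteq> carrier Wd" by (auto simp: K_def mcls_Wd)
    show "\<zero>\<^bsub>Wd\<^esub> \<in> K"
      unfolding K_def Wd_simps by (intro CollectI exI[of _ "MZero Xd Xd"]) (simp add: AW.mcong_refl)
  next
    fix a b assume "a \<in> K" "b \<in> K"
    obtain s where s: "AW.wf s" "AW.src s = Xd" "AW.tgt s = Xd" "acong s (MZero Xd Xd)" "a = acl s"
      using \<open>a \<in> K\<close> unfolding K_def by blast
    obtain t where t: "AW.wf t" "AW.src t = Xd" "AW.tgt t = Xd" "acong t (MZero Xd Xd)" "b = acl t"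
      using \<open>b \<in> K\<close> unfolding K_def by blast
    have "acong (MPlus s t) (MPlus (MZero Xd Xd) (MZero Xd Xd))"
      by (rule mcong_plus[OF s(4) t(4)]) (simp add: s t)
    also have "meqA \<dots> (MZero Xd Xd)" by (intro AW.plus_zero_left) auto
    finally have "acong (MPlus s t) (MZero Xd Xd)" .
    then have "acl (MPlus s t) \<in> K"
      unfolding K_def using s(1-3) t(1-3) by (intro CollectI exI[of _ "MPlus s t"]) simp
    then show "a \<oplus>\<^bsub>Wd\<^esub> b \<in> K" using s t by (simp add: Wd_add)
  next
    fix a x assume "a \<in> K" "x \<in> carrier Wd"
    obtain s where s: "AW.wf s" "AW.src s = Xd" "AW.tgt s = Xd" "acong s (MZero Xd Xd)" "a = acl s"
      using \<open>a \<in> K\<close> unfolding K_def by blast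
    obtain t where t: "AW.wf t" "AW.src t = Xd" "AW.tgt t = Xd" "x = acl t"
      using \<open>x \<in> carrier Wd\<close> by (rule Wd_E)
    have "acong (MComp t s) (MComp t (MZero Xd Xd))"
      by (rule mcong_comp[OF AW.mcong_refl[OF t(1)] s(4)]) (simp add: s t)
    also have "meqA \<dots> (MZero Xd Xd)"
      using AW.comp_MZero_right[OF t(1) strands_letters(2) t(2)[symmetric], of Xd] unfolding t(3) .
    finally have "acong (MComp t s) (MZero Xd Xd)" .
    then have "acl (MComp t s) \<in> K"
      unfolding K_def using s(1-3) t(1-3) by (intro CollectI exI[of _ "MComp t s"]) simp
    then show "x \<otimes>\<^bsub>Wd\<^esub> a \<in> K" using s t by (simp add: Wd_mult)
    have "acong (MComp s t) (MComp (MZero Xd Xd) t)"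
      by (rule mcong_comp[OF s(4) AW.mcong_refl[OF t(1)]]) (simp add: s t)
    also have "meqA \<dots> (MZero Xd Xd)"
      using AW.comp_MZero_left[OF t(1) strands_letters(2) t(3)[symmetric], of Xd] unfolding t(2) .
    finally have "acong (MComp s t) (MZero Xd Xd)" .
    then have "acl (MComp s t) \<in> K"
      unfolding K_def using s(1-3) t(1-3) by (intro CollectI exI[of _ "MComp s t"]) simp
    then show "a \<otimes>\<^bsub>Wd\<^esub> x \<in> K" using s t by (simp add: Wd_mult)
  qed
  moreover have "pol_in_W R A d 1 Q \<in> K"
  proof -
    let ?g = "MTens qbr (MId (replicate (d - 1) ()))"
    have "AW.wf ?g" "AW.src ?g = Xd" "AW.tgt ?g = Xd" using Xd_Cons by auto
    moreover from this have "acong ?g (MZero Xd Xd)"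
      using mcong_kill[of ?g cyc_gens R awp] by (auto simp: cyc_gens_def)
    ultimately show ?thesis unfolding K_def pol_in_W_eq by blast
  qed
  ultimately have "Icyc \<subseteq> K" unfolding Icyc_def by (intro Wd.genideal_minimal) auto
  then obtain t where t: "acl u = acl t" "AW.wf t" "acong t (MZero Xd Xd)"
    using mem by (auto simp: K_def)
  then have "meqA u t" by (simp add: mcls_eq_iff)
  then show ?thesis using t(3) by (rule meq_mcong_trans)
qed

section \<open>Words with one label, and the ideal generated by the identities of those that start
  with I\<close>

abbreviation "w0 \<equiv> qword d"
abbreviation "Words \<equiv> Gam R A d [Q]"
abbreviation "lcat \<equiv> presented_supercat R lawp"

interpretation LC: linear_category R lcat
  by (rule LAW.linear_category_pcat)

text \<open>The two subwords bound the number of letters \<open>I\<close> below by \<open>d\<close>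
  and that of \<open>Q\<close> by one; the length \<open>d + 1\<close> leaves no room for anything
  else.\<close>

lemma Words_mset:
  assumes "w \<in> Words" shows "mset w = mset w0"
proof -
  have w: "length w = d + 1" "subseq (replicate d Istr) w" "subseq [Lab Q] w"
    using assms by (auto simp: Gam_def)
  have "subseq (filter ((=) Istr) (replicate d Istr)) (filter ((=) Istr) w)"
    using w(2) by (rule subseq_filter)
  then have "d \<le> count (mset w) Istr"
    using list_emb_length by (fastforce simp: count_mset count_list_eq_length_filter)
  moreover have "Lab Q \<in> set w" using w(3) by (simp add: subseq_singleton_left)
  then have "1 \<le> count (mset w) (Lab Q)" using count_mset_gt_0[of "Lab Q" w] by simp
  ultimately have "count (mset w0) l \<le> count (mset w) l" for l
    by (cases l) (auto simp: qword_def)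
  then have "mset w0 \<subseteq># mset w" by (rule mset_subset_eqI)
  then show ?thesis using w(1) by (intro mset_eq_of_subset_size[symmetric]) (auto simp: qword_def)
qed

lemma Words_finite: "finite Words"
proof (rule finite_subset)
  show "Words \<subseteq> {w. set w \<subseteq> {Istr, Lab Q} \<and> length w = d + 1}"
  proof
    fix w assume w: "w \<in> Words"
    have "set w \<subseteq> {Istr, Lab Q}"
      using mset_eq_setD[OF Words_mset[OF w]] by (auto simp: qword_def split: if_splits)
    then show "w \<in> {w. set w \<subseteq> {Istr, Lab Q} \<and> length w = d + 1}"
      using w by (auto simp: Gam_def)
  qed
qed (rule finite_lists_length_eq, simp)

lemma WordsI:
  assumes "w \<in> lists (letters lawp)" "mset w = mset w0" shows "w \<in> Words"
proof -
  have "filter ((=) Istr) w = replicate (count (mset w) Istr) Istr"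
    by (simp add: count_mset count_list_eq_length_filter replicate_length_filter)
  then have "filter ((=) Istr) w = replicate d Istr"
    using assms(2) by (simp add: qword_def)
  then have "subseq (replicate d Istr) w" using subseq_filter_left[of "(=) Istr" w] by simp
  moreover have "Lab Q \<in> set w" using mset_eq_setD[OF assms(2)] by (simp add: qword_def)
  moreover have "length w = d + 1" using mset_eq_length[OF assms(2)] by (simp add: qword_def)
  moreover have "w \<in> lists (law_letters R A)" using assms(1) by (simp add: law_pres_def)
  ultimately show ?thesis by (simp add: Gam_def subseq_singleton_left)
qed

lemma w0_Words: "w0 \<in> Words"
  by (rule WordsI) auto

lemma Words_obj: "w \<in> Words \<Longrightarrow> w \<in> Obj lcat"
proof -
  have "letters lawp = law_letters R A" by (simp add: law_pres_def)
  then show "w \<in> Words \<Longrightarrow> w \<in> Obj lcat" by (simp add: Gam_def LAW.pcat_simps)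
qed

lemma Words_cases: "w \<in> Words \<Longrightarrow> w = w0 \<or> (\<exists>v. w = Istr # v)"
  using mset_qword[OF Words_mset] by metis

lemmas elem_facts = LC.elem_mor_closed[of Words "\<lambda>w. w", OF Words_finite Words_obj]
  LC.elem_mor_add[of Words "\<lambda>w. w", OF Words_finite Words_obj]
  LC.elem_mor_zero[of Words "\<lambda>w. w", OF Words_finite Words_obj]
  LC.elem_mor_scale[of Words "\<lambda>w. w", OF Words_finite Words_obj]
  LC.elem_mor_comp[of Words "\<lambda>w. w", OF Words_finite Words_obj]
  LC.elem_id_sandwich[of Words "\<lambda>w. w", OF Words_finite Words_obj]
  LC.diag_id_insert[of Words "\<lambda>w. w", OF Words_finite Words_obj]
  LC.diag_id_empty[of Words "\<lambda>w. w", OF Words_finite Words_obj]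
  LC.diag_id_all[of Words "\<lambda>w. w", OF Words_finite Words_obj]

abbreviation "Wc \<equiv> W_aff_words R A d [Q]"
abbreviation "gens \<equiv> {summand_id (LAW R A) (Words, \<lambda>w. w) w |w. w \<in> Words \<and> hd w = Istr}"

definition Jcyc where "Jcyc = genideal Wc gens"

abbreviation coset_J ("modJ _" [61] 60) where "modJ m \<equiv> Jcyc +>\<^bsub>Wc\<^esub> m"

abbreviation "elt \<equiv> elem_mor lcat Words (\<lambda>w. w)"

lemma Wc_alg: "Wc = End_alg (Add lcat) (Words, \<lambda>w. w)"
  by (simp add: W_aff_words_def LAW_def)

interpretation Wc: scaled_ring R Wc
  unfolding Wc_alg
  using LC.sum_obj[of Words "\<lambda>w. w", OF Words_finite Words_obj]
  by (intro linear_category.scaled_ring_End_alg[OF LC.linear_category_Add])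

lemma gens_eq: "gens = {elt w w (IdM lcat w) |w. w \<in> Words \<and> hd w = Istr}"
  by (simp add: summand_id_elem LAW_def)

lemma elt_closed: "v \<in> Words \<Longrightarrow> w \<in> Words \<Longrightarrow> f \<in> Mor lcat w v \<Longrightarrow> elt v w f \<in> carrier Wc"
  by (simp add: Wc_alg elem_facts(1))

lemma elt_mult:
  "u \<in> Words \<Longrightarrow> v \<in> Words \<Longrightarrow> w \<in> Words \<Longrightarrow> g \<in> Mor lcat v u \<Longrightarrow> f \<in> Mor lcat w v \<Longrightarrow>
    elt u v g \<otimes>\<^bsub>Wc\<^esub> elt v w f = elt u w (CompM lcat w v u g f)"
  by (simp add: Wc_alg elem_facts(5))

lemma gens_closed: "gens \<subseteq> carrier Wc"
  unfolding gens_eq using elt_closed LC.id_closed[OF Words_obj] by blast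

lemma Jcyc_ideal: "ideal Jcyc Wc"
  unfolding Jcyc_def by (rule Wc.genideal_ideal[OF gens_closed])

lemma Jcyc_zero: "\<zero>\<^bsub>Wc\<^esub> \<in> Jcyc"
  using Jcyc_ideal by (simp add: additive_subgroup.zero_closed ideal.axioms(1))

lemma gens_Jcyc: "Istr # v \<in> Words \<Longrightarrow> elt (Istr # v) (Istr # v) (IdM lcat (Istr # v)) \<in> Jcyc"
  unfolding Jcyc_def using Wc.genideal_self[OF gens_closed] unfolding gens_eq by fastforce

lemma elt_zero: "elt v w (ZeroM lcat w v) = \<zero>\<^bsub>Wc\<^esub>"
  by (simp add: Wc_alg elem_facts(3))

text \<open>The matrix unit of a composite through \<open>I v\<close> factors as a product with the
  generator of the ideal at that word in the middle. A middle word with other letters makes the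
  composite zero.\<close>

lemma elt_through:
  assumes "LAW.wf (MComp s t)" "LAW.src t = w0" "LAW.tgt s = w0" "LAW.src s \<noteq> w0"
  shows "elt w0 w0 (lcl (MComp s t)) \<in> Jcyc"
proof (cases "mset (LAW.tgt t) = mset w0")
  case True
  have wf: "LAW.wf s" "LAW.wf t" "LAW.tgt t = LAW.src s" using assms by auto
  then obtain v where v: "LAW.tgt t = Istr # v"
    using mset_qword[OF True] assms(4) by metis
  have V: "Istr # v \<in> Words"
    using v True wf LAW.tgt_letters[of t] by (intro WordsI) auto
  let ?s = "lcl s" and ?t = "lcl t"
  have s: "?s \<in> Mor lcat (Istr # v) w0" and t: "?t \<in> Mor lcat w0 (Istr # v)"
    using wf v assms by (auto intro: LAW.mcls_mem)
  have "elt w0 w0 (lcl (MComp s t)) = elt w0 w0 (CompM lcat w0 (Istr # v) w0 ?s ?t)"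
    using assms(1) by (simp only: LAW.mcls_comp)
  also have "\<dots> = elt w0 (Istr # v) ?s \<otimes>\<^bsub>Wc\<^esub> elt (Istr # v) w0 ?t"
    using V w0_Words s t by (simp add: elt_mult)
  also have "elt (Istr # v) w0 ?t = elt (Istr # v) (Istr # v) (IdM lcat (Istr # v)) \<otimes>\<^bsub>Wc\<^esub> elt (Istr # v) w0 ?t"
    using V w0_Words t LC.id_left[OF Words_obj[OF w0_Words] Words_obj[OF V] t]
      LC.id_closed[OF Words_obj[OF V]] by (simp add: elt_mult)
  finally have "elt w0 w0 (lcl (MComp s t)) = elt w0 (Istr # v) ?s \<otimes>\<^bsub>Wc\<^esub>
      (elt (Istr # v) (Istr # v) (IdM lcat (Istr # v)) \<otimes>\<^bsub>Wc\<^esub> elt (Istr # v) w0 ?t)" .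
  then show ?thesis
    using gens_Jcyc[OF V] elt_closed[OF V w0_Words t] elt_closed[OF w0_Words V s]
      ideal.I_l_closed[OF Jcyc_ideal] ideal.I_r_closed[OF Jcyc_ideal] by simp
next
  case False
  have wf: "LAW.wf s" "LAW.wf t" "LAW.tgt t = LAW.src s" using assms by auto
  have "meqL t (MZero (LAW.src t) (LAW.tgt t))"
    using False wf assms by (intro LAW.unbalanced_zero) auto
  then have "meqL (MComp s t) (MZero w0 w0)"
    using LAW.comp_zeroI[OF assms(1) disjI2] assms(2,3) by simp
  then have "lcl (MComp s t) = ZeroM lcat w0 w0"
    by (simp add: LAW.pcat_simps mcls_eqI)
  then show ?thesis using Jcyc_zero by (simp add: elt_zero)
qed

abbreviation "elt0 t \<equiv> elt w0 w0 (lcl t)"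

lemma elt0_closed: "LAW.wf t \<Longrightarrow> LAW.src t = w0 \<Longrightarrow> LAW.tgt t = w0 \<Longrightarrow> elt0 t \<in> carrier Wc"
  by (intro elt_closed w0_Words LAW.mcls_mem)

lemma elt0_plus:
  assumes "LAW.wf (MPlus s t)" "LAW.src t = w0" "LAW.tgt t = w0"
  shows "elt0 (MPlus s t) = elt0 s \<oplus>\<^bsub>Wc\<^esub> elt0 t"
proof -
  have "lcl s \<in> Mor lcat w0 w0" "lcl t \<in> Mor lcat w0 w0"
    using assms by (auto intro: LAW.mcls_mem)
  from elem_facts(2)[OF _ w0_Words w0_Words this] show ?thesis
    using assms(1) by (simp add: Wc_alg LAW.mcls_plus)
qed

lemma elt0_comp:
  assumes "LAW.wf (MComp s t)" "LAW.src t = w0" "LAW.tgt t = w0" "LAW.tgt s = w0"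
  shows "elt0 (MComp s t) = elt0 s \<otimes>\<^bsub>Wc\<^esub> elt0 t"
proof -
  have "lcl s \<in> Mor lcat w0 w0" "lcl t \<in> Mor lcat w0 w0"
    using assms by (auto intro: LAW.mcls_mem)
  from elt_mult[OF w0_Words w0_Words w0_Words this] show ?thesis
    using assms(1) by (simp only: LAW.mcls_comp)
qed

lemma elt0_scal:
  assumes "LAW.wf (MScal c t)"
  shows "elt0 (MScal c t) = c \<odot>\<^bsub>Wc\<^esub> elt0 t"
  using assms elem_facts(4)[of c w0 w0 "lcl t"] w0_Words by (simp add: Wc_alg LAW.mcls_scal)

lemma Jcyc_hom: "(\<lambda>m. modJ m) \<in> ring_hom Wc (Wc Quot Jcyc)"
  by (rule ideal.rcos_ring_hom[OF Jcyc_ideal])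

text \<open>The killed identities are never endomorphisms of \<open>w0\<close>, so that case is
  void. They act through composites with another middle word, and there both sides lie in the ideal
  by \<open>elt_through\<close>.\<close>

lemma lcong_coset:
  "lcong s t \<Longrightarrow> LAW.src s = w0 \<Longrightarrow> LAW.tgt s = w0 \<Longrightarrow>
    modJ elt0 s = modJ elt0 t"
proof (induction rule: mcong.induct)
  case (mcong_meq s t)
  then show ?case by (simp add: mcls_eqI)
next
  case (mcong_sym s t)
  then show ?case using LAW.mcong_types[OF mcong_sym(1)] by auto
next
  case (mcong_trans s t u)
  then show ?case using LAW.mcong_types[OF mcong_trans(1)] by auto
next
  case (mcong_plus s s' t t')
  note ty = LAW.mcong_types[OF mcong_plus(1)] LAW.mcong_types[OF mcong_plus(2)] mcong_plus(3) mcong_plus.prems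
  have "modJ elt0 (MPlus s t) = modJ (elt0 s \<oplus>\<^bsub>Wc\<^esub> elt0 t)"
    using ty by (subst elt0_plus) auto
  also have "\<dots> = modJ (elt0 s' \<oplus>\<^bsub>Wc\<^esub> elt0 t')"
    using ty mcong_plus.IH by (simp add: ring_hom_add[OF Jcyc_hom] elt0_closed)
  also have "\<dots> = modJ elt0 (MPlus s' t')"
    using ty by (subst elt0_plus) auto
  finally show ?case .
next
  case (mcong_scal c t t')
  note ty = LAW.mcong_types[OF mcong_scal(2)] mcong_scal.prems mcong_scal(1)
  have "modJ elt0 (MScal c t) = c \<odot>\<^bsub>quot_superalg Wc Jcyc\<^esub> (modJ elt0 t)"
    using ty by (simp add: Wc.smult_coset[OF Jcyc_ideal] elt0_closed elt0_scal)
  also have "\<dots> = modJ elt0 (MScal c t')"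
    using ty mcong_scal.IH by (simp add: Wc.smult_coset[OF Jcyc_ideal] elt0_closed elt0_scal)
  finally show ?case .
next
  case (mcong_comp s s' t t')
  note ty = LAW.mcong_types[OF mcong_comp(1)] LAW.mcong_types[OF mcong_comp(2)] mcong_comp(3) mcong_comp.prems
  show ?case
  proof (cases "LAW.tgt t = w0")
    case True
    have "modJ elt0 (MComp s t) = modJ (elt0 s \<otimes>\<^bsub>Wc\<^esub> elt0 t)"
      using ty True by (subst elt0_comp) auto
    also have "\<dots> = modJ (elt0 s' \<otimes>\<^bsub>Wc\<^esub> elt0 t')"
    proof -
      have c: "elt0 s \<in> carrier Wc" "elt0 t \<in> carrier Wc" "elt0 s' \<in> carrier Wc" "elt0 t' \<in> carrier Wc"
        using ty True by (intro elt0_closed; simp)+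
      have "modJ elt0 s = modJ elt0 s'" "modJ elt0 t = modJ elt0 t'"
        using ty True by (intro mcong_comp.IH; simp)+
      then show ?thesis
        by (simp only: ring_hom_mult[OF Jcyc_hom c(1,2)] ring_hom_mult[OF Jcyc_hom c(3,4)])
    qed
    also have "\<dots> = modJ elt0 (MComp s' t')"
      using ty True by (subst elt0_comp) auto
    finally show ?thesis .
  next
    case False
    then have J: "elt0 (MComp s t) \<in> Jcyc" "elt0 (MComp s' t') \<in> Jcyc"
      using ty by (intro elt_through; simp)+
    have "elt0 (MComp s t) \<in> carrier Wc" "elt0 (MComp s' t') \<in> carrier Wc"
      using ty by (intro elt0_closed; simp)+
    then have "modJ elt0 (MComp s t) = Jcyc" "modJ elt0 (MComp s' t') = Jcyc"
      using J Wc.coset_zero_iff[OF Jcyc_ideal] by auto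
    then show ?thesis by simp
  qed
next
  case (mcong_kill g)
  then show ?case by (auto simp: bad_ids_def qword_def)
qed

text \<open>The identity matrix is the sum of its diagonal matrix units, and those at words other
  than \<open>w0\<close> are generators of the ideal because these words start with
  \<open>I\<close>.\<close>

lemma one_mod_Jcyc:
  "\<exists>D \<in> Jcyc. \<one>\<^bsub>Wc\<^esub> = elt w0 w0 (IdM lcat w0) \<oplus>\<^bsub>Wc\<^esub> D"
proof -
  have D: "diag_id lcat Words (\<lambda>w. w) T \<in> Jcyc" if "finite T" "T \<subseteq> Words - {w0}" for T
    using that
  proof (induction T rule: finite_induct)
    case empty
    then show ?case using Jcyc_zero by (simp add: elem_facts(8) Wc_alg)
  next
    case (insert t T)
    then obtain v where v: "t = Istr # v" using Words_cases by blast
    have "diag_id lcat Words (\<lambda>w. w) (insert t T) =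
        elt t t (IdM lcat t) \<oplus>\<^bsub>Wc\<^esub> diag_id lcat Words (\<lambda>w. w) T"
      using insert elem_facts(7)[of t T] by (simp add: Wc_alg)
    then show ?case
      using insert gens_Jcyc[of v] v
        additive_subgroup.a_closed[OF ideal.axioms(1)[OF Jcyc_ideal]] by auto
  qed
  have "diag_id lcat Words (\<lambda>w. w) (insert w0 (Words - {w0})) =
      elt w0 w0 (IdM lcat w0) \<oplus>\<^bsub>Wc\<^esub> diag_id lcat Words (\<lambda>w. w) (Words - {w0})"
    using elem_facts(7)[of w0 "Words - {w0}"] w0_Words by (simp add: Wc_alg)
  moreover have "insert w0 (Words - {w0}) = Words" using w0_Words by auto
  moreover have "diag_id lcat Words (\<lambda>w. w) Words = \<one>\<^bsub>Wc\<^esub>"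
    by (simp add: elem_facts(9) Wc_alg)
  ultimately show ?thesis using D[of "Words - {w0}"] Words_finite by (intro bexI) auto
qed

text \<open>Modulo the ideal, the matrix unit \<open>e\<close> of the identity at \<open>w0\<close>
  becomes the unit, so \<open>M\<close> agrees with \<open>e M e\<close>, which keeps only the
  corner entry.\<close>

lemma coset_corner:
  assumes M: "M \<in> carrier Wc"
  shows "modJ M = modJ elt w0 w0 (M w0 w0)"
proof -
  interpret J: ideal Jcyc Wc by (rule Jcyc_ideal)
  interpret Quot: ring "Wc Quot Jcyc" by (rule J.quotient_is_ring)
  let ?p = "\<lambda>m. modJ m"
  let ?e = "elt w0 w0 (IdM lcat w0)"
  obtain D where D: "D \<in> Jcyc" "\<one>\<^bsub>Wc\<^esub> = ?e \<oplus>\<^bsub>Wc\<^esub> D" using one_mod_Jcyc by blast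
  have e: "?e \<in> carrier Wc"
    by (intro elt_closed w0_Words LC.id_closed Words_obj)
  have pc: "?p m \<in> carrier (Wc Quot Jcyc)" if "m \<in> carrier Wc" for m
    using ring_hom_closed[OF Jcyc_hom that] .
  have "?p D = \<zero>\<^bsub>Wc Quot Jcyc\<^esub>"
    using D Wc.coset_zero_iff[OF Jcyc_ideal] J.Icarr by (simp add: FactRing_def)
  then have "?p \<one>\<^bsub>Wc\<^esub> = ?p ?e"
    using D e pc ring_hom_add[OF Jcyc_hom e J.Icarr[OF D(1)]] by simp
  then have one: "?p ?e = \<one>\<^bsub>Wc Quot Jcyc\<^esub>" using ring_hom_one[OF Jcyc_hom] by simp
  have "?p (elt w0 w0 (M w0 w0)) = ?p (?e \<otimes>\<^bsub>Wc\<^esub> (M \<otimes>\<^bsub>Wc\<^esub> ?e))"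
    using M elem_facts(6)[of w0 M] w0_Words by (simp add: Wc_alg)
  also have "\<dots> = ?p ?e \<otimes>\<^bsub>Wc Quot Jcyc\<^esub> (?p M \<otimes>\<^bsub>Wc Quot Jcyc\<^esub> ?p ?e)"
    using M e by (simp add: ring_hom_mult[OF Jcyc_hom])
  also have "\<dots> = ?p M" using M pc by (simp add: one)
  finally show ?thesis by simp
qed

section \<open>The homomorphism to the cyclotomic quotient, read off from the corner entry\<close>

abbreviation "Gcyc \<equiv> W_cyclotomic R A d Q"

lemma Gcyc_eq: "Gcyc = quot_superalg Wd Icyc"
  by (simp add: W_cyclotomic_def Icyc_def)

lemma Gcyc_ring: "ring Gcyc"
  unfolding Gcyc_eq by (rule ring_quot_superalg[OF cyc_ideal])

lemma cyc_hom_Gcyc: "(\<lambda>m. modI m) \<in> ring_hom Wd Gcyc"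
  using cyc_hom unfolding Gcyc_eq ring_hom_def by simp

definition cyc ::
  "('k, 'a) lterm \<Rightarrow>
    (unit, 'k, 'a awgen) mterm set set" where
  "cyc t = modI acl (proj t)"

definition cyc_mor ::
  "('k, 'a) lterm set \<Rightarrow>
    (unit, 'k, 'a awgen) mterm set set" where
  "cyc_mor m = cyc (SOME t. t \<in> m)"

text \<open>Independence of the chosen representative: equal terms have congruent projections by
  \<open>proj_compat\<close>, and \<open>acong_coset\<close> turns congruence into equality of
  cosets.\<close>

lemma cyc_mor_mcls:
  assumes "LAW.wf t" "LAW.src t = w0" "LAW.tgt t = w0"
  shows "cyc_mor (lcl t) = cyc t"
proof -
  let ?s = "SOME s. s \<in> lcl t"
  have "t \<in> lcl t" using assms(1) by (simp add: mem_mcls meq_refl)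
  then have "?s \<in> lcl t" by (rule someI)
  then have s: "meqL t ?s" by (simp add: mem_mcls)
  then have "acong (proj t) (proj ?s)"
    using proj_compat[OF s] assms(2) unfolding compat_def by blast
  from acong_coset[OF this] show ?thesis using assms by (simp add: cyc_mor_def cyc_def)
qed

lemma proj_Wd: "LAW.wf t \<Longrightarrow> LAW.src t = w0 \<Longrightarrow> LAW.tgt t = w0 \<Longrightarrow> acl (proj t) \<in> carrier Wd"
  by (rule mcls_Wd) (auto simp: proj_wf)

lemma cyc_zero: "meqA (proj t) (MZero Xd Xd) \<Longrightarrow> cyc t = \<zero>\<^bsub>Gcyc\<^esub>"
  using Wd.coset_zero_iff[OF cyc_ideal Wd.zero_closed]
    additive_subgroup.zero_closed[OF ideal.axioms(1)[OF cyc_ideal]]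
  by (simp add: cyc_def mcls_eqI Gcyc_eq FactRing_def Wd_simps(2))

lemma cyc_mor_closed: "m \<in> Mor lcat w0 w0 \<Longrightarrow> cyc_mor m \<in> carrier Gcyc"
  by (auto elim!: LAW.MorE simp: cyc_mor_mcls cyc_def ring_hom_closed[OF cyc_hom_Gcyc] proj_Wd)

lemma cyc_mor_add:
  assumes "m \<in> Mor lcat w0 w0" "n \<in> Mor lcat w0 w0"
  shows "cyc_mor (AddM lcat w0 w0 m n) = cyc_mor m \<oplus>\<^bsub>Gcyc\<^esub> cyc_mor n"
proof -
  obtain s where s: "LAW.wf s" "LAW.src s = w0" "LAW.tgt s = w0" "m = lcl s"
    using assms(1) by (rule LAW.MorE)
  obtain t where t: "LAW.wf t" "LAW.src t = w0" "LAW.tgt t = w0" "n = lcl t"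
    using assms(2) by (rule LAW.MorE)
  have "cyc_mor (AddM lcat w0 w0 m n) = cyc (MPlus s t)"
    using s t by (simp add: LAW.mcls_plus cyc_mor_mcls)
  also have "\<dots> = modI (acl (proj s) \<oplus>\<^bsub>Wd\<^esub> acl (proj t))"
    using s t by (simp add: cyc_def Wd_add proj_wf)
  also have "\<dots> = cyc_mor m \<oplus>\<^bsub>Gcyc\<^esub> cyc_mor n"
    using s t by (simp add: ring_hom_add[OF cyc_hom_Gcyc] proj_Wd cyc_mor_mcls cyc_def)
  finally show ?thesis .
qed

lemma cyc_mor_scale:
  assumes "c \<in> carrier R" "m \<in> Mor lcat w0 w0"
  shows "cyc_mor (ScaleM lcat w0 w0 c m) = c \<odot>\<^bsub>Gcyc\<^esub> cyc_mor m"
proof -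
  obtain t where t: "LAW.wf t" "LAW.src t = w0" "LAW.tgt t = w0" "m = lcl t"
    using assms(2) by (rule LAW.MorE)
  have "cyc_mor (ScaleM lcat w0 w0 c m) = cyc (MScal c t)"
    using t assms(1) by (simp add: LAW.mcls_scal cyc_mor_mcls)
  also have "\<dots> = c \<odot>\<^bsub>Gcyc\<^esub> cyc_mor m"
    using t assms(1) Wd.smult_coset[OF cyc_ideal assms(1) proj_Wd[OF t(1-3)]]
    by (simp add: cyc_mor_mcls cyc_def Wd_smult proj_wf Gcyc_eq)
  finally show ?thesis .
qed

lemma cyc_mor_zero: "cyc_mor (ZeroM lcat w0 w0) = \<zero>\<^bsub>Gcyc\<^esub>"
  by (simp add: LAW.pcat_simps cyc_mor_mcls cyc_zero meq_refl)

lemma cyc_mor_comp: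
  assumes "m \<in> Mor lcat w0 w0" "n \<in> Mor lcat w0 w0"
  shows "cyc_mor (CompM lcat w0 w0 w0 m n) = cyc_mor m \<otimes>\<^bsub>Gcyc\<^esub> cyc_mor n"
proof -
  obtain s where s: "LAW.wf s" "LAW.src s = w0" "LAW.tgt s = w0" "m = lcl s"
    using assms(1) by (rule LAW.MorE)
  obtain t where t: "LAW.wf t" "LAW.src t = w0" "LAW.tgt t = w0" "n = lcl t"
    using assms(2) by (rule LAW.MorE)
  have "cyc_mor (CompM lcat w0 w0 w0 m n) = cyc (MComp s t)"
    using s t by (simp add: LAW.mcls_comp cyc_mor_mcls)
  also have "\<dots> = modI (acl (proj s) \<otimes>\<^bsub>Wd\<^esub> acl (proj t))"
    using s t by (simp add: cyc_def Wd_mult proj_wf)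
  also have "\<dots> = cyc_mor m \<otimes>\<^bsub>Gcyc\<^esub> cyc_mor n"
    using s t by (simp add: ring_hom_mult[OF cyc_hom_Gcyc] proj_Wd cyc_mor_mcls cyc_def)
  finally show ?thesis .
qed

text \<open>The factor \<open>n\<close> ends in a word different from its source, so its projection
  vanishes in the affine category, before any passage to the quotient.\<close>

lemma cyc_mor_through:
  assumes "v \<noteq> w0" "m \<in> Mor lcat v w0" "n \<in> Mor lcat w0 v"
  shows "cyc_mor (CompM lcat w0 v w0 m n) = \<zero>\<^bsub>Gcyc\<^esub>"
proof -
  obtain s where s: "LAW.wf s" "LAW.src s = v" "LAW.tgt s = w0" "m = lcl s"
    using assms(2) by (rule LAW.MorE)
  obtain t where t: "LAW.wf t" "LAW.src t = w0" "LAW.tgt t = v" "n = lcl t"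
    using assms(3) by (rule LAW.MorE)
  have "meqA (proj t) (MZero Xd (strip v))"
    using proj_offdiag[OF t(1)] t assms(1) by simp
  then have "meqA (proj (MComp s t)) (MZero Xd Xd)"
    using s t AW.comp_zeroI[OF _ disjI2, of "proj s" "proj t"] by (simp add: proj_wf)
  then show ?thesis using s t by (simp add: LAW.mcls_comp cyc_mor_mcls cyc_zero)
qed

definition phi where "phi M = cyc_mor (M w0 w0)"

lemma Wc_entry: "M \<in> carrier Wc \<Longrightarrow> v \<in> Words \<Longrightarrow> w \<in> Words \<Longrightarrow> M v w \<in> Mor lcat w v"
  by (simp add: Wc_alg Add_simps)

lemma cyc_mor_sum_zero:
  assumes "finite T" "\<And>v. v \<in> T \<Longrightarrow> f v \<in> Mor lcat w0 w0 \<and> cyc_mor (f v) = \<zero>\<^bsub>Gcyc\<^esub>"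
  shows "cyc_mor (finprod (hom_group lcat w0 w0) f T) = \<zero>\<^bsub>Gcyc\<^esub>"
proof -
  interpret H: comm_group "hom_group lcat w0 w0"
    by (intro LC.hom_comm_group Words_obj w0_Words)
  interpret G: ring Gcyc by (rule Gcyc_ring)
  show ?thesis using assms
  proof (induction T rule: finite_induct)
    case empty
    then show ?case by (simp add: cyc_mor_zero)
  next
    case (insert v T)
    have "finprod (hom_group lcat w0 w0) f T \<in> Mor lcat w0 w0"
      using insert H.finprod_closed[of f T] by auto
    then show ?case
      using insert H.finprod_insert[of T v f] by (auto simp: cyc_mor_add)
  qed
qed

text \<open>Taking a corner entry is not multiplicative in a general matrix ring, because the
  product sums over all middle words. Here every summand except the one at \<open>w0\<close> is sent
  to zero by \<open>cyc_mor_through\<close>.\<close>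

lemma phi_mult:
  assumes M: "M \<in> carrier Wc" and N: "N \<in> carrier Wc"
  shows "phi (M \<otimes>\<^bsub>Wc\<^esub> N) = phi M \<otimes>\<^bsub>Gcyc\<^esub> phi N"
proof -
  interpret H: comm_group "hom_group lcat w0 w0"
    by (intro LC.hom_comm_group Words_obj w0_Words)
  interpret G: ring Gcyc by (rule Gcyc_ring)
  let ?f = "\<lambda>v. CompM lcat w0 v w0 (M w0 v) (N v w0)"
  have f: "?f v \<in> Mor lcat w0 w0" if "v \<in> Words" for v
    using that w0_Words by (intro LC.comp_closed Words_obj Wc_entry M N)
  have rest: "finprod (hom_group lcat w0 w0) ?f (Words - {w0}) \<in> Mor lcat w0 w0"
    using H.finprod_closed[of ?f "Words - {w0}"] f by auto
  have "(M \<otimes>\<^bsub>Wc\<^esub> N) w0 w0 = finprod (hom_group lcat w0 w0) ?f Words"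
    using w0_Words by (simp add: Wc_alg Add_simps)
  also have "Words = insert w0 (Words - {w0})" using w0_Words by auto
  also have "finprod (hom_group lcat w0 w0) ?f (insert w0 (Words - {w0}))
      = AddM lcat w0 w0 (?f w0) (finprod (hom_group lcat w0 w0) ?f (Words - {w0}))"
    using H.finprod_insert[of "Words - {w0}" w0 ?f] f w0_Words Words_finite by auto
  finally have "phi (M \<otimes>\<^bsub>Wc\<^esub> N)
      = cyc_mor (?f w0) \<oplus>\<^bsub>Gcyc\<^esub> cyc_mor (finprod (hom_group lcat w0 w0) ?f (Words - {w0}))"
    using cyc_mor_add[OF f[OF w0_Words] rest] by (simp add: phi_def)
  also have "cyc_mor (finprod (hom_group lcat w0 w0) ?f (Words - {w0})) = \<zero>\<^bsub>Gcyc\<^esub>"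
  proof (rule cyc_mor_sum_zero)
    show "finite (Words - {w0})" using Words_finite by (rule finite_Diff)
    fix v assume "v \<in> Words - {w0}"
    then have v: "v \<in> Words" "v \<noteq> w0" by auto
    show "?f v \<in> Mor lcat w0 w0 \<and> cyc_mor (?f v) = \<zero>\<^bsub>Gcyc\<^esub>"
      using f[OF v(1)] cyc_mor_through[OF v(2) Wc_entry[OF M w0_Words v(1)] Wc_entry[OF N v(1) w0_Words]]
      by (rule conjI)
  qed
  also have "cyc_mor (?f w0) \<oplus>\<^bsub>Gcyc\<^esub> \<zero>\<^bsub>Gcyc\<^esub> = cyc_mor (?f w0)"
    using cyc_mor_closed[OF f[OF w0_Words]] by simp
  also have "\<dots> = phi M \<otimes>\<^bsub>Gcyc\<^esub> phi N"
    using w0_Words M N by (simp add: phi_def cyc_mor_comp Wc_entry)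
  finally show ?thesis .
qed

lemma phi_hom: "phi \<in> ring_hom Wc Gcyc"
proof (rule ring_hom_memI)
  fix M N assume M: "M \<in> carrier Wc" and N: "N \<in> carrier Wc"
  show "phi M \<in> carrier Gcyc"
    using M w0_Words by (simp add: phi_def cyc_mor_closed Wc_entry)
  show "phi (M \<otimes>\<^bsub>Wc\<^esub> N) = phi M \<otimes>\<^bsub>Gcyc\<^esub> phi N" using M N by (rule phi_mult)
  have "(M \<oplus>\<^bsub>Wc\<^esub> N) w0 w0 = AddM lcat w0 w0 (M w0 w0) (N w0 w0)"
    using w0_Words by (simp add: Wc_alg Add_simps)
  then show "phi (M \<oplus>\<^bsub>Wc\<^esub> N) = phi M \<oplus>\<^bsub>Gcyc\<^esub> phi N"
    using M N w0_Words by (simp add: phi_def cyc_mor_add Wc_entry)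
next
  have "\<one>\<^bsub>Wc\<^esub> w0 w0 = lcl (MId w0)"
    using w0_Words by (simp add: Wc_alg Add_simps LAW.pcat_simps)
  then have "phi \<one>\<^bsub>Wc\<^esub> = modI \<one>\<^bsub>Wd\<^esub>"
    by (simp add: phi_def cyc_mor_mcls cyc_def Wd_simps)
  then show "phi \<one>\<^bsub>Wc\<^esub> = \<one>\<^bsub>Gcyc\<^esub>"
    using ring_hom_one[OF cyc_hom_Gcyc] by simp
qed

lemma phi_elt0: "LAW.wf t \<Longrightarrow> LAW.src t = w0 \<Longrightarrow> LAW.tgt t = w0 \<Longrightarrow> phi (elt0 t) = cyc t"
  using w0_Words by (simp add: phi_def elem_mor_def cyc_mor_mcls)

lemma phi_surj: "phi ` carrier Wc = carrier Gcyc"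
proof
  show "phi ` carrier Wc \<subseteq> carrier Gcyc" using ring_hom_closed[OF phi_hom] by auto
  show "carrier Gcyc \<subseteq> phi ` carrier Wc"
  proof
    fix X assume "X \<in> carrier Gcyc"
    then obtain m where m: "m \<in> carrier Wd" "X = modI m"
      unfolding Gcyc_eq quot_superalg_simps FactRing_def partial_object.simps A_RCOSETS_def' by blast
    obtain u where u: "AW.wf u" "AW.src u = Xd" "AW.tgt u = Xd" "m = acl u"
      using m(1) by (rule Wd_E)
    have a: "LAW.wf (attach u)" "LAW.src (attach u) = w0" "LAW.tgt (attach u) = w0"
      using attach_wf[OF u(1)] u(2,3) by (simp_all add: qword_def)
    \<comment> \<open>Stripping the label leaves the identity of the empty word as the left tensor
      factor.\<close>
    have "meqA (proj (attach u)) u"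
      using AW.tens_unit_left[OF u(1)] by simp
    then have "cyc (attach u) = X" unfolding cyc_def m(2) u(4) by (simp only: mcls_eqI)
    then have "X = phi (elt0 (attach u))" using phi_elt0[OF a] by simp
    then show "X \<in> phi ` carrier Wc" using elt0_closed[OF a] by (rule image_eqI)
  qed
qed

text \<open>A generator of the ideal sits at a word other than \<open>w0\<close>, so its corner
  entry is zero. Conversely, if the corner \<open>t\<close> of \<open>M\<close> projects into the
  cyclotomic ideal, then modulo killed words \<open>t\<close> equals \<open>attach (proj t)\<close>,
  which equals \<open>attach\<close> of zero by \<open>acong_attach\<close>; and \<open>M\<close>
  has the same coset as its corner.\<close>

lemma phi_kernel: "Jcyc = a_kernel Wc Gcyc phi"
proof
  interpret ring_hom_ring Wc Gcyc phi
    by (rule ring_hom_ringI2[OF Wc.ring_axioms Gcyc_ring phi_hom])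
  have "gens \<subseteq> a_kernel Wc Gcyc phi"
  proof
    fix M assume M: "M \<in> gens"
    then obtain w where w: "w \<in> Words" "hd w = Istr" "M = elt w w (IdM lcat w)"
      unfolding gens_eq by blast
    then have "w0 \<noteq> w" by (auto simp: qword_def)
    then have "phi M = \<zero>\<^bsub>Gcyc\<^esub>"
      using w w0_Words by (simp add: phi_def elem_mor_def cyc_mor_zero)
    then show "M \<in> a_kernel Wc Gcyc phi"
      using M gens_closed unfolding a_kernel_def' by blast
  qed
  then show "Jcyc \<subseteq> a_kernel Wc Gcyc phi"
    unfolding Jcyc_def by (rule Wc.genideal_minimal[OF kernel_is_ideal])
  show "a_kernel Wc Gcyc phi \<subseteq> Jcyc"
  proof
    fix M assume "M \<in> a_kernel Wc Gcyc phi"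
    then have M: "M \<in> carrier Wc" "phi M = \<zero>\<^bsub>Gcyc\<^esub>" unfolding a_kernel_def' by blast+
    obtain t where t: "LAW.wf t" "LAW.src t = w0" "LAW.tgt t = w0" "M w0 w0 = lcl t"
      using Wc_entry[OF M(1) w0_Words w0_Words] by (rule LAW.MorE)
    have u: "AW.wf (proj t)" "AW.src (proj t) = Xd" "AW.tgt (proj t) = Xd"
      using t by (simp_all add: proj_wf)
    have "cyc t = Icyc" using M(2) t by (simp add: phi_def cyc_mor_mcls Gcyc_eq FactRing_def)
    then have "acl (proj t) \<in> Icyc"
      using Wd.coset_zero_iff[OF cyc_ideal proj_Wd[OF t(1-3)]] by (simp add: cyc_def)
    then have "acong (proj t) (MZero Xd Xd)" by (rule genideal_acong[OF u])
    have "lcong t (attach (proj t))" by (rule lcong_attach[OF t(1-3)])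
    also have "lcong \<dots> (attach (MZero Xd Xd))" by (rule acong_attach) fact
    also have "meqL \<dots> (MZero w0 w0)"
      using attach_zero[of Xd Xd] by (simp add: qword_def)
    finally have "lcong t (MZero w0 w0)" .
    from lcong_coset[OF this t(2,3)]
    have "modJ elt0 t = modJ \<zero>\<^bsub>Wc\<^esub>"
      using elt_zero[of w0 w0] by (simp add: LAW.pcat_simps)
    also have "\<dots> = Jcyc"
      using Wc.coset_zero_iff[OF Jcyc_ideal Wc.zero_closed] Jcyc_zero by simp
    finally have "modJ M = Jcyc" using coset_corner[OF M(1)] t(4) by simp
    then show "M \<in> Jcyc" using Wc.coset_zero_iff[OF Jcyc_ideal M(1)] by simp
  qed
qed

lemma phi_scale:
  assumes "c \<in> carrier R" "M \<in> carrier Wc"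
  shows "phi (c \<odot>\<^bsub>Wc\<^esub> M) = c \<odot>\<^bsub>Gcyc\<^esub> phi M"
proof -
  have "(c \<odot>\<^bsub>Wc\<^esub> M) w0 w0 = ScaleM lcat w0 w0 c (M w0 w0)"
    using w0_Words by (simp add: Wc_alg Add_simps)
  then show ?thesis
    using assms w0_Words by (simp add: phi_def cyc_mor_scale Wc_entry)
qed

text \<open>Parity in a presented category is witnessed by a homogeneous representative;
  \<open>phi\<close> may be computed from that one, and \<open>proj\<close> keeps its
  parity.\<close>

lemma phi_hpart:
  assumes "M \<in> hpart Wc p" shows "M \<in> carrier Wc \<and> phi M \<in> hpart Gcyc p"
proof
  have M: "M = restrict2 Words Words M" "\<And>v w. v \<in> Words \<Longrightarrow> w \<in> Words \<Longrightarrow> M v w \<in> MorP lcat w v p"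
    using assms by (auto simp: Wc_alg Add_def)
  have "MorP lcat w v p \<subseteq> Mor lcat w v" for w v
    by (auto simp: presented_supercat_def)
  then have "\<forall>v\<in>Words. \<forall>w\<in>Words. M v w \<in> Mor lcat w v" using M(2) by blast
  then show "M \<in> carrier Wc" using M(1) by (simp add: Wc_alg Add_simps)
  obtain t where t: "LAW.wf t" "LAW.src t = w0" "LAW.tgt t = w0" "mhomog lawp t p" "M w0 w0 = lcl t"
    using M(2)[OF w0_Words w0_Words] by (auto simp: presented_supercat_def)
  have "acl (proj t) \<in> hpart Wd p"
    using t proj_wf[OF t(1)] proj_homog[OF t(4)]
    by (auto simp: W_aff_def AW_def presented_supercat_def intro!: exI[of _ "proj t"])
  then show "phi M \<in> hpart Gcyc p"
    using t by (simp add: phi_def cyc_mor_mcls cyc_def Gcyc_eq)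
qed

lemma cyclotomic_iso:
  "superalg_iso R (W_cyc_words R A d [Q]) Gcyc (\<lambda>X. the_elem (phi ` X))"
  using Wc.quot_superalg_iso[OF phi_hom Gcyc_ring phi_surj phi_scale phi_hpart phi_kernel]
  by (simp add: W_cyc_words_def Jcyc_def)

end

theorem theorem5p34:
  fixes R :: "('k, 'r) ring_scheme"
    and A :: "('k, 'a, 'm) frobenius_scheme"
    and d :: nat
    and Q :: "('k, 'a polgen) aterm set"
  assumes "frobenius_superalgebra R A"
    and "d \<ge> 1"
    and "Q \<in> ECR R (Pol R A 1)"
  shows "\<exists>\<phi>. superalg_iso R (W_cyc_words R A d [Q]) (W_cyclotomic R A d Q) \<phi>"
proof -
  interpret frobenius_superalgebra R A by fact
  interpret cyclotomic_level R A Q d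
    by unfold_locales (use assms in auto)
  show ?thesis using cyclotomic_iso by blast
qed

end
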